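(* Consider the complex-valued Gaussian interference channel with unilateral source cooperation $$Y_1=\sqrt{\mathsf S_1}\,X_1+\sqrt{\mathsf I_2}\,e^{\mathrm j\theta_2}X_2+Z_1,\qquad Y_2=\sqrt{\mathsf I_1}\,e^{\mathrm j\theta_1}X_1+\sqrt{\mathsf S_2}\,X_2+Z_2,\qquad Y_{\mathsf{F2}}=Y_{\mathsf f}=\sqrt{\mathsf C}\,X_1+Z_{\mathsf f},$$ where $\theta_1,\theta_2\in\mathbb R$ and $\mathsf S_1,\mathsf S_2,\mathsf I_1,\mathsf I_2,\mathsf C$ are constants all larger than one, the noises $Z_1,Z_2,Z_{\mathsf f}$ are mutually independent, zero-mean, unit-variance complex Gaussian, and the inputs satisfy the average power constraints $\mathbb E[|X_1|^2]\le 1$, $\mathbb E[|X_2|^2]\le 1$. Then every rate pair $(R_1,R_2)$ in the capacity region satisfies $$\begin{aligned}2R_1+R_2\le{}&\log\Big(1+\big(\sqrt{\mathsf S_1}+\sqrt{\mathsf I_2}\big)^2\Big)+\log(1+\mathsf C)+\log(2)\\&+\log\Big(1+\frac{\mathsf S_1}{1+\mathsf I_1+\mathsf C}\Big)+\log\Big(1+\frac{\mathsf I_1}{\mathsf C}+\frac{\mathsf S_2}{\mathsf I_2}\Big)\end{aligned}$$ and $$\begin{aligned}R_1+2R_2\le{}&\log\Big(1+\big(\sqrt{\mathsf S_2}+\sqrt{\mathsf I_1}\big)^2\Big)+\log\Big(1+\frac{\mathsf S_2}{1+\mathsf I_2}\Big)\\&+\log\Big(1+\mathsf I_2+\frac{\mathsf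 S_1+\mathsf C+\mathsf I_2\mathsf C+2\sqrt{\mathsf S_1\mathsf I_2}}{1+\mathsf I_1}\Big).\end{aligned}$$
   Context: Codes and capacity. For $u\in\{1,2\}$, transmitter $u$ has a message $W_u$ for receiver $u$; $W_1,W_2$ are independent and $W_u$ is uniform on $[1:2^{NR_u}]$, where $N$ is the block length and $R_u$ the rate in bits per channel use. At time $i\in[1:N]$, transmitter 1 sends $X_{1i}(W_1)$ and transmitter 2 (full-duplex) sends $X_{2i}(W_2,Y_{\mathsf{F2}}^{i-1})$, a function of its message and its past channel observations. The channel is memoryless (noises are i.i.d. over time). After time $N$, receiver $u$ outputs an estimate $\widehat W_u(Y_u^N)$. The power constraints are understood as average constraints over the block. A rate pair is $\epsilon$-achievable if there is a sequence of codes indexed by $N$ with $\max_{u}\mathbb P[\widehat W_u\neq W_u]\le\epsilon$; the capacity region is the largest non-negative rate region that is $\epsilon$-achievable for every $\epsilon>0$. Logarithms are in base 2; complex Gaussian means circularly symmetric. *)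

theory Defs
  imports "HOL-Probability.Probability"
begin

text \<open>
  \<open>snr\<^sub>u\<close> is the gain of the direct link of user \<open>u\<close>, \<open>inr\<^sub>u\<close> the gain of the interfering link that
  starts at transmitter \<open>u\<close> (and ends at the other receiver), \<open>phase\<^sub>u\<close> the phase of that
  interfering link, and \<open>coop\<close> the gain of the link from transmitter 1 to transmitter 2.
\<close>

record channel =
  snr1 :: real
  snr2 :: real
  inr1 :: real
  inr2 :: real
  coop :: real
  phase1 :: real
  phase2 :: real

text \<open>
  The circularly symmetric complex Gaussian law with mean 0 and variance \<open>E |Z|\<^sup>2 = 1\<close>: real and
  imaginary part are independent, each of variance 1/2.
\<close>

definition std_complex_gaussian :: "complex measure" where
  "std_complex_gaussian =
     distr (density lborel (\<lambda>x. ennreal (normal_density 0 (1 / sqrt 2) x)) \<Otimes>\<^sub>M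
            density lborel (\<lambda>y. ennreal (normal_density 0 (1 / sqrt 2) y)))
       borel (\<lambda>(x, y). Complex x y)"

text \<open>
  A code consists of functions of exactly the data available at each terminal: \<open>enc1 i w\<close> is
  \<open>X\<^sub>1\<^sub>i(w)\<close>, and \<open>enc2 i w y\<close> is \<open>X\<^sub>2\<^sub>i(w, y)\<close>, where \<open>y\<close> is the vector \<open>(y 1, \<dots>, y (i - 1))\<close>. Vectors
  are functions on \<open>nat\<close> that are \<open>undefined\<close> off their index set, as in \<open>PiM\<close>.
\<close>

record code =
  enc1 :: "nat \<Rightarrow> nat \<Rightarrow> complex"
  enc2 :: "nat \<Rightarrow> nat \<Rightarrow> (nat \<Rightarrow> complex) \<Rightarrow> complex"
  dec1 :: "(nat \<Rightarrow> complex) \<Rightarrow> nat"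
  dec2 :: "(nat \<Rightarrow> complex) \<Rightarrow> nat"

text \<open>An outcome is \<open>(w\<^sub>1, w\<^sub>2, z\<^sub>1, z\<^sub>2, z\<^sub>f)\<close>: the two messages and the three noise sequences.\<close>

type_synonym outcome =
  "nat \<times> nat \<times> (nat \<Rightarrow> complex) \<times> (nat \<Rightarrow> complex) \<times> (nat \<Rightarrow> complex)"

definition noise_space :: "nat \<Rightarrow> (nat \<Rightarrow> complex) measure" where
  "noise_space N = PiM {1..N} (\<lambda>_. std_complex_gaussian)"

definition outcome_space :: "nat \<Rightarrow> nat \<Rightarrow> nat \<Rightarrow> outcome measure" where
  "outcome_space N M1 M2 =
     uniform_count_measure {1..M1} \<Otimes>\<^sub>M uniform_count_measure {1..M2} \<Otimes>\<^sub>M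
     noise_space N \<Otimes>\<^sub>M noise_space N \<Otimes>\<^sub>M noise_space N"

fun W1 :: "outcome \<Rightarrow> nat" where "W1 (w1, w2, z1, z2, zf) = w1"
fun W2 :: "outcome \<Rightarrow> nat" where "W2 (w1, w2, z1, z2, zf) = w2"
fun Z1 :: "nat \<Rightarrow> outcome \<Rightarrow> complex" where "Z1 i (w1, w2, z1, z2, zf) = z1 i"
fun Z2 :: "nat \<Rightarrow> outcome \<Rightarrow> complex" where "Z2 i (w1, w2, z1, z2, zf) = z2 i"
fun Zf :: "nat \<Rightarrow> outcome \<Rightarrow> complex" where "Zf i (w1, w2, z1, z2, zf) = zf i"

definition X1 :: "code \<Rightarrow> nat \<Rightarrow> outcome \<Rightarrow> complex" where
  "X1 c i \<omega> = enc1 c i (W1 \<omega>)"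

definition Yf :: "channel \<Rightarrow> code \<Rightarrow> nat \<Rightarrow> outcome \<Rightarrow> complex" where
  "Yf ch c i \<omega> = complex_of_real (sqrt (coop ch)) * X1 c i \<omega> + Zf i \<omega>"

definition X2 :: "channel \<Rightarrow> code \<Rightarrow> nat \<Rightarrow> outcome \<Rightarrow> complex" where
  "X2 ch c i \<omega> = enc2 c i (W2 \<omega>) (\<lambda>j\<in>{1..<i}. Yf ch c j \<omega>)"

definition Y1 :: "channel \<Rightarrow> code \<Rightarrow> nat \<Rightarrow> outcome \<Rightarrow> complex" where
  "Y1 ch c i \<omega> = complex_of_real (sqrt (snr1 ch)) * X1 c i \<omega>
     + complex_of_real (sqrt (inr2 ch)) * exp (\<i> * complex_of_real (phase2 ch)) * X2 ch c i \<omega>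
     + Z1 i \<omega>"

definition Y2 :: "channel \<Rightarrow> code \<Rightarrow> nat \<Rightarrow> outcome \<Rightarrow> complex" where
  "Y2 ch c i \<omega> =
       complex_of_real (sqrt (inr1 ch)) * exp (\<i> * complex_of_real (phase1 ch)) * X1 c i \<omega>
     + complex_of_real (sqrt (snr2 ch)) * X2 ch c i \<omega>
     + Z2 i \<omega>"

definition measurable_code :: "nat \<Rightarrow> code \<Rightarrow> bool" where
  "measurable_code N c \<longleftrightarrow>
     (\<forall>i\<in>{1..N}. \<forall>w. enc2 c i w \<in> PiM {1..<i} (\<lambda>_. borel) \<rightarrow>\<^sub>M borel) \<and>
     dec1 c \<in> PiM {1..N} (\<lambda>_. borel) \<rightarrow>\<^sub>M count_space UNIV \<and>
     dec2 c \<in> PiM {1..N} (\<lambda>_. borel) \<rightarrow>\<^sub>M count_space UNIV"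

text \<open>
  Expected power, averaged over the block. The nonnegative integral is used so that an input of
  infinite second moment violates the constraint.
\<close>

definition power_constraint :: "channel \<Rightarrow> nat \<Rightarrow> nat \<Rightarrow> nat \<Rightarrow> code \<Rightarrow> bool" where
  "power_constraint ch N M1 M2 c \<longleftrightarrow>
     (\<Sum>i=1..N. \<integral>\<^sup>+ \<omega>. ennreal ((cmod (X1 c i \<omega>))\<^sup>2) \<partial>outcome_space N M1 M2) / of_nat N \<le> 1 \<and>
     (\<Sum>i=1..N. \<integral>\<^sup>+ \<omega>. ennreal ((cmod (X2 ch c i \<omega>))\<^sup>2) \<partial>outcome_space N M1 M2) / of_nat N \<le> 1"

definition error1 :: "channel \<Rightarrow> nat \<Rightarrow> nat \<Rightarrow> nat \<Rightarrow> code \<Rightarrow> real" where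
  "error1 ch N M1 M2 c = measure (outcome_space N M1 M2)
     {\<omega> \<in> space (outcome_space N M1 M2). dec1 c (\<lambda>i\<in>{1..N}. Y1 ch c i \<omega>) \<noteq> W1 \<omega>}"

definition error2 :: "channel \<Rightarrow> nat \<Rightarrow> nat \<Rightarrow> nat \<Rightarrow> code \<Rightarrow> real" where
  "error2 ch N M1 M2 c = measure (outcome_space N M1 M2)
     {\<omega> \<in> space (outcome_space N M1 M2). dec2 c (\<lambda>i\<in>{1..N}. Y2 ch c i \<omega>) \<noteq> W2 \<omega>}"

text \<open>The number of integers in \<open>[1 : 2\<^sup>N\<^sup>R]\<close>, where \<open>2\<^sup>N\<^sup>R\<close> need not be an integer.\<close>

definition num_messages :: "nat \<Rightarrow> real \<Rightarrow> nat" where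
  "num_messages N R = nat \<lfloor>2 powr (real N * R)\<rfloor>"

text \<open>The requirements on a sequence of codes are asymptotic, i.e. for all large block lengths.\<close>

definition eps_achievable :: "channel \<Rightarrow> real \<Rightarrow> real \<Rightarrow> real \<Rightarrow> bool" where
  "eps_achievable ch \<epsilon> R1 R2 \<longleftrightarrow>
     (\<exists>c :: nat \<Rightarrow> code. \<forall>\<^sub>F N in sequentially.
        (let M1 = num_messages N R1; M2 = num_messages N R2 in
          measurable_code N (c N) \<and>
          power_constraint ch N M1 M2 (c N) \<and>
          max (error1 ch N M1 M2 (c N)) (error2 ch N M1 M2 (c N)) \<le> \<epsilon>))"

definition capacity_region :: "channel \<Rightarrow> (real \<times> real) set" where
  "capacity_region ch = {(R1, R2). 0 \<le> R1 \<and> 0 \<le> R2 \<and> (\<forall>\<epsilon>>0. eps_achievable ch \<epsilon> R1 R2)}"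

end

theory Submission
  imports Defs
begin

text \<open>
  Write \<open>T1 = Y2 - sqrt S2 X2\<close> and \<open>T2 = Y1 - sqrt S1 X1\<close> for the noisy interference at the two
  receivers. In terms of differential entropies of blocks, the bound on \<open>2 R1 + R2\<close> adds Fano's inequality
  for \<open>I(W1; Y1)\<close>, \<open>I(W1; Y1, T1, Yf | W2)\<close> and \<open>I(W2; Y2, T2, Yf)\<close>, using
  \<open>h(T2 | Yf) = h(T2 | Yf, W1) \<le> h(T2 | W1)\<close>. The bound on \<open>R1 + 2 R2\<close> adds it for \<open>I(W2; Y2)\<close>,
  \<open>I(W2; Y2, T2, Yf | W1)\<close> and \<open>I(W1; Y1, Yf, T1)\<close>; here \<open>h(Y2 | W2)\<close> is bounded from below by the
  entropy of \<open>T1\<close> causally conditioned on \<open>Yf\<close>, the sum of all \<open>h(T1 i | T1 1, \<dots>, T1 (i - 1), Yf 1, \<dots>, Yf (i - 1))\<close>.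

  No entropy is ever formed. Each mutual information is replaced by a ratio of explicit densities (finite
  mixtures of Gaussian product densities), multiplied by a factor that rewards correct decoding, which has
  expectation at most 1. The sum of the logarithms of the three ratios telescopes to explicit
  Gaussian terms, and \<open>ln r \<le> r - 1\<close> turns it into a bound on the message sizes. The Gaussian reference densities
  have fixed variances, so that the power constraints enter only through second moments of
  linear estimation errors.
\<close>

section \<open>Complex Gaussian densities\<close>

text \<open>The obstacle is cooperation: \<open>X2\<close> depends on the past of \<open>Yf\<close>,
  so \<open>W2\<close> and \<open>Y2\<close> do not reveal \<open>T1\<close>, and
  \<open>h(Y2 | W2)\<close> is not \<open>h(T1)\<close>. Conditioning it on the whole of
  \<open>Yf\<close> would remove \<open>X2\<close>, but the third mutual information would then
  leave \<open>h(Yf)\<close>, which costs \<open>log(1 + C)\<close> as in the first bound. Causal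
  conditioning also removes \<open>X2\<close>, since time \<open>i\<close> needs only the feedback
  before \<open>i\<close>, and it leaves the entropies of \<open>Yf i\<close> given its past and
  \<open>T1 1, ..., T1 i\<close>, which cost only \<open>log(1 + C / (1 + I1))\<close>. Density
  ratios are used because logarithms of mixtures have no evident integrability: the mixtures cancel
  pointwise before any expectation is taken. Since residual energies add up over time, the block
  power constraint applies directly, without reduction to a single letter. Estimators of least mean
  square error for unit power give quotients such as \<open>S1 / (1 + I1 + C)\<close>; zero forcing,
  which cancels both inputs, gives \<open>1 + I1 / C + S2 / I2\<close>.\<close>

lemma measurable_Complex [measurable]:
  "(\<lambda>(x, y). Complex x y) \<in> borel \<Otimes>\<^sub>M borel \<rightarrow>\<^sub>M borel"
proof -
  have "(\<lambda>p::real \<times> real. complex_of_real (fst p) + \<i> * complex_of_real (snd p)) \<in> borel_measurable (borel \<Otimes>\<^sub>M borel)"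
    by measurable
  then show ?thesis
    by (simp add: Complex_eq split_beta' add.commute)
qed

text \<open>The noise law is defined by its real and imaginary parts. Splitting Lebesgue measure on
  \<open>complex\<close> in the same way gives it a density.\<close>

lemma lborel_complex_eq:
  "(lborel :: complex measure) = distr (lborel \<Otimes>\<^sub>M lborel) borel (\<lambda>(x, y). Complex x y)"
proof (rule lborel_eqI)
  fix l u :: complex
  assume le: "\<And>b. b \<in> Basis \<Longrightarrow> l \<bullet> b \<le> u \<bullet> b"
  have le': "Re l \<le> Re u" "Im l \<le> Im u"
    using le[of 1] le[of \<i>] by (auto simp: Basis_complex_def)
  have vim: "(\<lambda>(x, y). Complex x y) -` box l u = {Re l<..<Re u} \<times> {Im l<..<Im u}"
    by (auto simp: box_def Basis_complex_def)
  have "emeasure (distr (lborel \<Otimes>\<^sub>M lborel) borel (\<lambda>(x, y). Complex x y)) (box l u)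
      = emeasure (lborel \<Otimes>\<^sub>M lborel) ({Re l<..<Re u} \<times> {Im l<..<Im u})"
    by (subst emeasure_distr) (auto simp: space_pair_measure vim)
  also have "\<dots> = ennreal (Re u - Re l) * ennreal (Im u - Im l)"
    using le' by (subst lborel.emeasure_pair_measure_Times) auto
  also have "\<dots> = (\<Prod>b\<in>Basis. (u - l) \<bullet> b)"
    using le' by (simp add: Basis_complex_def ennreal_mult)
  finally show "emeasure (distr (lborel \<Otimes>\<^sub>M lborel) borel (\<lambda>(x, y). Complex x y)) (box l u)
      = ennreal (\<Prod>b\<in>Basis. (u - l) \<bullet> b)" .
qed simp

text \<open>\<open>v\<close> is the whole variance \<open>E |Z|^2\<close>; real and imaginary part
  have variance \<open>v / 2\<close> each, whence the constant \<open>pi * v\<close>.\<close>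

definition gauss_density :: "real \<Rightarrow> complex \<Rightarrow> real" where
  "gauss_density v z = exp (- (cmod z)\<^sup>2 / v) / (pi * v)"

lemma gauss_density_measurable [measurable]: "gauss_density v \<in> borel_measurable borel"
  unfolding gauss_density_def by measurable

lemma gauss_density_pos: "v > 0 \<Longrightarrow> gauss_density v z > 0"
  by (simp add: gauss_density_def)

lemma gauss_density_uminus [simp]: "gauss_density v (- z) = gauss_density v z"
  by (simp add: gauss_density_def)

lemma ln_gauss_density:
  "v > 0 \<Longrightarrow> ln (gauss_density v z) = - (cmod z)\<^sup>2 / v - ln pi - ln v"
  by (simp add: gauss_density_def ln_div ln_mult)

lemma gauss_density_Complex:
  assumes "v > 0"
  shows "gauss_density v (Complex x y) =
    normal_density 0 (sqrt (v / 2)) x * normal_density 0 (sqrt (v / 2)) y"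
proof -
  have "(sqrt (v / 2))\<^sup>2 = v / 2" using assms by simp
  then show ?thesis
    using assms
    by (simp add: gauss_density_def normal_density_def cmod_power2 add_divide_distrib
        mult_exp_exp field_simps)
qed

lemma nn_integral_lborel_complex:
  fixes f :: "complex \<Rightarrow> ennreal"
  assumes [measurable]: "f \<in> borel_measurable borel"
  shows "(\<integral>\<^sup>+z. f z \<partial>lborel) = (\<integral>\<^sup>+x. \<integral>\<^sup>+y. f (Complex x y) \<partial>lborel \<partial>lborel)"
proof -
  have "(\<integral>\<^sup>+z. f z \<partial>lborel) = (\<integral>\<^sup>+p. f (case p of (x, y) \<Rightarrow> Complex x y) \<partial>(lborel \<Otimes>\<^sub>M lborel))"
    by (subst lborel_complex_eq, subst nn_integral_distr) auto
  also have "\<dots> = (\<integral>\<^sup>+x. \<integral>\<^sup>+y. f (Complex x y) \<partial>lborel \<partial>lborel)"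
    by (subst lborel.nn_integral_fst[symmetric]) auto
  finally show ?thesis .
qed

lemma nn_integral_normal_density:
  "\<sigma> > 0 \<Longrightarrow> (\<integral>\<^sup>+x. ennreal (normal_density 0 \<sigma> x) \<partial>lborel) = 1"
  by (subst nn_integral_eq_integral) (auto simp: integral_normal_density)

lemma nn_integral_gauss_density:
  assumes "v > 0"
  shows "(\<integral>\<^sup>+z. ennreal (gauss_density v z) \<partial>lborel) = 1"
  using assms
  by (simp add: nn_integral_lborel_complex gauss_density_Complex ennreal_mult normal_density_nonneg
      nn_integral_cmult nn_integral_multc nn_integral_normal_density)

lemma nn_integral_normal_second_moment:
  assumes "\<sigma> > 0"
  shows "(\<integral>\<^sup>+x. ennreal (normal_density 0 \<sigma> x * x\<^sup>2) \<partial>lborel) = ennreal (\<sigma>\<^sup>2)"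
proof -
  note m = normal_moment_even[OF assms, of 0 1]
  have "(\<integral>\<^sup>+x. ennreal (normal_density 0 \<sigma> x * x\<^sup>2) \<partial>lborel)
      = ennreal (\<integral>x. normal_density 0 \<sigma> x * x\<^sup>2 \<partial>lborel)"
    using m by (intro nn_integral_eq_integral)
      (auto simp: has_bochner_integral_iff normal_density_nonneg)
  also have "(\<integral>x. normal_density 0 \<sigma> x * x\<^sup>2 \<partial>lborel) = \<sigma>\<^sup>2"
    using m assms by (auto simp: has_bochner_integral_iff fact_2)
  finally show ?thesis .
qed

lemma nn_integral_gauss_second_moment:
  "(\<integral>\<^sup>+z. ennreal ((cmod z)\<^sup>2) * ennreal (gauss_density 1 z) \<partial>lborel) = 1"
proof -
  define \<phi> where "\<phi> x = normal_density 0 (sqrt (1 / 2)) x" for x :: real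
  have [measurable]: "\<phi> \<in> borel_measurable borel" unfolding \<phi>_def by measurable
  have \<phi>0: "\<phi> x \<ge> 0" for x by (simp add: \<phi>_def normal_density_nonneg)
  have \<phi>1: "(\<integral>\<^sup>+x. ennreal (\<phi> x) \<partial>lborel) = 1"
    unfolding \<phi>_def by (rule nn_integral_normal_density) simp
  have \<phi>2: "(\<integral>\<^sup>+x. ennreal (\<phi> x * x\<^sup>2) \<partial>lborel) = ennreal (1 / 2)"
    unfolding \<phi>_def by (subst nn_integral_normal_second_moment) (auto simp: power_divide)
  have eq: "ennreal ((cmod (Complex x y))\<^sup>2) * ennreal (gauss_density 1 (Complex x y))
      = ennreal (\<phi> x * x\<^sup>2) * ennreal (\<phi> y) + ennreal (\<phi> x) * ennreal (\<phi> y * y\<^sup>2)" for x y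
    using \<phi>0[of x] \<phi>0[of y]
    by (simp add: gauss_density_Complex cmod_power2 \<phi>_def[symmetric] ennreal_mult[symmetric]
        ennreal_plus[symmetric] algebra_simps del: ennreal_plus)
  have "(\<integral>\<^sup>+z. ennreal ((cmod z)\<^sup>2) * ennreal (gauss_density 1 z) \<partial>lborel) = ennreal (1/2) + ennreal (1/2)"
    by (subst nn_integral_lborel_complex)
      (simp_all add: eq nn_integral_add nn_integral_cmult nn_integral_multc \<phi>1 \<phi>2)
  also have "\<dots> = 1"
    by (subst ennreal_plus[symmetric]) auto
  finally show ?thesis .
qed

lemma std_complex_gaussian_eq: "std_complex_gaussian = density lborel (\<lambda>z. ennreal (gauss_density 1 z))"
proof -
  let ?n = "\<lambda>x. ennreal (normal_density 0 (1 / sqrt 2) x)"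
  have fin: "sigma_finite_measure (density lborel ?n)"
    by (intro prob_space_imp_sigma_finite prob_space_normal_density) simp
  have "std_complex_gaussian =
      distr (density (lborel \<Otimes>\<^sub>M lborel) (\<lambda>(x, y). ?n x * ?n y)) borel (\<lambda>(x, y). Complex x y)"
    unfolding std_complex_gaussian_def
    by (subst pair_measure_density) (auto simp: fin lborel.sigma_finite_measure_axioms)
  also have "(\<lambda>(x, y). ?n x * ?n y) = (\<lambda>p. ennreal (gauss_density 1 (case p of (x, y) \<Rightarrow> Complex x y)))"
    by (auto simp: fun_eq_iff gauss_density_Complex ennreal_mult normal_density_nonneg real_sqrt_divide)
  also have "distr (density (lborel \<Otimes>\<^sub>M lborel) \<dots>) borel (\<lambda>(x, y). Complex x y)
     = density lborel (\<lambda>z. ennreal (gauss_density 1 z))"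
    by (subst lborel_complex_eq, subst density_distr) auto
  finally show ?thesis .
qed

lemma sets_std_complex_gaussian [measurable_cong, simp]: "sets std_complex_gaussian = sets borel"
  by (simp add: std_complex_gaussian_eq)

lemma space_std_complex_gaussian [simp]: "space std_complex_gaussian = UNIV"
  by (simp add: std_complex_gaussian_eq)

lemma prob_space_std_complex_gaussian: "prob_space std_complex_gaussian"
  by (rule prob_spaceI) (simp add: std_complex_gaussian_eq emeasure_density nn_integral_gauss_density)

lemma nn_integral_lborel_translate:
  fixes f :: "'a::euclidean_space \<Rightarrow> ennreal"
  assumes [measurable]: "f \<in> borel_measurable borel"
  shows "(\<integral>\<^sup>+z. f (a + z) \<partial>lborel) = (\<integral>\<^sup>+z. f z \<partial>lborel)"
  by (subst (2) lborel_affine[of 1 a]) (auto simp: nn_integral_density nn_integral_distr)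

lemma nn_integral_lborel_uminus:
  fixes f :: "'a::euclidean_space \<Rightarrow> ennreal"
  assumes [measurable]: "f \<in> borel_measurable borel"
  shows "(\<integral>\<^sup>+z. f (- z) \<partial>lborel) = (\<integral>\<^sup>+z. f z \<partial>lborel)"
  by (subst (2) lborel_affine[of "-1" 0]) (auto simp: nn_integral_density nn_integral_distr)

lemma nn_integral_std_complex_gaussian:
  assumes [measurable]: "f \<in> borel_measurable borel"
  shows "(\<integral>\<^sup>+z. f z \<partial>std_complex_gaussian) = (\<integral>\<^sup>+z. f z * ennreal (gauss_density 1 z) \<partial>lborel)"
  by (simp add: std_complex_gaussian_eq nn_integral_density mult.commute)

text \<open>Since the law is symmetric, the parallelogram law removes the cross term.\<close>

lemma std_complex_gaussian_cmod_affine: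
  "(\<integral>\<^sup>+z. ennreal ((cmod (a + c * z))\<^sup>2) \<partial>std_complex_gaussian)
     = ennreal ((cmod a)\<^sup>2) + ennreal ((cmod c)\<^sup>2)"
proof -
  let ?\<mu> = std_complex_gaussian
  let ?I = "\<lambda>s. \<integral>\<^sup>+z. ennreal ((cmod (a + s * c * z))\<^sup>2) \<partial>?\<mu>"
  interpret prob_space ?\<mu> by (rule prob_space_std_complex_gaussian)
  have sym: "?I (-1) = ?I 1"
    using nn_integral_lborel_uminus[of "\<lambda>z. ennreal ((cmod (a + c * z))\<^sup>2) * ennreal (gauss_density 1 z)"]
    by (simp add: nn_integral_std_complex_gaussian)
  have par: "ennreal ((cmod (a + 1 * c * z))\<^sup>2) + ennreal ((cmod (a + (-1) * c * z))\<^sup>2)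
      = 2 * ennreal ((cmod a)\<^sup>2) + 2 * ennreal ((cmod c)\<^sup>2) * ennreal ((cmod z)\<^sup>2)" for z
  proof -
    have "(cmod (a + w))\<^sup>2 + (cmod (a - w))\<^sup>2 = 2 * (cmod a)\<^sup>2 + 2 * (cmod w)\<^sup>2" for w
      unfolding cmod_power2 by (simp add: power2_sum power2_diff)
    from this[of "c * z"] have "(cmod (a + 1 * c * z))\<^sup>2 + (cmod (a + (-1) * c * z))\<^sup>2
        = 2 * (cmod a)\<^sup>2 + 2 * (cmod c)\<^sup>2 * (cmod z)\<^sup>2"
      by (simp add: norm_mult power_mult_distrib)
    then show ?thesis
      by (simp add: ennreal_plus[symmetric] ennreal_mult'[symmetric] mult.assoc numeral_mult_ennreal
          del: ennreal_plus)
  qed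
  have z2: "(\<integral>\<^sup>+z. ennreal ((cmod z)\<^sup>2) \<partial>?\<mu>) = 1"
    by (simp add: nn_integral_std_complex_gaussian nn_integral_gauss_second_moment)
  have "2 * ?I 1 = ?I 1 + ?I (-1)" by (simp only: sym mult_2)
  also have "\<dots> = (\<integral>\<^sup>+z. 2 * ennreal ((cmod a)\<^sup>2) + 2 * ennreal ((cmod c)\<^sup>2) * ennreal ((cmod z)\<^sup>2) \<partial>?\<mu>)"
    unfolding par[symmetric] by (rule nn_integral_add[symmetric]) measurable
  also have "\<dots> = 2 * (ennreal ((cmod a)\<^sup>2) + ennreal ((cmod c)\<^sup>2))"
    using emeasure_space_1 by (simp add: nn_integral_add nn_integral_cmult z2 distrib_left)
  finally have "2 * ?I 1 = 2 * (ennreal ((cmod a)\<^sup>2) + ennreal ((cmod c)\<^sup>2))" .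
  then show ?thesis
    by (subst (asm) ennreal_mult_cancel_left) auto
qed

section \<open>Vectors of complex numbers and Gaussian noise\<close>

declare One_nat_def [simp del]

abbreviation vec_lborel :: "nat \<Rightarrow> (nat \<Rightarrow> complex) measure" where
  "vec_lborel N \<equiv> PiM {1..N} (\<lambda>_. lborel)"

interpretation vec: product_sigma_finite "\<lambda>_::nat. lborel :: complex measure"
  by standard

lemma sigma_finite_vec_lborel: "sigma_finite_measure (vec_lborel N)"
  by (rule vec.sigma_finite) simp

definition vec_gauss :: "nat \<Rightarrow> real \<Rightarrow> (nat \<Rightarrow> complex) \<Rightarrow> real" where
  "vec_gauss N v r = (\<Prod>i\<in>{1..N}. gauss_density v (r i))"

lemma vec_gauss_measurable [measurable (raw)]:
  assumes [measurable]: "\<And>i. i \<in> {1..N} \<Longrightarrow> (\<lambda>x. r x i) \<in> borel_measurable M"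
  shows "(\<lambda>x. vec_gauss N v (r x)) \<in> borel_measurable M"
  unfolding vec_gauss_def by measurable

lemma vec_gauss_pos: "v > 0 \<Longrightarrow> vec_gauss N v r > 0"
  by (simp add: vec_gauss_def prod_pos gauss_density_pos)

lemma vec_gauss_cong: "(\<And>i. i \<in> {1..N} \<Longrightarrow> r i = s i) \<Longrightarrow> vec_gauss N v r = vec_gauss N v s"
  by (simp add: vec_gauss_def)

lemma vec_gauss_mult_Suc:
  "vec_gauss (Suc N) v r = vec_gauss N v r * gauss_density v (r (Suc N))"
  by (simp add: vec_gauss_def)

lemma ln_vec_gauss:
  assumes "v > 0"
  shows "ln (vec_gauss N v r) = (\<Sum>i\<in>{1..N}. - (cmod (r i))\<^sup>2 / v - ln pi - ln v)"
  unfolding vec_gauss_def using assms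
  by (subst ln_prod) (auto simp: ln_gauss_density gauss_density_pos less_imp_neq[symmetric])

lemma nn_integral_vec_gauss:
  assumes "v > 0"
  shows "(\<integral>\<^sup>+z. ennreal (vec_gauss N v (\<lambda>i. a i + z i)) \<partial>vec_lborel N) = 1"
proof -
  have "(\<integral>\<^sup>+z. ennreal (vec_gauss N v (\<lambda>i. a i + z i)) \<partial>vec_lborel N)
      = (\<integral>\<^sup>+z. (\<Prod>i\<in>{1..N}. ennreal (gauss_density v (a i + z i))) \<partial>vec_lborel N)"
    using gauss_density_pos[OF assms] by (simp add: vec_gauss_def prod_ennreal less_imp_le)
  also have "\<dots> = (\<Prod>i\<in>{1..N}. \<integral>\<^sup>+x. ennreal (gauss_density v (a i + x)) \<partial>lborel)"
    by (rule vec.product_nn_integral_prod) auto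
  also have "\<dots> = 1"
    using nn_integral_lborel_translate[of "\<lambda>z. ennreal (gauss_density v z)"]
    by (simp add: nn_integral_gauss_density[OF assms])
  finally show ?thesis .
qed

lemma nn_integral_vec_translate:
  assumes [measurable]: "f \<in> borel_measurable (vec_lborel N)"
  shows "(\<integral>\<^sup>+z. f (\<lambda>i\<in>{1..N}. a i + z i) \<partial>vec_lborel N) = (\<integral>\<^sup>+z. f z \<partial>vec_lborel N)"
proof -
  let ?T = "\<lambda>z. \<lambda>i\<in>{1..N}. a i + z i"
  let ?D = "distr (vec_lborel N) (vec_lborel N) ?T"
  have T [measurable]: "?T \<in> vec_lborel N \<rightarrow>\<^sub>M vec_lborel N" by measurable
  have "?D = vec_lborel N"
  proof (rule vec.PiM_eqI)
    fix A :: "nat \<Rightarrow> complex set"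
    assume A: "\<And>i. i \<in> {1..N} \<Longrightarrow> A i \<in> sets lborel"
    then have [measurable]: "Pi\<^sub>E {1..N} A \<in> sets (vec_lborel N)"
      by (intro sets_PiM_I_finite) auto
    have "emeasure ?D (Pi\<^sub>E {1..N} A) = (\<integral>\<^sup>+z. indicator (Pi\<^sub>E {1..N} A) (?T z) \<partial>vec_lborel N)"
    proof -
      have "emeasure ?D (Pi\<^sub>E {1..N} A) = (\<integral>\<^sup>+z. indicator (Pi\<^sub>E {1..N} A) z \<partial>?D)"
        by (rule nn_integral_indicator[symmetric]) simp
      also have "\<dots> = (\<integral>\<^sup>+z. indicator (Pi\<^sub>E {1..N} A) (?T z) \<partial>vec_lborel N)"
        by (rule nn_integral_distr) auto
      finally show ?thesis .
    qed
    also have "\<dots> = (\<integral>\<^sup>+z. (\<Prod>i\<in>{1..N}. indicator (A i) (a i + z i)) \<partial>vec_lborel N)"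
      by (intro nn_integral_cong) (auto simp: indicator_def PiE_iff)
    also have "\<dots> = (\<Prod>i\<in>{1..N}. \<integral>\<^sup>+x. indicator (A i) (a i + x) \<partial>lborel)"
      using A by (intro vec.product_nn_integral_prod) (auto simp del: space_borel)
    also have "\<dots> = (\<Prod>i\<in>{1..N}. emeasure lborel (A i))"
      using A by (intro prod.cong refl) (subst nn_integral_lborel_translate, auto)
    finally show "emeasure ?D (Pi\<^sub>E {1..N} A) = (\<Prod>i\<in>{1..N}. emeasure lborel (A i))" .
  qed auto
  then have "(\<integral>\<^sup>+z. f z \<partial>vec_lborel N) = (\<integral>\<^sup>+z. f z \<partial>?D)" by simp
  also have "\<dots> = (\<integral>\<^sup>+z. f (?T z) \<partial>vec_lborel N)"
    by (rule nn_integral_distr) auto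
  finally show ?thesis by simp
qed

lemma prob_space_noise_space: "prob_space (noise_space N)"
  unfolding noise_space_def by (intro prob_space_PiM prob_space_std_complex_gaussian)

lemma sets_noise_space [measurable_cong, simp]: "sets (noise_space N) = sets (vec_lborel N)"
  unfolding noise_space_def by (rule sets_PiM_cong) auto

lemma nn_integral_noise_space:
  assumes [measurable]: "f \<in> borel_measurable (vec_lborel N)"
  shows "(\<integral>\<^sup>+z. f z \<partial>noise_space N) = (\<integral>\<^sup>+z. f z * ennreal (vec_gauss N 1 z) \<partial>vec_lborel N)"
proof -
  interpret std_complex_gaussian: prob_space std_complex_gaussian
    by (rule prob_space_std_complex_gaussian)
  interpret noise: product_sigma_finite "\<lambda>_::nat. std_complex_gaussian" by standard
  let ?D = "density (vec_lborel N) (\<lambda>z. ennreal (vec_gauss N 1 z))"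
  have "?D = PiM {1..N} (\<lambda>_. std_complex_gaussian)"
  proof (rule noise.PiM_eqI)
    fix A :: "nat \<Rightarrow> complex set"
    assume A: "\<And>i. i \<in> {1..N} \<Longrightarrow> A i \<in> sets std_complex_gaussian"
    then have [measurable]: "Pi\<^sub>E {1..N} A \<in> sets (vec_lborel N)"
      by (intro sets_PiM_I_finite) auto
    have "emeasure ?D (Pi\<^sub>E {1..N} A)
        = (\<integral>\<^sup>+z. ennreal (vec_gauss N 1 z) * indicator (Pi\<^sub>E {1..N} A) z \<partial>vec_lborel N)"
      by (rule emeasure_density) auto
    also have "\<dots> = (\<integral>\<^sup>+z. (\<Prod>i\<in>{1..N}. ennreal (gauss_density 1 (z i)) * indicator (A i) (z i)) \<partial>vec_lborel N)"
    proof (rule nn_integral_cong)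
      fix z assume "z \<in> space (vec_lborel N)"
      then have "indicator (Pi\<^sub>E {1..N} A) z = (\<Prod>i\<in>{1..N}. indicator (A i) (z i) :: ennreal)"
        by (auto simp: indicator_def PiE_iff space_PiM)
      then show "ennreal (vec_gauss N 1 z) * indicator (Pi\<^sub>E {1..N} A) z
          = (\<Prod>i\<in>{1..N}. ennreal (gauss_density 1 (z i)) * indicator (A i) (z i))"
        by (simp add: vec_gauss_def prod.distrib prod_ennreal less_imp_le gauss_density_pos)
    qed
    also have "\<dots> = (\<Prod>i\<in>{1..N}. \<integral>\<^sup>+x. ennreal (gauss_density 1 x) * indicator (A i) x \<partial>lborel)"
      using A by (intro vec.product_nn_integral_prod) (auto simp del: space_borel)
    also have "\<dots> = (\<Prod>i\<in>{1..N}. emeasure std_complex_gaussian (A i))"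
      using A by (intro prod.cong refl) (simp add: std_complex_gaussian_eq emeasure_density)
    finally show "emeasure ?D (Pi\<^sub>E {1..N} A) = (\<Prod>i\<in>{1..N}. emeasure std_complex_gaussian (A i))" .
  qed (use sets_noise_space in \<open>auto simp: noise_space_def\<close>)
  then have "(\<integral>\<^sup>+z. f z \<partial>noise_space N) = (\<integral>\<^sup>+z. f z \<partial>?D)"
    by (simp add: noise_space_def)
  also have "\<dots> = (\<integral>\<^sup>+z. f z * ennreal (vec_gauss N 1 z) \<partial>vec_lborel N)"
    by (subst nn_integral_density) (auto simp: mult.commute)
  finally show ?thesis .
qed

text \<open>Kernel \<open>i\<close> sees only the coordinates up to \<open>i\<close> and is
  normalised in the last of them. Integrating out the coordinates from \<open>N\<close> down to 1
  removes the kernels one by one. Earlier coordinates may enter a kernel in any measurable way,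
  which is what feedback requires.\<close>

lemma nn_integral_causal_kernels:
  fixes \<kappa> :: "nat \<Rightarrow> (nat \<Rightarrow> complex) \<Rightarrow> ennreal"
  assumes meas: "\<And>i. i \<in> {1..N} \<Longrightarrow> \<kappa> i \<in> borel_measurable (vec_lborel i)"
    and causal: "\<And>i f. i \<in> {1..N} \<Longrightarrow> \<kappa> i (restrict f {1..i}) = \<kappa> i f"
    and one: "\<And>i f. i \<in> {1..N} \<Longrightarrow> (\<integral>\<^sup>+x. \<kappa> i (f(i := x)) \<partial>lborel) = 1"
  shows "(\<integral>\<^sup>+f. (\<Prod>i\<in>{1..N}. \<kappa> i f) \<partial>vec_lborel N) = 1"
  using assms
proof (induction N)
  case 0
  then show ?case by (simp add: space_PiM PiM_empty nn_integral_count_space_finite)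
next
  case (Suc n)
  have meas': "\<kappa> i \<in> borel_measurable (vec_lborel m)" if "i \<in> {1..Suc n}" "i \<le> m" for i m
  proof -
    have "(\<lambda>f. \<kappa> i (restrict f {1..i})) \<in> borel_measurable (vec_lborel m)"
      using that by (intro measurable_compose[OF measurable_restrict_subset Suc.prems(1)]) auto
    moreover have "(\<lambda>f. \<kappa> i (restrict f {1..i})) = \<kappa> i"
      using that(1) by (intro ext Suc.prems(2))
    ultimately show ?thesis by simp
  qed
  have pm: "(\<lambda>f. \<Prod>i\<in>{1..Suc n}. \<kappa> i f) \<in> borel_measurable (vec_lborel (Suc n))"
    using meas' by (intro borel_measurable_prod_ennreal) auto
  have ins: "{1..Suc n} = insert (Suc n) {1..n}" by auto
  have indep: "\<kappa> i (f(Suc n := x)) = \<kappa> i f" if "i \<in> {1..n}" for i f x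
  proof -
    have "restrict (f(Suc n := x)) {1..i} = restrict f {1..i}"
      using that by (auto simp: restrict_def fun_eq_iff)
    then show ?thesis using Suc.prems(2)[of i] that by (metis atLeastAtMost_iff le_SucI)
  qed
  have "(\<integral>\<^sup>+f. (\<Prod>i\<in>{1..Suc n}. \<kappa> i f) \<partial>vec_lborel (Suc n))
      = (\<integral>\<^sup>+f. (\<integral>\<^sup>+x. (\<Prod>i\<in>{1..Suc n}. \<kappa> i (f(Suc n := x))) \<partial>lborel) \<partial>vec_lborel n)"
    using pm unfolding ins by (intro vec.product_nn_integral_insert) auto
  also have "\<dots> = (\<integral>\<^sup>+f. (\<Prod>i\<in>{1..n}. \<kappa> i f) \<partial>vec_lborel n)"
  proof (rule nn_integral_cong)
    fix f assume f: "f \<in> space (vec_lborel n)"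
    have [measurable]: "(\<lambda>x. \<kappa> (Suc n) (f(Suc n := x))) \<in> borel_measurable lborel"
      using measurable_component_update[OF f, of "Suc n"] meas'[of "Suc n" "Suc n"]
      unfolding ins by (auto intro: measurable_compose)
    have "(\<Prod>i\<in>{1..Suc n}. \<kappa> i (f(Suc n := x))) = (\<Prod>i\<in>{1..n}. \<kappa> i f) * \<kappa> (Suc n) (f(Suc n := x))" for x
      by (simp add: indep)
    then have "(\<integral>\<^sup>+x. (\<Prod>i\<in>{1..Suc n}. \<kappa> i (f(Suc n := x))) \<partial>lborel)
        = (\<Prod>i\<in>{1..n}. \<kappa> i f) * (\<integral>\<^sup>+x. \<kappa> (Suc n) (f(Suc n := x)) \<partial>lborel)"
      by (simp add: nn_integral_cmult)
    then show "(\<integral>\<^sup>+x. (\<Prod>i\<in>{1..Suc n}. \<kappa> i (f(Suc n := x))) \<partial>lborel) = (\<Prod>i\<in>{1..n}. \<kappa> i f)"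
      using Suc.prems(3)[of "Suc n" f] by simp
  qed
  also have "\<dots> = 1"
    using Suc.prems by (intro Suc.IH) auto
  finally show ?case .
qed

text \<open>In its main use \<open>A\<close> is the signal at time \<open>i\<close>, which may
  depend on the noise before \<open>i\<close> but not on \<open>z i\<close>. Given the other
  coordinates, the cross term vanishes by symmetry of the law, so the powers add exactly.\<close>

lemma noise_cmod_affine:
  assumes A [measurable]: "A \<in> borel_measurable (vec_lborel N)"
    and i: "i \<in> {1..N}"
    and indep: "\<And>z x. A (z(i := x)) = A z"
  shows "(\<integral>\<^sup>+z. ennreal ((cmod (A z + c * z i))\<^sup>2) \<partial>noise_space N)
     = (\<integral>\<^sup>+z. ennreal ((cmod (A z))\<^sup>2) \<partial>noise_space N) + ennreal ((cmod c)\<^sup>2)"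
proof -
  interpret std_complex_gaussian: prob_space std_complex_gaussian
    by (rule prob_space_std_complex_gaussian)
  interpret noise: product_sigma_finite "\<lambda>_::nat. std_complex_gaussian" by standard
  let ?J = "{1..N} - {i}"
  let ?P = "PiM ?J (\<lambda>_. std_complex_gaussian)"
  have prob: "prob_space ?P" by (intro prob_space_PiM prob_space_std_complex_gaussian)
  have ins: "{1..N} = insert i ?J" using i by auto
  have split: "(\<integral>\<^sup>+z. g z \<partial>noise_space N) = (\<integral>\<^sup>+z. \<integral>\<^sup>+x. g (z(i := x)) \<partial>std_complex_gaussian \<partial>?P)"
    if "g \<in> borel_measurable (vec_lborel N)" for g
  proof -
    have "g \<in> borel_measurable (noise_space N)" using that by simp
    then show ?thesis unfolding noise_space_def
      by (subst ins, intro noise.product_nn_integral_insert) (simp_all only: ins[symmetric], auto)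
  qed
  have A': "A \<in> borel_measurable ?P"
  proof -
    \<comment> \<open>Inserting 0 at the missing coordinate is harmless, as \<open>A\<close> ignores
      that coordinate.\<close>
    have upd: "(\<lambda>z. z(i := 0)) \<in> ?P \<rightarrow>\<^sub>M PiM (insert i ?J) (\<lambda>_. std_complex_gaussian)"
      by (rule measurable_fun_upd[where J = ?J]) auto
    have "A \<in> borel_measurable (noise_space N)" by simp
    with upd have "(\<lambda>z. A (z(i := 0))) \<in> borel_measurable ?P"
      unfolding noise_space_def ins[symmetric] by (rule measurable_compose)
    then show ?thesis by (simp add: indep)
  qed
  have "(\<integral>\<^sup>+z. ennreal ((cmod (A z + c * z i))\<^sup>2) \<partial>noise_space N)
      = (\<integral>\<^sup>+z. ennreal ((cmod (A z))\<^sup>2) + ennreal ((cmod c)\<^sup>2) \<partial>?P)"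
    using i by (subst split) (auto simp: indep std_complex_gaussian_cmod_affine)
  also have "\<dots> = (\<integral>\<^sup>+z. ennreal ((cmod (A z))\<^sup>2) \<partial>?P) + ennreal ((cmod c)\<^sup>2)"
    using A' prob_space.emeasure_space_1[OF prob] by (subst nn_integral_add) auto
  also have "(\<integral>\<^sup>+z. ennreal ((cmod (A z))\<^sup>2) \<partial>?P) = (\<integral>\<^sup>+z. ennreal ((cmod (A z))\<^sup>2) \<partial>noise_space N)"
    using std_complex_gaussian.emeasure_space_1
    by (subst split) (auto simp: indep)
  finally show ?thesis .
qed

section \<open>Averages over messages and noise blocks\<close>

lemma nn_integral_uniform_count:
  "(\<integral>\<^sup>+w. h w \<partial>uniform_count_measure {1..M}) = (\<Sum>w\<in>{1..M}. h w) / of_nat M"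
  unfolding uniform_count_measure_def
  by (subst nn_integral_point_measure_finite)
    (auto simp: sum_distrib_left divide_ennreal_def sum_distrib_right ennreal_of_nat_eq_real_of_nat[symmetric]
       inverse_ennreal[symmetric] mult.commute inverse_eq_divide[symmetric] cong: sum.cong
       split: if_splits intro!: sum.cong)

text \<open>Passes from noise to received values: a translation has Jacobian 1, so the noise density
  is merely evaluated at the shifted point.\<close>

lemma nn_integral_noise_translate:
  assumes [measurable]: "f \<in> borel_measurable (vec_lborel N)"
  shows "(\<integral>\<^sup>+z. f (\<lambda>i\<in>{1..N}. a i + z i) \<partial>noise_space N)
     = (\<integral>\<^sup>+t. f t * ennreal (vec_gauss N 1 (\<lambda>i. t i - a i)) \<partial>vec_lborel N)"
proof -
  let ?h = "\<lambda>t. f t * ennreal (vec_gauss N 1 (\<lambda>i. t i - a i))"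
  have eq: "vec_gauss N 1 (\<lambda>i. (\<lambda>i\<in>{1..N}. a i + z i) i - a i) = vec_gauss N 1 z" for z
    by (rule vec_gauss_cong) simp
  have "(\<integral>\<^sup>+z. f (\<lambda>i\<in>{1..N}. a i + z i) \<partial>noise_space N)
      = (\<integral>\<^sup>+z. f (\<lambda>i\<in>{1..N}. a i + z i) * ennreal (vec_gauss N 1 z) \<partial>vec_lborel N)"
    by (rule nn_integral_noise_space) measurable
  also have "\<dots> = (\<integral>\<^sup>+z. ?h (\<lambda>i\<in>{1..N}. a i + z i) \<partial>vec_lborel N)"
    unfolding eq ..
  also have "\<dots> = (\<integral>\<^sup>+t. ?h t \<partial>vec_lborel N)"
    by (rule nn_integral_vec_translate) measurable
  finally show ?thesis .
qed

interpretation vec_lborel: sigma_finite_measure "vec_lborel N" for N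
  by (rule sigma_finite_vec_lborel)

interpretation noise_space: prob_space "noise_space N" for N
  by (rule prob_space_noise_space)

text \<open>The messages range over finite discrete sets, so it suffices to fix both of them;
  encoders may depend on the message arbitrarily.\<close>

lemma outcome_space_measurableI:
  assumes "\<And>w1 w2. w1 \<in> {1..M1} \<Longrightarrow> w2 \<in> {1..M2} \<Longrightarrow>
    (\<lambda>(z1, z2, zf). h (w1, w2, z1, z2, zf)) \<in> vec_lborel N \<Otimes>\<^sub>M vec_lborel N \<Otimes>\<^sub>M vec_lborel N \<rightarrow>\<^sub>M L"
  shows "h \<in> outcome_space N M1 M2 \<rightarrow>\<^sub>M L"
proof -
  let ?V = "vec_lborel N \<Otimes>\<^sub>M vec_lborel N \<Otimes>\<^sub>M vec_lborel N"
  have s: "sets (outcome_space N M1 M2) = sets (count_space {1..M1} \<Otimes>\<^sub>M count_space {1..M2} \<Otimes>\<^sub>M ?V)"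
    unfolding outcome_space_def
    by (intro sets_pair_measure_cong sets_uniform_count_measure_count_space sets_noise_space)
  have "h \<in> count_space {1..M1} \<Otimes>\<^sub>M count_space {1..M2} \<Otimes>\<^sub>M ?V \<rightarrow>\<^sub>M L"
  proof (rule measurable_pair_measure_countable1, simp)
    fix w1 assume w1: "w1 \<in> {1..M1}"
    show "(\<lambda>y. h (w1, y)) \<in> count_space {1..M2} \<Otimes>\<^sub>M ?V \<rightarrow>\<^sub>M L"
    proof (rule measurable_pair_measure_countable1, simp)
      fix w2 assume w2: "w2 \<in> {1..M2}"
      show "(\<lambda>y. h (w1, w2, y)) \<in> ?V \<rightarrow>\<^sub>M L"
        using assms[OF w1 w2] by (simp add: case_prod_beta')
    qed
  qed
  then show ?thesis using s by (simp cong: measurable_cong_sets)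
qed

lemma prob_space_outcome_space:
  assumes "1 \<le> M1" "1 \<le> M2"
  shows "prob_space (outcome_space N M1 M2)"
  unfolding outcome_space_def using assms
  by (intro prob_space_pair prob_space_uniform_count_measure prob_space_noise_space) auto

text \<open>\<open>zf\<close> is outermost: the input of transmitter 2 depends on it, and shifting
  \<open>z1\<close> by that input requires \<open>zf\<close> to be fixed.\<close>

lemma nn_integral_outcome_space:
  fixes h :: "outcome \<Rightarrow> ennreal"
  assumes meas: "\<And>w1 w2. w1 \<in> {1..M1} \<Longrightarrow> w2 \<in> {1..M2} \<Longrightarrow>
    (\<lambda>(z1, z2, zf). h (w1, w2, z1, z2, zf)) \<in> borel_measurable (vec_lborel N \<Otimes>\<^sub>M vec_lborel N \<Otimes>\<^sub>M vec_lborel N)"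
    and M: "1 \<le> M1" "1 \<le> M2"
  shows "(\<integral>\<^sup>+\<omega>. h \<omega> \<partial>outcome_space N M1 M2) =
    (\<Sum>w1\<in>{1..M1}. (\<Sum>w2\<in>{1..M2}.
      \<integral>\<^sup>+zf. \<integral>\<^sup>+z2. \<integral>\<^sup>+z1. h (w1, w2, z1, z2, zf) \<partial>noise_space N \<partial>noise_space N \<partial>noise_space N)
      / of_nat M2) / of_nat M1"
proof -
  let ?U1 = "uniform_count_measure {1..M1}" and ?U2 = "uniform_count_measure {1..M2}"
  let ?Z = "noise_space N"
  interpret U2: prob_space ?U2
    using M by (intro prob_space_uniform_count_measure) auto
  interpret Z2: prob_space "?Z \<Otimes>\<^sub>M ?Z" by (intro prob_space_pair prob_space_noise_space)
  interpret Z3: prob_space "?Z \<Otimes>\<^sub>M ?Z \<Otimes>\<^sub>M ?Z" by (intro prob_space_pair prob_space_noise_space)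
  interpret U2Z3: prob_space "?U2 \<Otimes>\<^sub>M ?Z \<Otimes>\<^sub>M ?Z \<Otimes>\<^sub>M ?Z"
    by (intro prob_space_pair U2.prob_space_axioms prob_space_noise_space)
  interpret p1: pair_sigma_finite ?Z "?Z \<Otimes>\<^sub>M ?Z" ..
  interpret p2: pair_sigma_finite ?Z ?Z ..
  have h: "h \<in> borel_measurable (?U1 \<Otimes>\<^sub>M ?U2 \<Otimes>\<^sub>M ?Z \<Otimes>\<^sub>M ?Z \<Otimes>\<^sub>M ?Z)"
    using outcome_space_measurableI[OF meas] by (simp add: outcome_space_def)
  have eq3: "(\<integral>\<^sup>+q. h (w1, w2, q) \<partial>(?Z \<Otimes>\<^sub>M ?Z \<Otimes>\<^sub>M ?Z)) =
      (\<integral>\<^sup>+zf. \<integral>\<^sup>+z2. \<integral>\<^sup>+z1. h (w1, w2, z1, z2, zf) \<partial>?Z \<partial>?Z \<partial>?Z)"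
    if "w1 \<in> {1..M1}" "w2 \<in> {1..M2}" for w1 w2
  proof -
    have [measurable]: "(\<lambda>q. h (w1, w2, q)) \<in> borel_measurable (?Z \<Otimes>\<^sub>M ?Z \<Otimes>\<^sub>M ?Z)"
      using meas[OF that] by (simp add: case_prod_beta' cong: measurable_cong_sets sets_pair_measure_cong)
    have "(\<integral>\<^sup>+q. h (w1, w2, q) \<partial>(?Z \<Otimes>\<^sub>M ?Z \<Otimes>\<^sub>M ?Z)) = (\<integral>\<^sup>+p. \<integral>\<^sup>+z1. h (w1, w2, z1, p) \<partial>?Z \<partial>(?Z \<Otimes>\<^sub>M ?Z))"
      by (subst p1.nn_integral_snd[symmetric]) simp_all
    also have "\<dots> = (\<integral>\<^sup>+zf. \<integral>\<^sup>+z2. \<integral>\<^sup>+z1. h (w1, w2, z1, z2, zf) \<partial>?Z \<partial>?Z \<partial>?Z)"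
      by (subst p2.nn_integral_snd[symmetric]) simp_all
    finally show ?thesis .
  qed
  have "(\<integral>\<^sup>+\<omega>. h \<omega> \<partial>outcome_space N M1 M2) = (\<integral>\<^sup>+w1. \<integral>\<^sup>+p. h (w1, p) \<partial>(?U2 \<Otimes>\<^sub>M ?Z \<Otimes>\<^sub>M ?Z \<Otimes>\<^sub>M ?Z) \<partial>?U1)"
    unfolding outcome_space_def by (rule U2Z3.nn_integral_fst[symmetric, OF h])
  also have "\<dots> = (\<Sum>w1\<in>{1..M1}. \<integral>\<^sup>+p. h (w1, p) \<partial>(?U2 \<Otimes>\<^sub>M ?Z \<Otimes>\<^sub>M ?Z \<Otimes>\<^sub>M ?Z)) / of_nat M1"
    by (rule nn_integral_uniform_count)
  also have "(\<Sum>w1\<in>{1..M1}. \<integral>\<^sup>+p. h (w1, p) \<partial>(?U2 \<Otimes>\<^sub>M ?Z \<Otimes>\<^sub>M ?Z \<Otimes>\<^sub>M ?Z)) =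
      (\<Sum>w1\<in>{1..M1}. (\<Sum>w2\<in>{1..M2}.
         \<integral>\<^sup>+zf. \<integral>\<^sup>+z2. \<integral>\<^sup>+z1. h (w1, w2, z1, z2, zf) \<partial>?Z \<partial>?Z \<partial>?Z) / of_nat M2)"
  proof (rule sum.cong[OF refl])
    fix w1 assume w1: "w1 \<in> {1..M1}"
    then have "w1 \<in> space ?U1" by (simp add: space_uniform_count_measure)
    then have "(\<lambda>p. h (w1, p)) \<in> borel_measurable (?U2 \<Otimes>\<^sub>M ?Z \<Otimes>\<^sub>M ?Z \<Otimes>\<^sub>M ?Z)"
      using h by (rule measurable_compose_Pair1)
    then have "(\<integral>\<^sup>+p. h (w1, p) \<partial>(?U2 \<Otimes>\<^sub>M ?Z \<Otimes>\<^sub>M ?Z \<Otimes>\<^sub>M ?Z)) =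
        (\<integral>\<^sup>+w2. \<integral>\<^sup>+q. h (w1, w2, q) \<partial>(?Z \<Otimes>\<^sub>M ?Z \<Otimes>\<^sub>M ?Z) \<partial>?U2)"
      by (rule Z3.nn_integral_fst[symmetric])
    also have "\<dots> = (\<Sum>w2\<in>{1..M2}. \<integral>\<^sup>+q. h (w1, w2, q) \<partial>(?Z \<Otimes>\<^sub>M ?Z \<Otimes>\<^sub>M ?Z)) / of_nat M2"
      by (rule nn_integral_uniform_count)
    also have "(\<Sum>w2\<in>{1..M2}. \<integral>\<^sup>+q. h (w1, w2, q) \<partial>(?Z \<Otimes>\<^sub>M ?Z \<Otimes>\<^sub>M ?Z)) =
        (\<Sum>w2\<in>{1..M2}. \<integral>\<^sup>+zf. \<integral>\<^sup>+z2. \<integral>\<^sup>+z1. h (w1, w2, z1, z2, zf) \<partial>?Z \<partial>?Z \<partial>?Z)"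
      by (rule sum.cong[OF refl eq3[OF w1]])
    finally show "(\<integral>\<^sup>+p. h (w1, p) \<partial>(?U2 \<Otimes>\<^sub>M ?Z \<Otimes>\<^sub>M ?Z \<Otimes>\<^sub>M ?Z)) =
        (\<Sum>w2\<in>{1..M2}. \<integral>\<^sup>+zf. \<integral>\<^sup>+z2. \<integral>\<^sup>+z1. h (w1, w2, z1, z2, zf) \<partial>?Z \<partial>?Z \<partial>?Z) / of_nat M2" .
  qed
  finally show ?thesis .
qed

lemma measurable_vec_component [measurable_dest]:
  assumes "f \<in> M \<rightarrow>\<^sub>M vec_lborel n" and "g \<in> L \<rightarrow>\<^sub>M M" and "i \<in> {1..n}"
  shows "(\<lambda>x. f (g x) i) \<in> borel_measurable L"
proof -
  have "(\<lambda>z. z i) \<in> borel_measurable (vec_lborel n)"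
    using assms(3) by measurable
  then show ?thesis
    by (rule measurable_compose[OF measurable_compose[OF assms(2,1)]])
qed

interpretation vec_pair: pair_sigma_finite "vec_lborel N" "vec_lborel N" for N
  by standard

lemma nn_integral_vec_gauss_diff:
  assumes "v > 0"
  shows "(\<integral>\<^sup>+z. ennreal (vec_gauss N v (\<lambda>i. z i - s i)) \<partial>vec_lborel N) = 1"
  using nn_integral_vec_gauss[OF assms, of N "\<lambda>i. - s i"] by (simp add: algebra_simps)

text \<open>Every ratio is averaged in two stages: one message sum is bounded for each fixed value
  of the other message, leaving a quantity \<open>Y\<close> whose own average is at most 1. Either
  the inner stage cancels a mixture and the outer one uses the decoding reward, or the inner stage
  uses the reward and \<open>Y\<close> is constantly 1.\<close>

lemma ennreal_average_le_1:
  fixes X :: "nat \<Rightarrow> nat \<Rightarrow> ennreal"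
  assumes M: "1 \<le> M1" "1 \<le> M2"
    and X: "\<And>w1. w1 \<in> {1..M1} \<Longrightarrow> (\<Sum>w2\<in>{1..M2}. X w1 w2) \<le> of_nat M2 * Y w1"
    and Y: "(\<Sum>w1\<in>{1..M1}. Y w1) \<le> of_nat M1"
  shows "(\<Sum>w1\<in>{1..M1}. (\<Sum>w2\<in>{1..M2}. X w1 w2) / of_nat M2) / of_nat M1 \<le> 1"
proof -
  have nz: "(of_nat M1 :: ennreal) \<noteq> 0" "(of_nat M2 :: ennreal) \<noteq> 0"
    using M by auto
  have nt: "(of_nat M1 :: ennreal) \<noteq> \<top>" "(of_nat M2 :: ennreal) \<noteq> \<top>"
    by (simp_all add: ennreal_of_nat_eq_real_of_nat)
  have "(\<Sum>w2\<in>{1..M2}. X w1 w2) / of_nat M2 \<le> Y w1" if "w1 \<in> {1..M1}" for w1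
  proof -
    have "(\<Sum>w2\<in>{1..M2}. X w1 w2) / of_nat M2 \<le> (of_nat M2 * Y w1) / of_nat M2"
      by (rule divide_right_mono_ennreal[OF X[OF that]])
    also have "\<dots> = Y w1"
      using nz nt by (subst mult.commute) (simp add: mult_divide_eq_ennreal)
    finally show ?thesis .
  qed
  then have "(\<Sum>w1\<in>{1..M1}. (\<Sum>w2\<in>{1..M2}. X w1 w2) / of_nat M2) \<le> of_nat M1"
    using sum_mono Y by (meson order_trans)
  then have "(\<Sum>w1\<in>{1..M1}. (\<Sum>w2\<in>{1..M2}. X w1 w2) / of_nat M2) / of_nat M1 \<le> of_nat M1 / of_nat M1"
    by (rule divide_right_mono_ennreal)
  also have "(of_nat M1 :: ennreal) / of_nat M1 = 1"
    using mult_divide_eq_ennreal[OF nz(1) nt(1), of 1] by simp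
  finally show ?thesis .
qed

lemma ennreal_average_swap:
  fixes X :: "nat \<Rightarrow> nat \<Rightarrow> ennreal"
  shows "(\<Sum>w1\<in>{1..M1}. (\<Sum>w2\<in>{1..M2}. X w1 w2) / of_nat M2) / of_nat M1
       = (\<Sum>w2\<in>{1..M2}. (\<Sum>w1\<in>{1..M1}. X w1 w2) / of_nat M1) / of_nat M2"
  unfolding divide_ennreal_def sum_distrib_right[symmetric]
  by (subst sum.swap) (simp add: ac_simps)

section \<open>The channel with a code\<close>

locale coded_channel =
  fixes ch :: channel and c :: code and N M1 M2 :: nat
  assumes code: "measurable_code N c" and M1: "1 \<le> M1" and M2: "1 \<le> M2"
begin

text \<open>
  The lower-case names \<open>f\<close>, \<open>t1\<close>, \<open>t2\<close>, \<open>y1\<close>, \<open>y2\<close> are values of the blocks \<open>Yf\<close>, \<open>T1\<close>, \<open>T2\<close>, \<open>Y1\<close>, \<open>Y2\<close>.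
  Given the messages, the noise is an explicit function of \<open>(f, t1, t2)\<close>, so all integrals use these coordinates.
\<close>

definition g11 :: complex where "g11 = complex_of_real (sqrt (snr1 ch))"
definition g12 :: complex where "g12 = complex_of_real (sqrt (inr2 ch)) * exp (\<i> * complex_of_real (phase2 ch))"
definition g21 :: complex where "g21 = complex_of_real (sqrt (inr1 ch)) * exp (\<i> * complex_of_real (phase1 ch))"
definition g22 :: complex where "g22 = complex_of_real (sqrt (snr2 ch))"
definition gf :: complex where "gf = complex_of_real (sqrt (coop ch))"

definition xs1 :: "nat \<Rightarrow> nat \<Rightarrow> complex" where "xs1 w i = enc1 c i w"
definition xs2 :: "nat \<Rightarrow> (nat \<Rightarrow> complex) \<Rightarrow> nat \<Rightarrow> complex" where
  "xs2 w f i = enc2 c i w (restrict f {1..<i})"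

definition y1_of :: "nat \<Rightarrow> (nat \<Rightarrow> complex) \<Rightarrow> nat \<Rightarrow> complex" where
  "y1_of w1 t2 = (\<lambda>i\<in>{1..N}. g11 * xs1 w1 i + t2 i)"
definition y2_of :: "nat \<Rightarrow> (nat \<Rightarrow> complex) \<Rightarrow> (nat \<Rightarrow> complex) \<Rightarrow> nat \<Rightarrow> complex" where
  "y2_of w2 f t1 = (\<lambda>i\<in>{1..N}. g22 * xs2 w2 f i + t1 i)"

definition f_of :: "nat \<Rightarrow> (nat \<Rightarrow> complex) \<Rightarrow> nat \<Rightarrow> complex" where
  "f_of w1 zf = (\<lambda>i\<in>{1..N}. gf * xs1 w1 i + zf i)"
definition t1_of :: "nat \<Rightarrow> (nat \<Rightarrow> complex) \<Rightarrow> nat \<Rightarrow> complex" where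
  "t1_of w1 z2 = (\<lambda>i\<in>{1..N}. g21 * xs1 w1 i + z2 i)"
definition t2_of :: "nat \<Rightarrow> (nat \<Rightarrow> complex) \<Rightarrow> (nat \<Rightarrow> complex) \<Rightarrow> nat \<Rightarrow> complex" where
  "t2_of w2 f z1 = (\<lambda>i\<in>{1..N}. g12 * xs2 w2 f i + z1 i)"

text \<open>\<open>i \<le> Suc n\<close> suffices because the encoder at time \<open>i\<close> reads
  \<open>f\<close> only before \<open>i\<close>.\<close>

lemma xs2_measurable [measurable (raw)]:
  assumes i: "i \<in> {1..N}" and f: "f \<in> M \<rightarrow>\<^sub>M vec_lborel n" and n: "i \<le> Suc n"
  shows "(\<lambda>x. xs2 w (f x) i) \<in> borel_measurable M"
proof -
  have "(\<lambda>f. restrict f {1..<i}) \<in> vec_lborel n \<rightarrow>\<^sub>M PiM {1..<i} (\<lambda>_. borel)"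
  proof -
    have "(\<lambda>f. restrict f {1..<i}) \<in> vec_lborel n \<rightarrow>\<^sub>M PiM {1..<i} (\<lambda>_. lborel)"
      using n by (intro measurable_restrict_subset) auto
    also have "sets (PiM {1..<i} (\<lambda>_. lborel)) = sets (PiM {1..<i} (\<lambda>_. borel :: complex measure))"
      by (intro sets_PiM_cong) auto
    then have "vec_lborel n \<rightarrow>\<^sub>M PiM {1..<i} (\<lambda>_. lborel) = vec_lborel n \<rightarrow>\<^sub>M PiM {1..<i} (\<lambda>_. borel :: complex measure)"
      by (intro measurable_cong_sets) auto
    finally show ?thesis .
  qed
  moreover have "enc2 c i w \<in> PiM {1..<i} (\<lambda>_. borel) \<rightarrow>\<^sub>M borel"
    using code i by (auto simp: measurable_code_def)
  ultimately show ?thesis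
    unfolding xs2_def
    by (rule measurable_compose[OF measurable_compose[OF f]])
qed

lemma xs2_measurable_N [measurable (raw)]:
  assumes "i \<in> {1..N}" and "f \<in> M \<rightarrow>\<^sub>M vec_lborel N"
  shows "(\<lambda>x. xs2 w (f x) i) \<in> borel_measurable M"
  using assms by (intro xs2_measurable[where n = N]) auto

lemma of_measurable [measurable (raw)]:
  assumes [measurable]: "t \<in> M \<rightarrow>\<^sub>M vec_lborel N"
  shows "(\<lambda>x. y1_of w (t x)) \<in> M \<rightarrow>\<^sub>M vec_lborel N"
    and "(\<lambda>x. f_of w (t x)) \<in> M \<rightarrow>\<^sub>M vec_lborel N"
    and "(\<lambda>x. t1_of w (t x)) \<in> M \<rightarrow>\<^sub>M vec_lborel N"
  unfolding y1_of_def f_of_def t1_of_def by measurable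

lemma of_measurable2 [measurable (raw)]:
  assumes [measurable]: "f \<in> M \<rightarrow>\<^sub>M vec_lborel N" "t \<in> M \<rightarrow>\<^sub>M vec_lborel N"
  shows "(\<lambda>x. y2_of w (f x) (t x)) \<in> M \<rightarrow>\<^sub>M vec_lborel N"
    and "(\<lambda>x. t2_of w (f x) (t x)) \<in> M \<rightarrow>\<^sub>M vec_lborel N"
  unfolding y2_of_def t2_of_def by measurable

text \<open>The density of \<open>(Yf, T1)\<close> given \<open>W1 = w1\<close>; the noises on the
  two links are independent.\<close>

definition dens1 :: "nat \<Rightarrow> (nat \<Rightarrow> complex) \<Rightarrow> (nat \<Rightarrow> complex) \<Rightarrow> real" where
  "dens1 w1 f t1 = vec_gauss N 1 (\<lambda>i. t1 i - g21 * xs1 w1 i) * vec_gauss N 1 (\<lambda>i. f i - gf * xs1 w1 i)"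

text \<open>The density of \<open>T2\<close> given \<open>W2 = w2\<close> and \<open>Yf = f\<close>:
  the input \<open>X2\<close> is then known, and \<open>Yf\<close> carries no information about
  \<open>Z1\<close>.\<close>

definition dens2 :: "nat \<Rightarrow> (nat \<Rightarrow> complex) \<Rightarrow> (nat \<Rightarrow> complex) \<Rightarrow> real" where
  "dens2 w2 f t2 = vec_gauss N 1 (\<lambda>i. t2 i - g12 * xs2 w2 f i)"

lemma dens1_pos: "dens1 w1 f t1 > 0" and dens2_pos: "dens2 w2 f t2 > 0"
  by (simp_all add: dens1_def dens2_def vec_gauss_pos)

lemma of_in_space:
  "y1_of w t \<in> space (vec_lborel N)" "y2_of w f t \<in> space (vec_lborel N)"
  "f_of w t \<in> space (vec_lborel N)" "t1_of w t \<in> space (vec_lborel N)"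
  "t2_of w f t \<in> space (vec_lborel N)"
  by (auto simp: y1_of_def y2_of_def f_of_def t1_of_def t2_of_def space_PiM)

lemma dens_measurable [measurable (raw)]:
  assumes [measurable]: "f \<in> M \<rightarrow>\<^sub>M vec_lborel N" "t \<in> M \<rightarrow>\<^sub>M vec_lborel N"
  shows "(\<lambda>x. dens1 w (f x) (t x)) \<in> borel_measurable M"
    and "(\<lambda>x. dens2 w (f x) (t x)) \<in> borel_measurable M"
  unfolding dens1_def dens2_def by measurable

text \<open>\<open>f\<close> is outermost because the translations from \<open>z1\<close> to
  \<open>t2\<close> and from \<open>t1\<close> to \<open>y2\<close> depend on it.\<close>

definition triple_integral :: "((nat \<Rightarrow> complex) \<Rightarrow> (nat \<Rightarrow> complex) \<Rightarrow> (nat \<Rightarrow> complex) \<Rightarrow> real) \<Rightarrow> ennreal" where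
  "triple_integral h = (\<integral>\<^sup>+f. \<integral>\<^sup>+t1. \<integral>\<^sup>+t2. ennreal (h f t1 t2) \<partial>vec_lborel N \<partial>vec_lborel N \<partial>vec_lborel N)"

definition Fv :: "outcome \<Rightarrow> nat \<Rightarrow> complex" where "Fv \<omega> = (\<lambda>i\<in>{1..N}. Yf ch c i \<omega>)"
definition T1v :: "outcome \<Rightarrow> nat \<Rightarrow> complex" where "T1v \<omega> = (\<lambda>i\<in>{1..N}. g21 * X1 c i \<omega> + Z2 i \<omega>)"
definition T2v :: "outcome \<Rightarrow> nat \<Rightarrow> complex" where "T2v \<omega> = (\<lambda>i\<in>{1..N}. g12 * X2 ch c i \<omega> + Z1 i \<omega>)"

lemma X1_eq: "X1 c i (w1, w2, z1, z2, zf) = xs1 w1 i"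
  by (simp add: X1_def xs1_def)

lemma Fv_eq: "Fv (w1, w2, z1, z2, zf) = f_of w1 zf"
  by (simp add: Fv_def f_of_def Yf_def X1_eq gf_def cong: restrict_cong)

lemma X2_eq_Fv: "i \<in> {1..N} \<Longrightarrow> X2 ch c i \<omega> = xs2 (W2 \<omega>) (Fv \<omega>) i"
  unfolding X2_def xs2_def Fv_def by (rule arg_cong[where f = "enc2 c i (W2 \<omega>)"]) (auto simp: restrict_def)

lemma X2_eq: "i \<in> {1..N} \<Longrightarrow> X2 ch c i (w1, w2, z1, z2, zf) = xs2 w2 (f_of w1 zf) i"
  by (simp add: X2_eq_Fv Fv_eq)

lemma T1v_eq: "T1v (w1, w2, z1, z2, zf) = t1_of w1 z2"
  by (simp add: T1v_def t1_of_def X1_eq cong: restrict_cong)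

lemma T2v_eq: "T2v (w1, w2, z1, z2, zf) = t2_of w2 (f_of w1 zf) z1"
  by (simp add: T2v_def t2_of_def X2_eq cong: restrict_cong)

text \<open>Given the messages, the map from noise to received values is triangular:
  \<open>f\<close> and \<open>t1\<close> are shifted by codewords, and \<open>t2\<close> by an input
  that is fixed once \<open>f\<close> is. All Jacobians are 1, and the noise densities become
  \<open>dens1\<close> and \<open>dens2\<close>.\<close>

lemma triple_integral_noise:
  assumes meas: "(\<lambda>(f, t1, t2). \<phi> f t1 t2) \<in> borel_measurable (vec_lborel N \<Otimes>\<^sub>M vec_lborel N \<Otimes>\<^sub>M vec_lborel N)"
    and nonneg: "\<And>f t1 t2. \<phi> f t1 t2 \<ge> 0"
  shows "(\<integral>\<^sup>+zf. \<integral>\<^sup>+z2. \<integral>\<^sup>+z1. ennreal (\<phi> (f_of w1 zf) (t1_of w1 z2) (t2_of w2 (f_of w1 zf) z1))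
       \<partial>noise_space N \<partial>noise_space N \<partial>noise_space N)
     = triple_integral (\<lambda>f t1 t2. \<phi> f t1 t2 * dens1 w1 f t1 * dens2 w2 f t2)"
proof -
  let ?V = "vec_lborel N"
  let ?n = "vec_gauss N 1"
  have [measurable (raw)]: "(\<lambda>x. \<phi> (g x) (h x) (k x)) \<in> borel_measurable M"
    if [measurable]: "g \<in> M \<rightarrow>\<^sub>M ?V" "h \<in> M \<rightarrow>\<^sub>M ?V" "k \<in> M \<rightarrow>\<^sub>M ?V"
    for g h k and M :: "'x measure"
  proof -
    have "(\<lambda>x. (g x, h x, k x)) \<in> M \<rightarrow>\<^sub>M ?V \<Otimes>\<^sub>M ?V \<Otimes>\<^sub>M ?V" by measurable
    from measurable_compose[OF this meas] show ?thesis by simp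
  qed
  define A where "A t1 = ?n (\<lambda>i. t1 i - g21 * xs1 w1 i)" for t1
  define D where "D f = ?n (\<lambda>i. f i - gf * xs1 w1 i)" for f
  have [measurable]: "A \<in> borel_measurable ?V" "D \<in> borel_measurable ?V"
    unfolding A_def D_def by measurable
  have pos: "A z \<ge> 0" "D z \<ge> 0" "dens2 w2 f z \<ge> 0" for f z
    by (simp_all add: A_def D_def dens2_def vec_gauss_pos less_imp_le)
  have z1: "(\<integral>\<^sup>+z1. ennreal (\<phi> f t1 (t2_of w2 f z1)) \<partial>noise_space N)
      = (\<integral>\<^sup>+t2. ennreal (\<phi> f t1 t2 * dens2 w2 f t2) \<partial>?V)"
    if [measurable]: "f \<in> space ?V" "t1 \<in> space ?V" for f t1
    unfolding t2_of_def dens2_def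
    by (subst nn_integral_noise_translate[where f = "\<lambda>t2. ennreal (\<phi> f t1 t2)"])
      (auto simp: ennreal_mult nonneg vec_gauss_pos less_imp_le)
  have z2: "(\<integral>\<^sup>+z2. \<integral>\<^sup>+t2. ennreal (\<phi> f (t1_of w1 z2) t2 * dens2 w2 f t2) \<partial>?V \<partial>noise_space N)
      = (\<integral>\<^sup>+t1. \<integral>\<^sup>+t2. ennreal (\<phi> f t1 t2 * dens2 w2 f t2 * A t1) \<partial>?V \<partial>?V)"
    if [measurable]: "f \<in> space ?V" for f
  proof -
    have "(\<integral>\<^sup>+z2. \<integral>\<^sup>+t2. ennreal (\<phi> f (t1_of w1 z2) t2 * dens2 w2 f t2) \<partial>?V \<partial>noise_space N)
        = (\<integral>\<^sup>+t1. (\<integral>\<^sup>+t2. ennreal (\<phi> f t1 t2 * dens2 w2 f t2) \<partial>?V) * ennreal (A t1) \<partial>?V)"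
      unfolding t1_of_def A_def
      by (rule nn_integral_noise_translate[where f = "\<lambda>t1. \<integral>\<^sup>+t2. ennreal (\<phi> f t1 t2 * dens2 w2 f t2) \<partial>?V"]) measurable
    also have "\<dots> = (\<integral>\<^sup>+t1. \<integral>\<^sup>+t2. ennreal (\<phi> f t1 t2 * dens2 w2 f t2 * A t1) \<partial>?V \<partial>?V)"
    proof (rule nn_integral_cong)
      fix t1 assume [measurable]: "t1 \<in> space ?V"
      show "(\<integral>\<^sup>+t2. ennreal (\<phi> f t1 t2 * dens2 w2 f t2) \<partial>?V) * ennreal (A t1)
        = (\<integral>\<^sup>+t2. ennreal (\<phi> f t1 t2 * dens2 w2 f t2 * A t1) \<partial>?V)"
        by (subst nn_integral_multc[symmetric]) (auto simp: ennreal_mult nonneg pos)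
    qed
    finally show ?thesis .
  qed
  have "(\<integral>\<^sup>+zf. \<integral>\<^sup>+z2. \<integral>\<^sup>+z1. ennreal (\<phi> (f_of w1 zf) (t1_of w1 z2) (t2_of w2 (f_of w1 zf) z1))
       \<partial>noise_space N \<partial>noise_space N \<partial>noise_space N)
     = (\<integral>\<^sup>+zf. \<integral>\<^sup>+z2. \<integral>\<^sup>+t2. ennreal (\<phi> (f_of w1 zf) (t1_of w1 z2) t2 * dens2 w2 (f_of w1 zf) t2) \<partial>?V \<partial>noise_space N \<partial>noise_space N)"
    by (intro nn_integral_cong z1 of_in_space)
  also have "\<dots> = (\<integral>\<^sup>+zf. \<integral>\<^sup>+t1. \<integral>\<^sup>+t2. ennreal (\<phi> (f_of w1 zf) t1 t2 * dens2 w2 (f_of w1 zf) t2 * A t1) \<partial>?V \<partial>?V \<partial>noise_space N)"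
    by (intro nn_integral_cong z2 of_in_space)
  also have "\<dots> = (\<integral>\<^sup>+f. (\<integral>\<^sup>+t1. \<integral>\<^sup>+t2. ennreal (\<phi> f t1 t2 * dens2 w2 f t2 * A t1) \<partial>?V \<partial>?V) * ennreal (D f) \<partial>?V)"
    unfolding f_of_def D_def
    by (rule nn_integral_noise_translate[where f = "\<lambda>f. \<integral>\<^sup>+t1. \<integral>\<^sup>+t2. ennreal (\<phi> f t1 t2 * dens2 w2 f t2 * A t1) \<partial>?V \<partial>?V"]) measurable
  also have "\<dots> = (\<integral>\<^sup>+f. \<integral>\<^sup>+t1. \<integral>\<^sup>+t2. ennreal (\<phi> f t1 t2 * dens2 w2 f t2 * A t1 * D f) \<partial>?V \<partial>?V \<partial>?V)"
  proof (rule nn_integral_cong)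
    fix f assume [measurable]: "f \<in> space ?V"
    have "(\<integral>\<^sup>+t1. \<integral>\<^sup>+t2. ennreal (\<phi> f t1 t2 * dens2 w2 f t2 * A t1) \<partial>?V \<partial>?V) * ennreal (D f)
        = (\<integral>\<^sup>+t1. (\<integral>\<^sup>+t2. ennreal (\<phi> f t1 t2 * dens2 w2 f t2 * A t1) \<partial>?V) * ennreal (D f) \<partial>?V)"
      by (rule nn_integral_multc[symmetric]) measurable
    also have "\<dots> = (\<integral>\<^sup>+t1. \<integral>\<^sup>+t2. ennreal (\<phi> f t1 t2 * dens2 w2 f t2 * A t1 * D f) \<partial>?V \<partial>?V)"
    proof (rule nn_integral_cong)
      fix t1 assume [measurable]: "t1 \<in> space ?V"
      show "(\<integral>\<^sup>+t2. ennreal (\<phi> f t1 t2 * dens2 w2 f t2 * A t1) \<partial>?V) * ennreal (D f)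
        = (\<integral>\<^sup>+t2. ennreal (\<phi> f t1 t2 * dens2 w2 f t2 * A t1 * D f) \<partial>?V)"
        by (subst nn_integral_multc[symmetric]) (auto simp: ennreal_mult nonneg pos)
    qed
    finally show "(\<integral>\<^sup>+t1. \<integral>\<^sup>+t2. ennreal (\<phi> f t1 t2 * dens2 w2 f t2 * A t1) \<partial>?V \<partial>?V) * ennreal (D f)
        = (\<integral>\<^sup>+t1. \<integral>\<^sup>+t2. ennreal (\<phi> f t1 t2 * dens2 w2 f t2 * A t1 * D f) \<partial>?V \<partial>?V)" .
  qed
  finally show ?thesis
    by (simp add: triple_integral_def dens1_def A_def D_def ac_simps)
qed

lemma nn_integral_outcome_triple_integral:
  assumes meas: "\<And>w1 w2. (\<lambda>(f, t1, t2). \<phi> w1 w2 f t1 t2) \<in> borel_measurable (vec_lborel N \<Otimes>\<^sub>M vec_lborel N \<Otimes>\<^sub>M vec_lborel N)"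
    and nonneg: "\<And>w1 w2 f t1 t2. \<phi> w1 w2 f t1 t2 \<ge> 0"
  shows "(\<integral>\<^sup>+\<omega>. ennreal (\<phi> (W1 \<omega>) (W2 \<omega>) (Fv \<omega>) (T1v \<omega>) (T2v \<omega>)) \<partial>outcome_space N M1 M2) =
    (\<Sum>w1\<in>{1..M1}. (\<Sum>w2\<in>{1..M2}. triple_integral (\<lambda>f t1 t2. \<phi> w1 w2 f t1 t2 * dens1 w1 f t1 * dens2 w2 f t2)) / of_nat M2) / of_nat M1"
proof (subst nn_integral_outcome_space[OF _ M1 M2], goal_cases)
  case (1 w1 w2)
  have "(\<lambda>(z1, z2, zf). (f_of w1 zf, t1_of w1 z2, t2_of w2 (f_of w1 zf) z1))
      \<in> vec_lborel N \<Otimes>\<^sub>M vec_lborel N \<Otimes>\<^sub>M vec_lborel N \<rightarrow>\<^sub>M vec_lborel N \<Otimes>\<^sub>M vec_lborel N \<Otimes>\<^sub>M vec_lborel N"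
    by measurable
  from measurable_compose[OF this meas[of w1 w2]] show ?case
    by (simp add: Fv_eq T1v_eq T2v_eq split_beta')
next
  case 2
  show ?case
    by (simp add: Fv_eq T1v_eq T2v_eq triple_integral_noise[OF meas nonneg])
qed

section \<open>Density ratios with expectation at most one\<close>

abbreviation "V \<equiv> vec_lborel N"

text \<open>
  The reward for correct decoding: multiplying a density of the output by it costs at most a factor 1 on average
  over a uniform message, while its expected logarithm is \<open>(1 - error) ln M - ln 2\<close>, as in Fano's inequality.
\<close>

definition gain1 :: "nat \<Rightarrow> (nat \<Rightarrow> complex) \<Rightarrow> real" where
  "gain1 w y = (if dec1 c y = w then real M1 / 2 else 1 / 2)"
definition gain2 :: "nat \<Rightarrow> (nat \<Rightarrow> complex) \<Rightarrow> real" where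
  "gain2 w y = (if dec2 c y = w then real M2 / 2 else 1 / 2)"

lemma dec_measurable [measurable]:
  "dec1 c \<in> V \<rightarrow>\<^sub>M count_space UNIV" "dec2 c \<in> V \<rightarrow>\<^sub>M count_space UNIV"
proof -
  have s: "sets V = sets (PiM {1..N} (\<lambda>_. borel :: complex measure))"
    by (intro sets_PiM_cong) auto
  show "dec1 c \<in> V \<rightarrow>\<^sub>M count_space UNIV" "dec2 c \<in> V \<rightarrow>\<^sub>M count_space UNIV"
    using code s by (auto simp: measurable_code_def cong: measurable_cong_sets)
qed

lemma gain_measurable [measurable (raw)]:
  assumes [measurable]: "y \<in> M \<rightarrow>\<^sub>M V"
  shows "(\<lambda>x. gain1 w (y x)) \<in> borel_measurable M" "(\<lambda>x. gain2 w (y x)) \<in> borel_measurable M"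
  unfolding gain1_def gain2_def by measurable

lemma gain_pos: "gain1 w y > 0" "gain2 w y > 0"
  using M1 M2 by (auto simp: gain1_def gain2_def)

text \<open>At most one message equals the decoded value and contributes \<open>M / 2\<close>; the
  terms \<open>1 / 2\<close> give at most another \<open>M / 2\<close>. A decoded value outside
  \<open>{1..M}\<close> only lowers the sum.\<close>

lemma sum_gain_le:
  assumes M: "1 \<le> M"
  shows "(\<Sum>w\<in>{1..M}. if d = w then real M / 2 else 1 / 2) \<le> real M"
proof -
  have "(\<Sum>w\<in>{1..M}. if d = w then real M / 2 else 1 / 2)
      \<le> (\<Sum>w\<in>{1..M}. (if d = w then real M / 2 else 0) + 1 / 2)"
    by (intro sum_mono) auto
  also have "\<dots> \<le> real M"
    by (simp add: sum.distrib sum.delta)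
  finally show ?thesis .
qed

lemma sum_gain1_le: "(\<Sum>w\<in>{1..M1}. gain1 w y) \<le> real M1"
  and sum_gain2_le: "(\<Sum>w\<in>{1..M2}. gain2 w y) \<le> real M2"
  unfolding gain1_def gain2_def by (rule sum_gain_le M1 M2)+

section \<open>Integrals over the received blocks, and the mixture densities\<close>

abbreviation meas3 :: "((nat \<Rightarrow> complex) \<Rightarrow> (nat \<Rightarrow> complex) \<Rightarrow> (nat \<Rightarrow> complex) \<Rightarrow> real) \<Rightarrow> bool" where
  "meas3 h \<equiv> (\<lambda>(f, t1, t2). h f t1 t2) \<in> borel_measurable (V \<Otimes>\<^sub>M V \<Otimes>\<^sub>M V)"

lemma meas3_compose:
  assumes meas: "meas3 h"
    and g [measurable]: "g \<in> M \<rightarrow>\<^sub>M V" "h' \<in> M \<rightarrow>\<^sub>M V" "k \<in> M \<rightarrow>\<^sub>M V"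
  shows "(\<lambda>x. h (g x) (h' x) (k x)) \<in> borel_measurable M"
proof -
  have "(\<lambda>x. (g x, h' x, k x)) \<in> M \<rightarrow>\<^sub>M V \<Otimes>\<^sub>M V \<Otimes>\<^sub>M V" by measurable
  from measurable_compose[OF this meas] show ?thesis by simp
qed

lemma triple_integral_sum:
  assumes meas: "\<And>w. w \<in> W \<Longrightarrow> meas3 (h w)" and nonneg: "\<And>w f t1 t2. w \<in> W \<Longrightarrow> h w f t1 t2 \<ge> 0"
  shows "(\<Sum>w\<in>W. triple_integral (h w)) = triple_integral (\<lambda>f t1 t2. \<Sum>w\<in>W. h w f t1 t2)"
proof -
  note [measurable (raw)] = meas3_compose[OF meas]
  have "triple_integral (\<lambda>f t1 t2. \<Sum>w\<in>W. h w f t1 t2)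
      = (\<integral>\<^sup>+f. \<integral>\<^sup>+t1. \<integral>\<^sup>+t2. (\<Sum>w\<in>W. ennreal (h w f t1 t2)) \<partial>V \<partial>V \<partial>V)"
    unfolding triple_integral_def by (intro nn_integral_cong) (simp add: nonneg sum_ennreal)
  also have "\<dots> = (\<integral>\<^sup>+f. \<integral>\<^sup>+t1. (\<Sum>w\<in>W. \<integral>\<^sup>+t2. ennreal (h w f t1 t2) \<partial>V) \<partial>V \<partial>V)"
    by (intro nn_integral_cong nn_integral_sum) measurable
  also have "\<dots> = (\<integral>\<^sup>+f. (\<Sum>w\<in>W. \<integral>\<^sup>+t1. \<integral>\<^sup>+t2. ennreal (h w f t1 t2) \<partial>V \<partial>V) \<partial>V)"
    by (intro nn_integral_cong nn_integral_sum) measurable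
  also have "\<dots> = (\<Sum>w\<in>W. triple_integral (h w))"
    unfolding triple_integral_def by (intro nn_integral_sum) measurable
  finally show ?thesis ..
qed

lemma triple_integral_mono: "(\<And>f t1 t2. h f t1 t2 \<le> k f t1 t2) \<Longrightarrow> triple_integral h \<le> triple_integral k"
  unfolding triple_integral_def by (intro nn_integral_mono ennreal_leI)

lemma triple_integral_cmult:
  assumes meas: "meas3 h" and a: "a \<ge> 0" and nonneg: "\<And>f t1 t2. h f t1 t2 \<ge> 0"
  shows "triple_integral (\<lambda>f t1 t2. a * h f t1 t2) = ennreal a * triple_integral h"
proof -
  note [measurable (raw)] = meas3_compose[OF meas]
  have "triple_integral (\<lambda>f t1 t2. a * h f t1 t2) = (\<integral>\<^sup>+f. \<integral>\<^sup>+t1. ennreal a * (\<integral>\<^sup>+t2. ennreal (h f t1 t2) \<partial>V) \<partial>V \<partial>V)"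
    unfolding triple_integral_def ennreal_mult[OF a nonneg]
    by (intro nn_integral_cong nn_integral_cmult) measurable
  also have "\<dots> = (\<integral>\<^sup>+f. ennreal a * (\<integral>\<^sup>+t1. \<integral>\<^sup>+t2. ennreal (h f t1 t2) \<partial>V \<partial>V) \<partial>V)"
    by (intro nn_integral_cong nn_integral_cmult) measurable
  also have "\<dots> = ennreal a * triple_integral h"
    unfolding triple_integral_def by (intro nn_integral_cmult) measurable
  finally show ?thesis .
qed

lemma triple_integral_translate_y1:
  assumes meas: "meas3 h"
  shows "triple_integral (\<lambda>f t1 t2. h f t1 (y1_of w t2)) = triple_integral h"
proof -
  note [measurable (raw)] = meas3_compose[OF meas]
  show ?thesis
    unfolding triple_integral_def y1_of_def
    by (intro nn_integral_cong nn_integral_vec_translate[where f = "\<lambda>t2. ennreal (h _ _ t2)"]) measurable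
qed

lemma triple_integral_translate_y2:
  assumes meas: "meas3 h"
  shows "triple_integral (\<lambda>f t1 t2. h f (y2_of w f t1) t2) = triple_integral h"
proof -
  note [measurable (raw)] = meas3_compose[OF meas]
  show ?thesis
    unfolding triple_integral_def y2_of_def
    by (intro nn_integral_cong nn_integral_vec_translate[where f = "\<lambda>t1. \<integral>\<^sup>+t2. ennreal (h _ t1 t2) \<partial>V"]) measurable
qed

lemma triple_integral_integrate_t2:
  assumes v: "v > 0" and k: "\<And>f t1. k f t1 \<ge> 0"
  shows "triple_integral (\<lambda>f t1 y. k f t1 * vec_gauss N v (\<lambda>i. y i - s f t1 i)) = (\<integral>\<^sup>+f. \<integral>\<^sup>+t1. ennreal (k f t1) \<partial>V \<partial>V)"
  unfolding triple_integral_def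
  by (intro nn_integral_cong)
    (simp add: ennreal_mult k vec_gauss_pos[OF v] less_imp_le nn_integral_cmult nn_integral_vec_gauss_diff[OF v])

lemma triple_integral_swap:
  assumes meas: "meas3 h"
  shows "triple_integral h = triple_integral (\<lambda>f t1 t2. h f t2 t1)"
proof -
  note [measurable (raw)] = meas3_compose[OF meas]
  show ?thesis
    unfolding triple_integral_def
    by (intro nn_integral_cong vec_pair.Fubini') measurable
qed

text \<open>The density of the prefixes \<open>t1 1, ..., t1 k\<close> and
  \<open>f 1, ..., f j\<close> under a uniform message. Separate lengths are needed for causal
  conditioning, where \<open>f\<close> lags one step behind \<open>t1\<close>.\<close>

definition mix1 :: "nat \<Rightarrow> nat \<Rightarrow> (nat \<Rightarrow> complex) \<Rightarrow> (nat \<Rightarrow> complex) \<Rightarrow> real" where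
  "mix1 k j f t1 = (\<Sum>w\<in>{1..M1}. vec_gauss k 1 (\<lambda>i. t1 i - g21 * xs1 w i) * vec_gauss j 1 (\<lambda>i. f i - gf * xs1 w i)) / real M1"

text \<open>The density of \<open>T2\<close> given \<open>Yf = f\<close>. Uniform weights on
  \<open>w2\<close> are correct since \<open>Yf\<close> depends only on \<open>W1\<close> and
  \<open>Zf\<close> and so says nothing about \<open>W2\<close>.\<close>

definition mix2 :: "(nat \<Rightarrow> complex) \<Rightarrow> (nat \<Rightarrow> complex) \<Rightarrow> real" where
  "mix2 f t2 = (\<Sum>w\<in>{1..M2}. dens2 w f t2) / real M2"

lemma mix1_pos: "mix1 k j f t1 > 0" and mix2_pos: "mix2 f t2 > 0"
  using M1 M2 unfolding mix1_def mix2_def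
  by (auto intro!: divide_pos_pos sum_pos mult_pos_pos vec_gauss_pos dens2_pos)

lemma sum_dens1: "(\<Sum>w\<in>{1..M1}. dens1 w f t1) = real M1 * mix1 N N f t1"
  and sum_dens2: "(\<Sum>w\<in>{1..M2}. dens2 w f t2) = real M2 * mix2 f t2"
  using M1 M2 by (auto simp: mix1_def mix2_def dens1_def)

lemma mix1_measurable [measurable (raw)]:
  assumes [measurable]: "f \<in> M \<rightarrow>\<^sub>M V" "t \<in> M \<rightarrow>\<^sub>M V" and kj: "k \<le> N" "j \<le> N"
  shows "(\<lambda>x. mix1 k j (f x) (t x)) \<in> borel_measurable M"
proof -
  have "(\<lambda>x. vec_gauss k 1 (\<lambda>i. t x i - g21 * xs1 w i)) \<in> borel_measurable M"
       "(\<lambda>x. vec_gauss j 1 (\<lambda>i. f x i - gf * xs1 w i)) \<in> borel_measurable M" for w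
    using kj by (auto intro!: vec_gauss_measurable borel_measurable_diff measurable_vec_component[where g = "\<lambda>x. x" and n = N])
  then show ?thesis unfolding mix1_def by measurable
qed

lemma mix2_measurable [measurable (raw)]:
  assumes [measurable]: "f \<in> M \<rightarrow>\<^sub>M V" "t \<in> M \<rightarrow>\<^sub>M V"
  shows "(\<lambda>x. mix2 (f x) (t x)) \<in> borel_measurable M"
  unfolding mix2_def by measurable

lemma nn_integral_dens2:
  assumes [measurable]: "f \<in> space V"
  shows "(\<integral>\<^sup>+t. ennreal (dens2 w f t) \<partial>V) = 1"
  unfolding dens2_def by (rule nn_integral_vec_gauss_diff) simp

lemma nn_integral_mix2:
  assumes [measurable]: "f \<in> space V"
  shows "(\<integral>\<^sup>+t. ennreal (mix2 f t) \<partial>V) = 1"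
proof -
  have eq: "ennreal (mix2 f t) = (\<Sum>w\<in>{1..M2}. ennreal (dens2 w f t)) * inverse (of_nat M2)" for t
    using M2 dens2_pos unfolding mix2_def
    by (subst sum_ennreal) (auto simp: less_imp_le divide_inverse ennreal_mult sum_nonneg
        inverse_ennreal[symmetric] ennreal_of_nat_eq_real_of_nat)
  have "(\<integral>\<^sup>+t. ennreal (mix2 f t) \<partial>V) = (\<Sum>w\<in>{1..M2}. (\<integral>\<^sup>+t. ennreal (dens2 w f t) \<partial>V)) * inverse (of_nat M2)"
    unfolding eq by (subst nn_integral_multc) (simp_all add: nn_integral_sum)
  also have "\<dots> = of_nat M2 * inverse (of_nat M2)"
    by (simp add: nn_integral_dens2[OF assms])
  also have "\<dots> = 1"
    using M2 by (simp add: ennreal_of_nat_eq_real_of_nat inverse_ennreal ennreal_mult[symmetric])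
  finally show ?thesis .
qed

lemma nn_integral_dens1: "(\<integral>\<^sup>+f. \<integral>\<^sup>+t. ennreal (dens1 w f t) \<partial>V \<partial>V) = 1"
  unfolding dens1_def
  by (simp add: ennreal_mult vec_gauss_pos less_imp_le nn_integral_multc nn_integral_vec_gauss_diff)

lemma nn_integral_mix1: "(\<integral>\<^sup>+f. \<integral>\<^sup>+t. ennreal (mix1 N N f t) \<partial>V \<partial>V) = 1"
proof -
  have eq: "ennreal (mix1 N N f t) = (\<Sum>w\<in>{1..M1}. ennreal (dens1 w f t)) * inverse (of_nat M1)" for f t
    using M1 dens1_pos unfolding mix1_def dens1_def[symmetric]
    by (subst sum_ennreal) (auto simp: less_imp_le divide_inverse ennreal_mult sum_nonneg
        inverse_ennreal[symmetric] ennreal_of_nat_eq_real_of_nat)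
  have "(\<integral>\<^sup>+f. \<integral>\<^sup>+t. ennreal (mix1 N N f t) \<partial>V \<partial>V)
      = (\<Sum>w\<in>{1..M1}. (\<integral>\<^sup>+f. \<integral>\<^sup>+t. ennreal (dens1 w f t) \<partial>V \<partial>V)) * inverse (of_nat M1)"
  proof -
    have "(\<integral>\<^sup>+f. \<integral>\<^sup>+t. ennreal (mix1 N N f t) \<partial>V \<partial>V)
        = (\<integral>\<^sup>+f. (\<Sum>w\<in>{1..M1}. \<integral>\<^sup>+t. ennreal (dens1 w f t) \<partial>V) * inverse (of_nat M1) \<partial>V)"
      unfolding eq
    proof (rule nn_integral_cong)
      fix f assume [measurable]: "f \<in> space V"
      show "(\<integral>\<^sup>+t. (\<Sum>w\<in>{1..M1}. ennreal (dens1 w f t)) * inverse (of_nat M1) \<partial>V)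
          = (\<Sum>w\<in>{1..M1}. \<integral>\<^sup>+t. ennreal (dens1 w f t) \<partial>V) * inverse (of_nat M1)"
        by (subst nn_integral_multc) (simp_all add: nn_integral_sum)
    qed
    also have "\<dots> = (\<Sum>w\<in>{1..M1}. \<integral>\<^sup>+f. \<integral>\<^sup>+t. ennreal (dens1 w f t) \<partial>V \<partial>V) * inverse (of_nat M1)"
      by (subst nn_integral_multc) (simp_all add: nn_integral_sum)
    finally show ?thesis .
  qed
  also have "\<dots> = of_nat M1 * inverse (of_nat M1)"
    by (simp add: nn_integral_dens1)
  also have "\<dots> = 1"
    using M1 by (simp add: ennreal_of_nat_eq_real_of_nat inverse_ennreal ennreal_mult[symmetric])
  finally show ?thesis .
qed

text \<open>For nonnegative measurable \<open>\<phi>\<close> this is its mean over the outcome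
  space, in the coordinates \<open>(f, t1, t2)\<close>.\<close>

definition expect :: "(nat \<Rightarrow> nat \<Rightarrow> (nat \<Rightarrow> complex) \<Rightarrow> (nat \<Rightarrow> complex) \<Rightarrow> (nat \<Rightarrow> complex) \<Rightarrow> real) \<Rightarrow> ennreal" where
  "expect \<phi> = (\<Sum>w1\<in>{1..M1}. (\<Sum>w2\<in>{1..M2}.
      triple_integral (\<lambda>f t1 t2. \<phi> w1 w2 f t1 t2 * dens1 w1 f t1 * dens2 w2 f t2)) / of_nat M2) / of_nat M1"

lemma expect_le_1_A:
  assumes "\<And>w1. w1 \<in> {1..M1} \<Longrightarrow>
      (\<Sum>w2\<in>{1..M2}. triple_integral (\<lambda>f t1 t2. \<phi> w1 w2 f t1 t2 * dens1 w1 f t1 * dens2 w2 f t2)) \<le> of_nat M2 * Y w1"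
    and "(\<Sum>w1\<in>{1..M1}. Y w1) \<le> of_nat M1"
  shows "expect \<phi> \<le> 1"
  unfolding expect_def by (rule ennreal_average_le_1[OF M1 M2 assms])

lemma expect_le_1_B:
  assumes "\<And>w2. w2 \<in> {1..M2} \<Longrightarrow>
      (\<Sum>w1\<in>{1..M1}. triple_integral (\<lambda>f t1 t2. \<phi> w1 w2 f t1 t2 * dens1 w1 f t1 * dens2 w2 f t2)) \<le> of_nat M1 * Y w2"
    and "(\<Sum>w2\<in>{1..M2}. Y w2) \<le> of_nat M2"
  shows "expect \<phi> \<le> 1"
  unfolding expect_def by (subst ennreal_average_swap) (rule ennreal_average_le_1[OF M2 M1 assms])

lemma meas3I: "(\<lambda>p. h (fst p) (fst (snd p)) (snd (snd p))) \<in> borel_measurable (V \<Otimes>\<^sub>M V \<Otimes>\<^sub>M V) \<Longrightarrow> meas3 h"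
  by (simp add: split_beta')

lemma y_of_component_measurable [measurable (raw)]:
  assumes [measurable]: "f \<in> M \<rightarrow>\<^sub>M V" "t \<in> M \<rightarrow>\<^sub>M V" and i: "i \<in> {1..N}"
  shows "(\<lambda>x. y2_of w (f x) (t x) i) \<in> borel_measurable M"
  by (rule measurable_vec_component[OF of_measurable2(1) measurable_ident i, unfolded id_def]) measurable

lemma y1_of_component_measurable [measurable (raw)]:
  assumes [measurable]: "t \<in> M \<rightarrow>\<^sub>M V" and i: "i \<in> {1..N}"
  shows "(\<lambda>x. y1_of w (t x) i) \<in> borel_measurable M"
  by (rule measurable_vec_component[OF of_measurable(1) measurable_ident i, unfolded id_def]) measurable

text \<open>Passing from \<open>t2\<close> to \<open>y1\<close> absorbs the codeword of
  \<open>w\<close>, after which \<open>w\<close> occurs in the reward alone. The rewards sum to at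
  most \<open>M1\<close> pointwise, and the Gaussian in \<open>y1\<close> integrates to 1 whatever
  its centre \<open>s f t1\<close>.\<close>

lemma sum_gain1_triple_integral_le:
  assumes v: "v > 0" and k: "\<And>f t1. k f t1 \<ge> 0"
    and meas: "meas3 (\<lambda>f t1 y. k f t1 * vec_gauss N v (\<lambda>i. y i - s f t1 i))"
  shows "(\<Sum>w\<in>{1..M1}. triple_integral (\<lambda>f t1 t2. gain1 w (y1_of w t2) * (k f t1 * vec_gauss N v (\<lambda>i. y1_of w t2 i - s f t1 i))))
    \<le> of_nat M1 * (\<integral>\<^sup>+f. \<integral>\<^sup>+t1. ennreal (k f t1) \<partial>V \<partial>V)"
proof -
  let ?K = "\<lambda>f t1 y. k f t1 * vec_gauss N v (\<lambda>i. y i - s f t1 i)"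
  note [measurable (raw)] = meas3_compose[OF meas]
  have K0: "?K f t1 y \<ge> 0" for f t1 y
    using k vec_gauss_pos[OF v] by (simp add: less_imp_le)
  have m: "meas3 (\<lambda>f t1 y. gain1 w y * ?K f t1 y)" for w
    by (rule meas3I) measurable
  have "(\<Sum>w\<in>{1..M1}. triple_integral (\<lambda>f t1 t2. gain1 w (y1_of w t2) * ?K f t1 (y1_of w t2)))
      = (\<Sum>w\<in>{1..M1}. triple_integral (\<lambda>f t1 y. gain1 w y * ?K f t1 y))"
    by (intro sum.cong refl triple_integral_translate_y1[OF m])
  also have "\<dots> = triple_integral (\<lambda>f t1 y. \<Sum>w\<in>{1..M1}. gain1 w y * ?K f t1 y)"
    by (rule triple_integral_sum[OF m]) (intro mult_nonneg_nonneg K0 less_imp_le[OF gain_pos(1)])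
  also have "\<dots> \<le> triple_integral (\<lambda>f t1 y. real M1 * ?K f t1 y)"
    unfolding sum_distrib_right[symmetric]
    by (intro triple_integral_mono mult_right_mono sum_gain1_le K0)
  also have "\<dots> = ennreal (real M1) * triple_integral ?K"
    by (rule triple_integral_cmult[OF meas]) (simp_all add: K0)
  also have "\<dots> = of_nat M1 * (\<integral>\<^sup>+f. \<integral>\<^sup>+t1. ennreal (k f t1) \<partial>V \<partial>V)"
    by (simp add: triple_integral_integrate_t2[OF v k] ennreal_of_nat_eq_real_of_nat)
  finally show ?thesis .
qed

text \<open>The translation from \<open>t1\<close> to \<open>y2\<close> depends on \<open>w\<close>
  and \<open>f\<close>, so it is carried out with \<open>f\<close> fixed. The order of
  \<open>y2\<close> and \<open>t2\<close> is then exchanged, since the centre of the Gaussian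
  depends on \<open>t2\<close>.\<close>

lemma sum_gain2_triple_integral_le:
  assumes v: "v > 0" and k: "\<And>f t2. k f t2 \<ge> 0"
    and meas: "meas3 (\<lambda>f y t2. k f t2 * vec_gauss N v (\<lambda>i. y i - s f t2 i))"
  shows "(\<Sum>w\<in>{1..M2}. triple_integral (\<lambda>f t1 t2. gain2 w (y2_of w f t1) * (k f t2 * vec_gauss N v (\<lambda>i. y2_of w f t1 i - s f t2 i))))
    \<le> of_nat M2 * (\<integral>\<^sup>+f. \<integral>\<^sup>+t2. ennreal (k f t2) \<partial>V \<partial>V)"
proof -
  let ?K = "\<lambda>f y t2. k f t2 * vec_gauss N v (\<lambda>i. y i - s f t2 i)"
  note [measurable (raw)] = meas3_compose[OF meas]
  have K0: "?K f y t2 \<ge> 0" for f t2 y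
    using k vec_gauss_pos[OF v] by (simp add: less_imp_le)
  have m: "meas3 (\<lambda>f y t2. gain2 w y * ?K f y t2)" for w
    by (rule meas3I) measurable
  have "(\<Sum>w\<in>{1..M2}. triple_integral (\<lambda>f t1 t2. gain2 w (y2_of w f t1) * ?K f (y2_of w f t1) t2))
      = (\<Sum>w\<in>{1..M2}. triple_integral (\<lambda>f y t2. gain2 w y * ?K f y t2))"
    by (intro sum.cong refl triple_integral_translate_y2[OF m])
  also have "\<dots> = triple_integral (\<lambda>f y t2. \<Sum>w\<in>{1..M2}. gain2 w y * ?K f y t2)"
    by (rule triple_integral_sum[OF m]) (intro mult_nonneg_nonneg K0 less_imp_le[OF gain_pos(2)])
  also have "\<dots> \<le> triple_integral (\<lambda>f y t2. real M2 * ?K f y t2)"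
    unfolding sum_distrib_right[symmetric]
    by (intro triple_integral_mono mult_right_mono sum_gain2_le K0)
  also have "\<dots> = ennreal (real M2) * triple_integral ?K"
    by (rule triple_integral_cmult[OF meas]) (simp_all add: K0)
  also have "triple_integral ?K = triple_integral (\<lambda>f t2 y. ?K f y t2)"
    by (rule triple_integral_swap[OF meas])
  also have "ennreal (real M2) * \<dots> = of_nat M2 * (\<integral>\<^sup>+f. \<integral>\<^sup>+t2. ennreal (k f t2) \<partial>V \<partial>V)"
    by (simp add: triple_integral_integrate_t2[OF v k] ennreal_of_nat_eq_real_of_nat)
  finally show ?thesis .
qed

lemma sum_gain_integral_le:
  assumes v: "v > 0"
  shows "(\<Sum>w\<in>{1..M1}. \<integral>\<^sup>+y. ennreal (gain1 w y * vec_gauss N v y) \<partial>V) \<le> of_nat M1"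
    and "(\<Sum>w\<in>{1..M2}. \<integral>\<^sup>+y. ennreal (gain2 w y * vec_gauss N v y) \<partial>V) \<le> of_nat M2"
proof -
  have gen: "(\<Sum>w\<in>{1..M}. \<integral>\<^sup>+y. ennreal (g w y * vec_gauss N v y) \<partial>V) \<le> of_nat M"
    if [measurable]: "\<And>w. g w \<in> borel_measurable V" and g0: "\<And>w y. g w y > 0"
      and le: "\<And>y. (\<Sum>w\<in>{1..M}. g w y) \<le> real M" for g :: "nat \<Rightarrow> (nat \<Rightarrow> complex) \<Rightarrow> real" and M
  proof -
    have "(\<Sum>w\<in>{1..M}. \<integral>\<^sup>+y. ennreal (g w y * vec_gauss N v y) \<partial>V)
        = (\<integral>\<^sup>+y. (\<Sum>w\<in>{1..M}. ennreal (g w y * vec_gauss N v y)) \<partial>V)"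
      by (rule nn_integral_sum[symmetric]) measurable
    also have "\<dots> \<le> (\<integral>\<^sup>+y. ennreal (real M) * ennreal (vec_gauss N v y) \<partial>V)"
    proof (rule nn_integral_mono)
      fix y
      have "(\<Sum>w\<in>{1..M}. ennreal (g w y * vec_gauss N v y)) = ennreal ((\<Sum>w\<in>{1..M}. g w y) * vec_gauss N v y)"
        using g0 vec_gauss_pos[OF v] by (simp add: sum_ennreal less_imp_le sum_distrib_right)
      also have "\<dots> \<le> ennreal (real M * vec_gauss N v y)"
        by (intro ennreal_leI mult_right_mono le less_imp_le[OF vec_gauss_pos[OF v]])
      finally show "(\<Sum>w\<in>{1..M}. ennreal (g w y * vec_gauss N v y)) \<le> ennreal (real M) * ennreal (vec_gauss N v y)"
        using vec_gauss_pos[OF v] by (simp add: ennreal_mult less_imp_le)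
    qed
    also have "\<dots> = of_nat M"
      using nn_integral_vec_gauss_diff[OF v, of N "\<lambda>_. 0"]
      by (simp add: nn_integral_cmult ennreal_of_nat_eq_real_of_nat)
    finally show ?thesis .
  qed
  show "(\<Sum>w\<in>{1..M1}. \<integral>\<^sup>+y. ennreal (gain1 w y * vec_gauss N v y) \<partial>V) \<le> of_nat M1"
    by (rule gen) (auto simp: gain_pos sum_gain1_le)
  show "(\<Sum>w\<in>{1..M2}. \<integral>\<^sup>+y. ennreal (gain2 w y * vec_gauss N v y) \<partial>V) \<le> of_nat M2"
    by (rule gen) (auto simp: gain_pos sum_gain2_le)
qed

lemma sum_triple_integral_dens2:
  assumes meas: "meas3 h" and h0: "\<And>f t1 t2. h f t1 t2 \<ge> 0"
    and \<phi>: "\<And>w2 f t1 t2. w2 \<in> {1..M2} \<Longrightarrow> \<phi> w2 f t1 t2 = h f t1 t2 / mix2 f t2 * dens2 w2 f t2"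
  shows "(\<Sum>w2\<in>{1..M2}. triple_integral (\<phi> w2)) = of_nat M2 * triple_integral h"
proof -
  note [measurable (raw)] = meas3_compose[OF meas]
  have \<phi>': "\<phi> w2 = (\<lambda>f t1 t2. h f t1 t2 / mix2 f t2 * dens2 w2 f t2)" if "w2 \<in> {1..M2}" for w2
    by (intro ext) (rule \<phi>[OF that])
  have "(\<Sum>w2\<in>{1..M2}. triple_integral (\<phi> w2)) = (\<Sum>w2\<in>{1..M2}. triple_integral (\<lambda>f t1 t2. h f t1 t2 / mix2 f t2 * dens2 w2 f t2))"
    by (intro sum.cong refl arg_cong[where f = triple_integral] \<phi>')
  also have "\<dots> = triple_integral (\<lambda>f t1 t2. \<Sum>w2\<in>{1..M2}. h f t1 t2 / mix2 f t2 * dens2 w2 f t2)"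
    using h0 mix2_pos dens2_pos
    by (intro triple_integral_sum meas3I) (measurable, auto simp: less_imp_le)
  also have "(\<lambda>f t1 t2. \<Sum>w2\<in>{1..M2}. h f t1 t2 / mix2 f t2 * dens2 w2 f t2) = (\<lambda>f t1 t2. real M2 * h f t1 t2)"
    by (intro ext) (simp only: sum_distrib_left[symmetric] sum_dens2, simp add: less_imp_neq[OF mix2_pos, symmetric])
  also have "triple_integral \<dots> = of_nat M2 * triple_integral h"
    by (subst triple_integral_cmult[OF meas]) (auto simp: h0 ennreal_of_nat_eq_real_of_nat)
  finally show ?thesis .
qed

lemma sum_triple_integral_dens1:
  assumes meas: "meas3 h" and h0: "\<And>f t1 t2. h f t1 t2 \<ge> 0"
    and \<phi>: "\<And>w1 f t1 t2. w1 \<in> {1..M1} \<Longrightarrow> \<phi> w1 f t1 t2 = h f t1 t2 / mix1 N N f t1 * dens1 w1 f t1"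
  shows "(\<Sum>w1\<in>{1..M1}. triple_integral (\<phi> w1)) = of_nat M1 * triple_integral h"
proof -
  note [measurable (raw)] = meas3_compose[OF meas]
  have \<phi>': "\<phi> w1 = (\<lambda>f t1 t2. h f t1 t2 / mix1 N N f t1 * dens1 w1 f t1)" if "w1 \<in> {1..M1}" for w1
    by (intro ext) (rule \<phi>[OF that])
  have "(\<Sum>w1\<in>{1..M1}. triple_integral (\<phi> w1)) = (\<Sum>w1\<in>{1..M1}. triple_integral (\<lambda>f t1 t2. h f t1 t2 / mix1 N N f t1 * dens1 w1 f t1))"
    by (intro sum.cong refl arg_cong[where f = triple_integral] \<phi>')
  also have "\<dots> = triple_integral (\<lambda>f t1 t2. \<Sum>w1\<in>{1..M1}. h f t1 t2 / mix1 N N f t1 * dens1 w1 f t1)"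
    using h0 mix1_pos dens1_pos
    by (intro triple_integral_sum meas3I) (measurable, auto simp: less_imp_le)
  also have "(\<lambda>f t1 t2. \<Sum>w1\<in>{1..M1}. h f t1 t2 / mix1 N N f t1 * dens1 w1 f t1) = (\<lambda>f t1 t2. real M1 * h f t1 t2)"
    by (intro ext) (simp only: sum_distrib_left[symmetric] sum_dens1, simp add: less_imp_neq[OF mix1_pos, symmetric])
  also have "triple_integral \<dots> = of_nat M1 * triple_integral h"
    by (subst triple_integral_cmult[OF meas]) (auto simp: h0 ennreal_of_nat_eq_real_of_nat)
  finally show ?thesis .
qed

text \<open>
  The ratios \<open>A1\<close>, \<open>B1\<close>, \<open>C1\<close> belong to \<open>I(W1; Y1)\<close>, \<open>I(W1; Y1, T1, Yf | W2)\<close>, \<open>I(W2; Y2, T2, Yf)\<close>, and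
  \<open>A2\<close>, \<open>B2\<close>, \<open>C2\<close> belong to \<open>I(W2; Y2)\<close>, \<open>I(W2; Y2, T2, Yf | W1)\<close>, \<open>I(W1; Y1, Yf, T1)\<close>; factors that cancel in
  the sum of the three logarithms are already omitted. The free coefficients are those of linear estimators.
\<close>

lemma expect_ratio_A1:
  assumes v: "v > 0"
  shows "expect (\<lambda>w1 w2 f t1 t2. gain1 w1 (y1_of w1 t2) * vec_gauss N v (y1_of w1 t2) / mix2 f t2) \<le> 1"
proof (rule expect_le_1_A[OF eq_refl sum_gain_integral_le(1)[OF v]])
  fix w1 :: nat
  let ?h = "\<lambda>f t1 y. dens1 w1 f t1 * (gain1 w1 y * vec_gauss N v y)"
  have "(\<Sum>w2\<in>{1..M2}. triple_integral (\<lambda>f t1 t2. gain1 w1 (y1_of w1 t2) * vec_gauss N v (y1_of w1 t2) / mix2 f t2 *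
      dens1 w1 f t1 * dens2 w2 f t2)) = of_nat M2 * triple_integral (\<lambda>f t1 t2. ?h f t1 (y1_of w1 t2))"
    by (rule sum_triple_integral_dens2)
      (intro meas3I, measurable, simp_all add: less_imp_le dens1_pos gain_pos vec_gauss_pos[OF v])
  \<comment> \<open>For fixed \<open>w1\<close> the change from \<open>t2\<close> to
    \<open>y1\<close> is a translation; afterwards the integral over \<open>f\<close> and
    \<open>t1\<close> separates from the one over \<open>y1\<close>.\<close>
  also have "triple_integral (\<lambda>f t1 t2. ?h f t1 (y1_of w1 t2)) = triple_integral ?h"
    by (intro triple_integral_translate_y1 meas3I) measurable
  also have "\<dots> = (\<integral>\<^sup>+y. ennreal (gain1 w1 y * vec_gauss N v y) \<partial>V)"
  proof -
    have "triple_integral ?h = (\<integral>\<^sup>+f. \<integral>\<^sup>+t1. ennreal (dens1 w1 f t1) * (\<integral>\<^sup>+y. ennreal (gain1 w1 y * vec_gauss N v y) \<partial>V) \<partial>V \<partial>V)"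
      unfolding triple_integral_def using dens1_pos gain_pos vec_gauss_pos[OF v]
      by (simp add: ennreal_mult[of "dens1 _ _ _"] less_imp_le nn_integral_cmult)
    also have "\<dots> = (\<integral>\<^sup>+f. (\<integral>\<^sup>+t1. ennreal (dens1 w1 f t1) \<partial>V) * (\<integral>\<^sup>+y. ennreal (gain1 w1 y * vec_gauss N v y) \<partial>V) \<partial>V)"
      by (intro nn_integral_cong nn_integral_multc) measurable
    also have "\<dots> = (\<integral>\<^sup>+f. \<integral>\<^sup>+t1. ennreal (dens1 w1 f t1) \<partial>V \<partial>V) * (\<integral>\<^sup>+y. ennreal (gain1 w1 y * vec_gauss N v y) \<partial>V)"
      by (intro nn_integral_multc) measurable
    finally show ?thesis by (simp add: nn_integral_dens1)
  qed
  finally show "(\<Sum>w2\<in>{1..M2}. triple_integral (\<lambda>f t1 t2. gain1 w1 (y1_of w1 t2) * vec_gauss N v (y1_of w1 t2) / mix2 f t2 *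
      dens1 w1 f t1 * dens2 w2 f t2)) = of_nat M2 * (\<integral>\<^sup>+y. ennreal (gain1 w1 y * vec_gauss N v y) \<partial>V)" .
qed

text \<open>\<open>mix1 N N f t1\<close> times the Gaussian is a density of
  \<open>(Yf, T1, Y1)\<close> that may use \<open>w2\<close> but not \<open>w1\<close>. Centring at
  \<open>g12 * xs2 w2 f i\<close> is allowed because \<open>f\<close> and \<open>w2\<close>
  determine the input of transmitter 2. The denominator is the true density, so only the sum of the
  rewards over \<open>w1\<close> has to be controlled.\<close>

lemma expect_ratio_B1:
  assumes v: "v > 0"
  shows "expect (\<lambda>w1 w2 f t1 t2. gain1 w1 (y1_of w1 t2) * mix1 N N f t1 *
      vec_gauss N v (\<lambda>i. y1_of w1 t2 i - (g12 * xs2 w2 f i + \<alpha> * t1 i + \<beta> * f i)) / (dens1 w1 f t1 * dens2 w2 f t2)) \<le> 1"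
proof (rule expect_le_1_B[where Y = "\<lambda>_. 1"])
  fix w2
  have "(\<Sum>w1\<in>{1..M1}. triple_integral (\<lambda>f t1 t2. gain1 w1 (y1_of w1 t2) *
      (mix1 N N f t1 * vec_gauss N v (\<lambda>i. y1_of w1 t2 i - (g12 * xs2 w2 f i + \<alpha> * t1 i + \<beta> * f i)))))
      \<le> of_nat M1 * (\<integral>\<^sup>+f. \<integral>\<^sup>+t1. ennreal (mix1 N N f t1) \<partial>V \<partial>V)"
    by (rule sum_gain1_triple_integral_le[OF v]) (simp_all add: less_imp_le mix1_pos)
  then show "(\<Sum>w1\<in>{1..M1}. triple_integral (\<lambda>f t1 t2. gain1 w1 (y1_of w1 t2) * mix1 N N f t1 *
      vec_gauss N v (\<lambda>i. y1_of w1 t2 i - (g12 * xs2 w2 f i + \<alpha> * t1 i + \<beta> * f i)) / (dens1 w1 f t1 * dens2 w2 f t2)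
      * dens1 w1 f t1 * dens2 w2 f t2)) \<le> of_nat M1 * 1"
    using dens1_pos dens2_pos by (simp add: nn_integral_mix1 less_imp_neq[symmetric] mult.assoc)
qed simp

text \<open>The true density of \<open>(Yf, T2, Y2)\<close> given \<open>w2\<close> is
  \<open>mix1 N N f t1 * dens2 w2 f t2\<close>. In the reference density, \<open>Yf\<close> becomes
  Gaussian and \<open>Y2\<close> becomes Gaussian around a linear estimate, while the law of
  \<open>T2\<close> given \<open>Yf\<close> is kept exact as \<open>mix2\<close>, so that it cancels
  against the ratio for \<open>I(W1; Y1)\<close>.\<close>

lemma expect_ratio_C1:
  assumes v: "v > 0" "v' > 0"
  shows "expect (\<lambda>w1 w2 f t1 t2. gain2 w2 (y2_of w2 f t1) * vec_gauss N v f * mix2 f t2 *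
      vec_gauss N v' (\<lambda>i. y2_of w2 f t1 i - (\<alpha> * t2 i + \<beta> * f i)) / (mix1 N N f t1 * dens2 w2 f t2)) \<le> 1"
proof (rule expect_le_1_B)
  fix w2
  show "(\<Sum>w1\<in>{1..M1}. triple_integral (\<lambda>f t1 t2. gain2 w2 (y2_of w2 f t1) * vec_gauss N v f * mix2 f t2 *
      vec_gauss N v' (\<lambda>i. y2_of w2 f t1 i - (\<alpha> * t2 i + \<beta> * f i)) / (mix1 N N f t1 * dens2 w2 f t2)
      * dens1 w1 f t1 * dens2 w2 f t2)) \<le> of_nat M1 *
    triple_integral (\<lambda>f t1 t2. gain2 w2 (y2_of w2 f t1) * (vec_gauss N v f * mix2 f t2 *
      vec_gauss N v' (\<lambda>i. y2_of w2 f t1 i - (\<alpha> * t2 i + \<beta> * f i))))"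
  proof (rule eq_refl, rule sum_triple_integral_dens1)
    fix w1 f t1 t2
    show "gain2 w2 (y2_of w2 f t1) * vec_gauss N v f * mix2 f t2 *
      vec_gauss N v' (\<lambda>i. y2_of w2 f t1 i - (\<alpha> * t2 i + \<beta> * f i)) / (mix1 N N f t1 * dens2 w2 f t2)
      * dens1 w1 f t1 * dens2 w2 f t2 = gain2 w2 (y2_of w2 f t1) * (vec_gauss N v f * mix2 f t2 *
      vec_gauss N v' (\<lambda>i. y2_of w2 f t1 i - (\<alpha> * t2 i + \<beta> * f i))) / mix1 N N f t1 * dens1 w1 f t1"
      using dens2_pos[of w2 f t2] mix1_pos[of N N f t1] by (simp add: field_simps)
    show "gain2 w2 (y2_of w2 f t1) * (vec_gauss N v f * mix2 f t2 *
      vec_gauss N v' (\<lambda>i. y2_of w2 f t1 i - (\<alpha> * t2 i + \<beta> * f i))) \<ge> 0"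
      by (intro mult_nonneg_nonneg less_imp_le gain_pos vec_gauss_pos v mix2_pos)
  qed (intro meas3I, measurable)
next
  have "(\<integral>\<^sup>+f. \<integral>\<^sup>+t2. ennreal (vec_gauss N v f * mix2 f t2) \<partial>V \<partial>V) = (\<integral>\<^sup>+f. ennreal (vec_gauss N v f) \<partial>V)"
    using v mix2_pos
    by (intro nn_integral_cong)
      (simp add: ennreal_mult less_imp_le vec_gauss_pos nn_integral_cmult nn_integral_mix2)
  also have "\<dots> = 1"
    using nn_integral_vec_gauss_diff[OF v(1), of N "\<lambda>_. 0"] by simp
  finally have *: "(\<integral>\<^sup>+f. \<integral>\<^sup>+t2. ennreal (vec_gauss N v f * mix2 f t2) \<partial>V \<partial>V) = 1" .
  have "(\<Sum>w2\<in>{1..M2}. triple_integral (\<lambda>f t1 t2. gain2 w2 (y2_of w2 f t1) * (vec_gauss N v f * mix2 f t2 *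
      vec_gauss N v' (\<lambda>i. y2_of w2 f t1 i - (\<alpha> * t2 i + \<beta> * f i)))))
    \<le> of_nat M2 * (\<integral>\<^sup>+f. \<integral>\<^sup>+t2. ennreal (vec_gauss N v f * mix2 f t2) \<partial>V \<partial>V)"
    by (rule sum_gain2_triple_integral_le[OF v(2)]) (simp_all add: less_imp_le mix2_pos vec_gauss_pos v)
  then show "(\<Sum>w2\<in>{1..M2}. triple_integral (\<lambda>f t1 t2. gain2 w2 (y2_of w2 f t1) * (vec_gauss N v f * mix2 f t2 *
      vec_gauss N v' (\<lambda>i. y2_of w2 f t1 i - (\<alpha> * t2 i + \<beta> * f i))))) \<le> of_nat M2"
    by (simp add: *)
qed

text \<open>Given \<open>w1\<close>, the density of \<open>f\<close> is the same in the reference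
  and in the true density and has been cancelled; \<open>?n\<close> brings it back when the ratio is
  integrated.\<close>

lemma expect_ratio_B2:
  assumes v: "v > 0"
  shows "expect (\<lambda>w1 w2 f t1 t2. gain2 w2 (y2_of w2 f t1) * mix2 f t2 *
      vec_gauss N v (\<lambda>i. y2_of w2 f t1 i - (g21 * xs1 w1 i + \<alpha> * t2 i)) /
      (vec_gauss N 1 (\<lambda>i. t1 i - g21 * xs1 w1 i) * dens2 w2 f t2)) \<le> 1"
proof (rule expect_le_1_A[where Y = "\<lambda>_. 1"])
  fix w1
  let ?n = "\<lambda>f. vec_gauss N 1 (\<lambda>i. f i - gf * xs1 w1 i)"
  have "(\<integral>\<^sup>+f. \<integral>\<^sup>+t2. ennreal (?n f * mix2 f t2) \<partial>V \<partial>V) = (\<integral>\<^sup>+f. ennreal (?n f) \<partial>V)"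
    using v mix2_pos
    by (intro nn_integral_cong)
      (simp add: ennreal_mult less_imp_le vec_gauss_pos nn_integral_cmult nn_integral_mix2)
  also have "\<dots> = 1"
    by (rule nn_integral_vec_gauss_diff) simp
  finally have *: "(\<integral>\<^sup>+f. \<integral>\<^sup>+t2. ennreal (?n f * mix2 f t2) \<partial>V \<partial>V) = 1" .
  have "(\<Sum>w2\<in>{1..M2}. triple_integral (\<lambda>f t1 t2. gain2 w2 (y2_of w2 f t1) * (?n f * mix2 f t2 *
      vec_gauss N v (\<lambda>i. y2_of w2 f t1 i - (g21 * xs1 w1 i + \<alpha> * t2 i)))))
    \<le> of_nat M2 * (\<integral>\<^sup>+f. \<integral>\<^sup>+t2. ennreal (?n f * mix2 f t2) \<partial>V \<partial>V)"
    by (rule sum_gain2_triple_integral_le[OF v]) (simp_all add: less_imp_le mix2_pos vec_gauss_pos)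
  moreover have "gain2 w2 (y2_of w2 f t1) * mix2 f t2 *
      vec_gauss N v (\<lambda>i. y2_of w2 f t1 i - (g21 * xs1 w1 i + \<alpha> * t2 i)) /
      (vec_gauss N 1 (\<lambda>i. t1 i - g21 * xs1 w1 i) * dens2 w2 f t2) * dens1 w1 f t1 * dens2 w2 f t2
    = gain2 w2 (y2_of w2 f t1) * (?n f * mix2 f t2 *
      vec_gauss N v (\<lambda>i. y2_of w2 f t1 i - (g21 * xs1 w1 i + \<alpha> * t2 i)))" for w2 f t1 t2
    using vec_gauss_pos[of 1 N "\<lambda>i. t1 i - g21 * xs1 w1 i"] dens2_pos[of w2 f t2]
    by (simp add: dens1_def field_simps)
  ultimately show "(\<Sum>w2\<in>{1..M2}. triple_integral (\<lambda>f t1 t2. gain2 w2 (y2_of w2 f t1) * mix2 f t2 *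
      vec_gauss N v (\<lambda>i. y2_of w2 f t1 i - (g21 * xs1 w1 i + \<alpha> * t2 i)) /
      (vec_gauss N 1 (\<lambda>i. t1 i - g21 * xs1 w1 i) * dens2 w2 f t2) * dens1 w1 f t1 * dens2 w2 f t2)) \<le> of_nat M2 * 1"
    by (simp add: *)
qed simp

section \<open>Causal conditioning\<close>

lemma mix1_cong:
  assumes "\<And>i. i \<in> {1..k} \<Longrightarrow> t i = t' i" "\<And>i. i \<in> {1..j} \<Longrightarrow> f i = f' i"
  shows "mix1 k j f t = mix1 k j f' t'"
  unfolding mix1_def
  by (intro arg_cong2[where f = "(/)"] sum.cong arg_cong2[where f = "(*)"] vec_gauss_cong refl)
    (use assms in auto)

lemma mix1_0_0 [simp]: "mix1 0 0 f t = 1"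
  using M1 by (simp add: mix1_def vec_gauss_def)

lemma nn_integral_gauss_density_diff:
  "(\<integral>\<^sup>+x. ennreal (gauss_density 1 (x - a)) \<partial>lborel) = 1"
  using nn_integral_lborel_translate[of "\<lambda>x. ennreal (gauss_density 1 x)" "- a"]
  by (simp add: nn_integral_gauss_density)

lemma nn_integral_weighted_gauss:
  assumes "\<And>w. k w \<ge> 0"
  shows "(\<integral>\<^sup>+x. ennreal ((\<Sum>w\<in>W. k w * gauss_density 1 (x - a w)) / real M) \<partial>lborel)
    = ennreal ((\<Sum>w\<in>W. k w) / real M)"
proof -
  have g0: "gauss_density 1 z \<ge> 0" for z by (simp add: gauss_density_pos less_imp_le)
  have "(\<integral>\<^sup>+x. ennreal ((\<Sum>w\<in>W. k w * gauss_density 1 (x - a w)) / real M) \<partial>lborel)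
    = (\<integral>\<^sup>+x. (\<Sum>w\<in>W. ennreal (k w / real M) * ennreal (gauss_density 1 (x - a w))) \<partial>lborel)"
    using assms g0
    by (intro nn_integral_cong)
      (simp add: ennreal_mult[symmetric] sum_ennreal sum_divide_distrib)
  also have "\<dots> = (\<Sum>w\<in>W. ennreal (k w / real M))"
    by (simp add: nn_integral_sum nn_integral_cmult nn_integral_gauss_density_diff)
  also have "\<dots> = ennreal ((\<Sum>w\<in>W. k w) / real M)"
    using assms by (simp add: sum_ennreal sum_divide_distrib)
  finally show ?thesis .
qed

lemma nn_integral_mix1_f:
  "(\<integral>\<^sup>+x. ennreal (mix1 k (Suc j) (f(Suc j := x)) t) \<partial>lborel) = ennreal (mix1 k j f t)"
proof -
  have "vec_gauss j 1 (\<lambda>i. (if i = Suc j then x else f i) - gf * xs1 w i) = vec_gauss j 1 (\<lambda>i. f i - gf * xs1 w i)" for x w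
    by (rule vec_gauss_cong) simp
  then show ?thesis
    unfolding mix1_def vec_gauss_mult_Suc mult.assoc[symmetric] fun_upd_def
    by (subst nn_integral_weighted_gauss[symmetric]) (simp_all add: vec_gauss_pos less_imp_le)
qed

lemma nn_integral_mix1_t:
  "(\<integral>\<^sup>+x. ennreal (mix1 (Suc k) j f (t(Suc k := x))) \<partial>lborel) = ennreal (mix1 k j f t)"
proof -
  have "vec_gauss k 1 (\<lambda>i. (if i = Suc k then x else t i) - g21 * xs1 w i) = vec_gauss k 1 (\<lambda>i. t i - g21 * xs1 w i)" for x w
    by (rule vec_gauss_cong) simp
  moreover have "mix1 k j f t = (\<Sum>w\<in>{1..M1}. vec_gauss j 1 (\<lambda>i. f i - gf * xs1 w i) * vec_gauss k 1 (\<lambda>i. t i - g21 * xs1 w i)) / real M1"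
    unfolding mix1_def by (simp add: mult.commute)
  moreover have "mix1 (Suc k) j f t' = (\<Sum>w\<in>{1..M1}. vec_gauss j 1 (\<lambda>i. f i - gf * xs1 w i) * vec_gauss k 1 (\<lambda>i. t' i - g21 * xs1 w i)
      * gauss_density 1 (t' (Suc k) - g21 * xs1 w (Suc k))) / real M1" for t'
    unfolding mix1_def vec_gauss_mult_Suc by (simp add: ac_simps)
  ultimately show ?thesis
    unfolding fun_upd_def
    by (simp add: nn_integral_weighted_gauss vec_gauss_pos less_imp_le)
qed

text \<open>
  \<open>caus\<close> is the density of \<open>t1\<close> causally conditioned on \<open>f\<close>, i.e. the product of the densities of
  \<open>t1 i\<close> given \<open>t1 1, \<dots>, t1 (i - 1), f 1, \<dots>, f (i - 1)\<close>; \<open>caus'\<close> is the complementary factor.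
\<close>

definition caus :: "(nat \<Rightarrow> complex) \<Rightarrow> (nat \<Rightarrow> complex) \<Rightarrow> real" where
  "caus f t1 = (\<Prod>i\<in>{1..N}. mix1 i (i - 1) f t1 / mix1 (i - 1) (i - 1) f t1)"

definition caus' :: "(nat \<Rightarrow> complex) \<Rightarrow> (nat \<Rightarrow> complex) \<Rightarrow> real" where
  "caus' f t1 = (\<Prod>i\<in>{1..N}. mix1 i i f t1 / mix1 i (i - 1) f t1)"

lemma caus_pos: "caus f t1 > 0" and caus'_pos: "caus' f t1 > 0"
  unfolding caus_def caus'_def by (auto intro!: prod_pos divide_pos_pos mix1_pos)

text \<open>The prefix lengths climb a staircase \<open>(i - 1, i - 1)\<close>,
  \<open>(i, i - 1)\<close>, \<open>(i, i)\<close>, and the quotients telescope, starting from the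
  empty prefixes, where the density is 1.\<close>

lemma caus_mult_caus': "caus f t1 * caus' f t1 = mix1 N N f t1"
proof -
  have "(\<Prod>i\<in>{1..n}. mix1 i (i - 1) f t1 / mix1 (i - 1) (i - 1) f t1) * (\<Prod>i\<in>{1..n}. mix1 i i f t1 / mix1 i (i - 1) f t1)
      = mix1 n n f t1" for n
  proof (induction n)
    case (Suc n)
    let ?P = "\<lambda>n. \<Prod>i\<in>{1..n}. mix1 i (i - 1) f t1 / mix1 (i - 1) (i - 1) f t1"
    let ?Q = "\<lambda>n. \<Prod>i\<in>{1..n}. mix1 i i f t1 / mix1 i (i - 1) f t1"
    have "?P (Suc n) * ?Q (Suc n) = (?P n * ?Q n) * (mix1 (Suc n) n f t1 / mix1 n n f t1) * (mix1 (Suc n) (Suc n) f t1 / mix1 (Suc n) n f t1)"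
      by (simp add: ac_simps)
    also have "\<dots> = mix1 (Suc n) (Suc n) f t1"
      unfolding Suc.IH using mix1_pos[of n n f t1] mix1_pos[of "Suc n" n f t1] by simp
    finally show ?case .
  qed simp
  then show ?thesis unfolding caus_def caus'_def .
qed

lemma caus_measurable [measurable (raw)]:
  assumes [measurable]: "f \<in> M \<rightarrow>\<^sub>M V" "t \<in> M \<rightarrow>\<^sub>M V"
  shows "(\<lambda>x. caus (f x) (t x)) \<in> borel_measurable M" "(\<lambda>x. caus' (f x) (t x)) \<in> borel_measurable M"
  unfolding caus_def caus'_def
  by (auto intro!: borel_measurable_prod borel_measurable_divide mix1_measurable)

lemma caus'_cong: "(\<And>i. i \<in> {1..N} \<Longrightarrow> t i = t' i) \<Longrightarrow> caus' f t = caus' f t'"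
  unfolding caus'_def by (intro prod.cong arg_cong2[where f = "(/)"] mix1_cong) auto

text \<open>Inverts \<open>y2_of w2 f\<close>. With \<open>y\<close> held fixed, it makes
  \<open>t1\<close> a function of \<open>f\<close>.\<close>

definition t1_from :: "nat \<Rightarrow> (nat \<Rightarrow> complex) \<Rightarrow> (nat \<Rightarrow> complex) \<Rightarrow> nat \<Rightarrow> complex" where
  "t1_from w2 f y = (\<lambda>i\<in>{1..N}. y i - g22 * xs2 w2 f i)"

lemma t1_from_measurable [measurable (raw)]:
  assumes [measurable]: "f \<in> M \<rightarrow>\<^sub>M V" "y \<in> M \<rightarrow>\<^sub>M V"
  shows "(\<lambda>x. t1_from w2 (f x) (y x)) \<in> M \<rightarrow>\<^sub>M V"
  unfolding t1_from_def by measurable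

lemma xs2_cong:
  assumes "\<And>j. j \<in> {1..<i} \<Longrightarrow> f j = f' j"
  shows "xs2 w f i = xs2 w f' i"
  unfolding xs2_def using assms by (intro arg_cong[where f = "enc2 c i w"]) (auto simp: restrict_def)

lemma vec_gauss_borel:
  assumes "\<And>i. i \<in> {1..n} \<Longrightarrow> (\<lambda>x. r x i) \<in> borel_measurable M"
  shows "(\<lambda>x. vec_gauss n 1 (\<lambda>i. r x i - a i)) \<in> borel_measurable M"
  using assms by (intro vec_gauss_measurable borel_measurable_diff) auto

lemma mix1_borel:
  assumes "\<And>i. i \<in> {1..k} \<Longrightarrow> (\<lambda>x. t x i) \<in> borel_measurable M"
    "\<And>i. i \<in> {1..j} \<Longrightarrow> (\<lambda>x. f x i) \<in> borel_measurable M"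
  shows "(\<lambda>x. mix1 k j (f x) (t x)) \<in> borel_measurable M"
  unfolding mix1_def using assms
  by (intro borel_measurable_divide borel_measurable_sum borel_measurable_times vec_gauss_borel) auto

lemma component_vec_lborel: "i \<in> {1..n} \<Longrightarrow> (\<lambda>f. f i) \<in> borel_measurable (vec_lborel n)"
  by measurable

text \<open>
  The kernels are causal because \<open>t1_from w2 f y\<close> at time \<open>i\<close> only involves \<open>f 1, \<dots>, f (i - 1)\<close>.
\<close>

lemma nn_integral_caus': "(\<integral>\<^sup>+f. ennreal (caus' f (t1_from w2 f y)) \<partial>V) = 1"
proof -
  let ?\<kappa> = "\<lambda>i f. ennreal (mix1 i i f (t1_from w2 f y) / mix1 i (i - 1) f (t1_from w2 f y))"
  have "(\<integral>\<^sup>+f. ennreal (caus' f (t1_from w2 f y)) \<partial>V) = (\<integral>\<^sup>+f. (\<Prod>i\<in>{1..N}. ?\<kappa> i f) \<partial>V)"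
    unfolding caus'_def
    by (intro nn_integral_cong prod_ennreal[symmetric]) (simp add: mix1_pos less_imp_le)
  also have "\<dots> = 1"
  proof (rule nn_integral_causal_kernels)
    fix i assume i: "i \<in> {1..N}"
    have b: "(\<lambda>f. t1_from w2 f y j) \<in> borel_measurable (vec_lborel i)" if "j \<in> {1..i}" for j
    proof -
      have "(\<lambda>f. xs2 w2 f j) \<in> borel_measurable (vec_lborel i)"
        using that i by (intro xs2_measurable[where n = i]) auto
      then have "(\<lambda>f. y j - g22 * xs2 w2 f j) \<in> borel_measurable (vec_lborel i)"
        by measurable
      then show ?thesis using that i by (simp add: t1_from_def)
    qed
    show "?\<kappa> i \<in> borel_measurable (vec_lborel i)"
      using i by (intro measurable_compose[OF _ measurable_ennreal] borel_measurable_divide mix1_borel b component_vec_lborel) auto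
  next
    fix i f assume i: "i \<in> {1..N}"
    have b: "t1_from w2 (restrict f {1..i}) y j = t1_from w2 f y j" if "j \<in> {1..i}" for j
      using that by (auto simp: t1_from_def intro!: xs2_cong)
    have "mix1 i m (restrict f {1..i}) (t1_from w2 (restrict f {1..i}) y) = mix1 i m f (t1_from w2 f y)" if "m \<le> i" for m
      using that by (intro mix1_cong b) auto
    then show "?\<kappa> i (restrict f {1..i}) = ?\<kappa> i f" by simp
  next
    fix i f assume i: "i \<in> {1..N}"
    then obtain n where n: "i = Suc n" by (cases i) auto
    have b: "t1_from w2 (f(i := x)) y j = t1_from w2 f y j" if "j \<in> {1..i}" for j x
      using that by (auto simp: t1_from_def intro!: xs2_cong)
    have 1: "mix1 i i (f(i := x)) (t1_from w2 (f(i := x)) y) = mix1 i i (f(i := x)) (t1_from w2 f y)" for x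
      by (intro mix1_cong b) auto
    have 2: "mix1 i (i - 1) (f(i := x)) (t1_from w2 (f(i := x)) y) = mix1 i (i - 1) f (t1_from w2 f y)" for x
      by (intro mix1_cong b) auto
    have "(\<integral>\<^sup>+x. ?\<kappa> i (f(i := x)) \<partial>lborel)
      = (\<integral>\<^sup>+x. ennreal (mix1 i i (f(i := x)) (t1_from w2 f y)) * ennreal (inverse (mix1 i (i - 1) f (t1_from w2 f y))) \<partial>lborel)"
      unfolding 1 2 by (simp add: ennreal_mult[symmetric] mix1_pos less_imp_le divide_inverse)
    also have "\<dots> = ennreal (mix1 i (i - 1) f (t1_from w2 f y)) * ennreal (inverse (mix1 i (i - 1) f (t1_from w2 f y)))"
    proof -
      have "(\<lambda>x. mix1 i i (f(i := x)) (t1_from w2 f y)) \<in> borel_measurable lborel"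
        by (rule mix1_borel) (auto simp: fun_upd_def)
      then show ?thesis
        using nn_integral_mix1_f[of i n f] by (subst nn_integral_multc) (simp_all add: n)
    qed
    also have "\<dots> = 1"
      using mix1_pos[of i "i - 1" f "t1_from w2 f y"] by (simp add: ennreal_mult[symmetric] less_imp_le)
    finally show "(\<integral>\<^sup>+x. ?\<kappa> i (f(i := x)) \<partial>lborel) = 1" .
  qed
  finally show ?thesis .
qed

text \<open>Here the roles are reversed: \<open>s = f - a * t\<close> is held fixed and
  \<open>f\<close> follows \<open>t\<close>. Factor \<open>i\<close> of \<open>caus\<close> reads
  \<open>f\<close> only up to \<open>i - 1\<close>, so the new coordinate \<open>t i\<close> enters
  through \<open>t\<close> alone, and integrating over it lowers \<open>mix1 i (i - 1)\<close> to
  \<open>mix1 (i - 1) (i - 1)\<close>.\<close>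

lemma nn_integral_caus: "(\<integral>\<^sup>+t. ennreal (caus (\<lambda>i\<in>{1..N}. a * t i + s i) t) \<partial>V) = 1"
proof -
  let ?f = "\<lambda>t. \<lambda>i\<in>{1..N}. a * t i + s i"
  let ?\<kappa> = "\<lambda>i t. ennreal (mix1 i (i - 1) (?f t) t / mix1 (i - 1) (i - 1) (?f t) t)"
  have "(\<integral>\<^sup>+t. ennreal (caus (?f t) t) \<partial>V) = (\<integral>\<^sup>+t. (\<Prod>i\<in>{1..N}. ?\<kappa> i t) \<partial>V)"
    unfolding caus_def
    by (intro nn_integral_cong prod_ennreal[symmetric]) (simp add: mix1_pos less_imp_le)
  also have "\<dots> = 1"
  proof (rule nn_integral_causal_kernels)
    fix i assume i: "i \<in> {1..N}"
    have b: "(\<lambda>t. ?f t j) \<in> borel_measurable (vec_lborel i)" if "j \<in> {1..i}" for j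
      using that i by (simp add: component_vec_lborel)
    show "?\<kappa> i \<in> borel_measurable (vec_lborel i)"
      using i by (intro measurable_compose[OF _ measurable_ennreal] borel_measurable_divide mix1_borel b component_vec_lborel) auto
  next
    fix i t assume i: "i \<in> {1..N}"
    have "mix1 k m (?f (restrict t {1..i})) (restrict t {1..i}) = mix1 k m (?f t) t" if "k \<le> i" "m \<le> i" for k m
      using that by (intro mix1_cong) (auto simp: restrict_def)
    then show "?\<kappa> i (restrict t {1..i}) = ?\<kappa> i t" by simp
  next
    fix i t assume i: "i \<in> {1..N}"
    then obtain n where n: "i = Suc n" by (cases i) auto
    have 1: "mix1 i (i - 1) (?f (t(i := x))) (t(i := x)) = mix1 i (i - 1) (?f t) (t(i := x))" for x
      by (intro mix1_cong) auto
    have 2: "mix1 (i - 1) (i - 1) (?f (t(i := x))) (t(i := x)) = mix1 (i - 1) (i - 1) (?f t) t" for x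
      by (intro mix1_cong) auto
    have "(\<integral>\<^sup>+x. ?\<kappa> i (t(i := x)) \<partial>lborel)
      = (\<integral>\<^sup>+x. ennreal (mix1 i (i - 1) (?f t) (t(i := x))) * ennreal (inverse (mix1 (i - 1) (i - 1) (?f t) t)) \<partial>lborel)"
      unfolding 1 2 by (simp add: ennreal_mult[symmetric] mix1_pos less_imp_le divide_inverse)
    also have "\<dots> = ennreal (mix1 (i - 1) (i - 1) (?f t) t) * ennreal (inverse (mix1 (i - 1) (i - 1) (?f t) t))"
    proof -
      have "(\<lambda>x. mix1 i (i - 1) (?f t) (t(i := x))) \<in> borel_measurable lborel"
        by (rule mix1_borel) (auto simp: fun_upd_def)
      then show ?thesis
        using nn_integral_mix1_t[of n n _ t] by (subst nn_integral_multc) (simp_all add: n)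
    qed
    also have "\<dots> = 1"
      using mix1_pos[of "i - 1" "i - 1" "?f t" t] by (simp add: ennreal_mult[symmetric] less_imp_le)
    finally show "(\<integral>\<^sup>+x. ?\<kappa> i (t(i := x)) \<partial>lborel) = 1" .
  qed
  finally show ?thesis .
qed

text \<open>Summing over \<open>w1\<close> produces \<open>mix1 N N\<close>, of which
  \<open>caus'\<close> survives the division. For fixed \<open>y2\<close> and \<open>w2\<close> the
  block \<open>t1\<close> varies with \<open>f\<close>, so an ordinary conditional density of
  \<open>f\<close> given \<open>t1\<close> would in general not integrate to 1 over
  \<open>f\<close>, whereas \<open>caus'\<close> does. This forces the causal density in the
  denominator.\<close>

lemma expect_ratio_A2:
  assumes v: "v > 0"
  shows "expect (\<lambda>w1 w2 f t1 t2. gain2 w2 (y2_of w2 f t1) * vec_gauss N v (y2_of w2 f t1) / caus f t1) \<le> 1"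
proof (rule expect_le_1_B[OF eq_refl sum_gain_integral_le(2)[OF v]])
  fix w2 :: nat
  let ?q = "\<lambda>y. gain2 w2 y * vec_gauss N v y"
  let ?h = "\<lambda>f y t2. ?q y * caus' f (t1_from w2 f y) * dens2 w2 f t2"
  have q0: "?q y \<ge> 0" for y by (simp add: less_imp_le gain_pos vec_gauss_pos v)
  have "(\<Sum>w1\<in>{1..M1}. triple_integral (\<lambda>f t1 t2. gain2 w2 (y2_of w2 f t1) * vec_gauss N v (y2_of w2 f t1) / caus f t1 *
      dens1 w1 f t1 * dens2 w2 f t2)) = of_nat M1 * triple_integral (\<lambda>f t1 t2. ?h f (y2_of w2 f t1) t2)"
  proof (rule sum_triple_integral_dens1)
    show "meas3 (\<lambda>f t1 t2. ?h f (y2_of w2 f t1) t2)"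
      by (intro meas3I) measurable
    show "?h f (y2_of w2 f t1) t2 \<ge> 0" for f t1 t2
      by (intro mult_nonneg_nonneg less_imp_le gain_pos vec_gauss_pos v caus'_pos dens2_pos)
    fix w1 f t1 t2
    have "caus' f (t1_from w2 f (y2_of w2 f t1)) = caus' f t1"
      by (rule caus'_cong) (simp add: t1_from_def y2_of_def)
    then show "gain2 w2 (y2_of w2 f t1) * vec_gauss N v (y2_of w2 f t1) / caus f t1 * dens1 w1 f t1 * dens2 w2 f t2
      = ?h f (y2_of w2 f t1) t2 / mix1 N N f t1 * dens1 w1 f t1"
      using caus_pos[of f t1] caus'_pos[of f t1] by (simp add: caus_mult_caus'[symmetric])
  qed
  also have "triple_integral (\<lambda>f t1 t2. ?h f (y2_of w2 f t1) t2) = triple_integral ?h"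
    by (intro triple_integral_translate_y2 meas3I) measurable
  also have "triple_integral ?h = (\<integral>\<^sup>+f. \<integral>\<^sup>+y. ennreal (?q y * caus' f (t1_from w2 f y)) \<partial>V \<partial>V)"
    unfolding dens2_def
    by (rule triple_integral_integrate_t2) (intro mult_nonneg_nonneg q0 less_imp_le caus'_pos | simp)+
  also have "\<dots> = (\<integral>\<^sup>+y. \<integral>\<^sup>+f. ennreal (?q y * caus' f (t1_from w2 f y)) \<partial>V \<partial>V)"
    by (rule vec_pair.Fubini') measurable
  also have "\<dots> = (\<integral>\<^sup>+y. ennreal (?q y) \<partial>V)"
  proof (rule nn_integral_cong)
    fix y assume [measurable]: "y \<in> space V"
    have "(\<integral>\<^sup>+f. ennreal (?q y * caus' f (t1_from w2 f y)) \<partial>V) = (\<integral>\<^sup>+f. ennreal (?q y) * ennreal (caus' f (t1_from w2 f y)) \<partial>V)"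
      by (intro nn_integral_cong ennreal_mult q0 less_imp_le caus'_pos)
    also have "\<dots> = ennreal (?q y)"
      by (subst nn_integral_cmult) (simp_all add: nn_integral_caus')
    finally show "(\<integral>\<^sup>+f. ennreal (?q y * caus' f (t1_from w2 f y)) \<partial>V) = ennreal (?q y)" .
  qed
  finally show "(\<Sum>w1\<in>{1..M1}. triple_integral (\<lambda>f t1 t2. gain2 w2 (y2_of w2 f t1) * vec_gauss N v (y2_of w2 f t1) / caus f t1 *
      dens1 w1 f t1 * dens2 w2 f t2)) = of_nat M1 * (\<integral>\<^sup>+y. ennreal (?q y) \<partial>V)" .
qed

text \<open>For fixed \<open>t\<close> the block \<open>f\<close> is traded for
  \<open>s = f - a * t\<close>, which decouples the Gaussian from \<open>t\<close>. Integrating over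
  \<open>t\<close> first then leaves the Gaussian in \<open>s\<close>.\<close>

lemma nn_integral_caus_gauss:
  assumes v: "v > 0"
  shows "(\<integral>\<^sup>+f. \<integral>\<^sup>+t. ennreal (caus f t * vec_gauss N v (\<lambda>i. f i - a * t i)) \<partial>V \<partial>V) = 1"
proof -
  have "(\<integral>\<^sup>+f. \<integral>\<^sup>+t. ennreal (caus f t * vec_gauss N v (\<lambda>i. f i - a * t i)) \<partial>V \<partial>V)
      = (\<integral>\<^sup>+t. \<integral>\<^sup>+f. ennreal (caus f t * vec_gauss N v (\<lambda>i. f i - a * t i)) \<partial>V \<partial>V)"
    by (rule vec_pair.Fubini') measurable
  also have "\<dots> = (\<integral>\<^sup>+t. \<integral>\<^sup>+s. ennreal (caus (\<lambda>i\<in>{1..N}. a * t i + s i) t * vec_gauss N v s) \<partial>V \<partial>V)"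
  proof (rule nn_integral_cong)
    fix t assume [measurable]: "t \<in> space V"
    let ?g = "\<lambda>f. ennreal (caus f t * vec_gauss N v (\<lambda>i. f i - a * t i))"
    have "(\<integral>\<^sup>+f. ?g f \<partial>V) = (\<integral>\<^sup>+s. ?g (\<lambda>i\<in>{1..N}. a * t i + s i) \<partial>V)"
      by (rule nn_integral_vec_translate[symmetric]) measurable
    also have "\<dots> = (\<integral>\<^sup>+s. ennreal (caus (\<lambda>i\<in>{1..N}. a * t i + s i) t * vec_gauss N v s) \<partial>V)"
    proof -
      have "vec_gauss N v (\<lambda>i. (\<lambda>i\<in>{1..N}. a * t i + s i) i - a * t i) = vec_gauss N v s" for s
        by (rule vec_gauss_cong) simp
      then show ?thesis by (simp only:)
    qed
    finally show "(\<integral>\<^sup>+f. ?g f \<partial>V) = (\<integral>\<^sup>+s. ennreal (caus (\<lambda>i\<in>{1..N}. a * t i + s i) t * vec_gauss N v s) \<partial>V)" .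
  qed
  also have "\<dots> = (\<integral>\<^sup>+s. \<integral>\<^sup>+t. ennreal (caus (\<lambda>i\<in>{1..N}. a * t i + s i) t * vec_gauss N v s) \<partial>V \<partial>V)"
    by (rule vec_pair.Fubini') measurable
  also have "\<dots> = (\<integral>\<^sup>+s. ennreal (vec_gauss N v s) \<partial>V)"
  proof (rule nn_integral_cong)
    fix s assume [measurable]: "s \<in> space V"
    have "(\<integral>\<^sup>+t. ennreal (caus (\<lambda>i\<in>{1..N}. a * t i + s i) t * vec_gauss N v s) \<partial>V)
        = (\<integral>\<^sup>+t. ennreal (caus (\<lambda>i\<in>{1..N}. a * t i + s i) t) * ennreal (vec_gauss N v s) \<partial>V)"
      by (intro nn_integral_cong ennreal_mult less_imp_le caus_pos vec_gauss_pos v)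
    also have "\<dots> = ennreal (vec_gauss N v s)"
      by (subst nn_integral_multc) (measurable, simp add: nn_integral_caus)
    finally show "(\<integral>\<^sup>+t. ennreal (caus (\<lambda>i\<in>{1..N}. a * t i + s i) t * vec_gauss N v s) \<partial>V) = ennreal (vec_gauss N v s)" .
  qed
  also have "\<dots> = 1"
    using nn_integral_vec_gauss_diff[OF v, of N "\<lambda>_. 0"] by simp
  finally show ?thesis .
qed

text \<open>The reference density of \<open>(Yf, T1, Y1)\<close> multiplies the causal density of
  \<open>t1\<close> by a Gaussian for \<open>f\<close> around \<open>l * t1\<close>. The factor
  \<open>caus\<close> cancels against the ratio for \<open>I(W2; Y2)\<close>, so that only the error
  of estimating \<open>Yf\<close> from \<open>T1\<close> is paid for.\<close>

lemma expect_ratio_C2: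
  assumes v: "v > 0" "v' > 0"
  shows "expect (\<lambda>w1 w2 f t1 t2. gain1 w1 (y1_of w1 t2) * caus f t1 * vec_gauss N v (\<lambda>i. f i - l * t1 i) *
      vec_gauss N v' (\<lambda>i. y1_of w1 t2 i - (\<alpha> * t1 i + \<beta> * f i)) / (dens1 w1 f t1 * mix2 f t2)) \<le> 1"
proof (rule expect_le_1_A)
  fix w1
  let ?h = "\<lambda>f t1 t2. gain1 w1 (y1_of w1 t2) * (caus f t1 * vec_gauss N v (\<lambda>i. f i - l * t1 i) *
      vec_gauss N v' (\<lambda>i. y1_of w1 t2 i - (\<alpha> * t1 i + \<beta> * f i)))"
  show "(\<Sum>w2\<in>{1..M2}. triple_integral (\<lambda>f t1 t2. gain1 w1 (y1_of w1 t2) * caus f t1 * vec_gauss N v (\<lambda>i. f i - l * t1 i) *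
      vec_gauss N v' (\<lambda>i. y1_of w1 t2 i - (\<alpha> * t1 i + \<beta> * f i)) / (dens1 w1 f t1 * mix2 f t2)
      * dens1 w1 f t1 * dens2 w2 f t2)) \<le> of_nat M2 * triple_integral ?h"
  proof (rule eq_refl, rule sum_triple_integral_dens2)
    show "meas3 ?h" by (intro meas3I) measurable
    show "?h f t1 t2 \<ge> 0" for f t1 t2
      by (intro mult_nonneg_nonneg less_imp_le gain_pos vec_gauss_pos v caus_pos)
    fix w2 f t1 t2
    show "gain1 w1 (y1_of w1 t2) * caus f t1 * vec_gauss N v (\<lambda>i. f i - l * t1 i) *
      vec_gauss N v' (\<lambda>i. y1_of w1 t2 i - (\<alpha> * t1 i + \<beta> * f i)) / (dens1 w1 f t1 * mix2 f t2)
      * dens1 w1 f t1 * dens2 w2 f t2 = ?h f t1 t2 / mix2 f t2 * dens2 w2 f t2"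
      using dens1_pos[of w1 f t1] mix2_pos[of f t2] by (simp add: field_simps)
  qed
next
  have "(\<Sum>w1\<in>{1..M1}. triple_integral (\<lambda>f t1 t2. gain1 w1 (y1_of w1 t2) * (caus f t1 * vec_gauss N v (\<lambda>i. f i - l * t1 i) *
      vec_gauss N v' (\<lambda>i. y1_of w1 t2 i - (\<alpha> * t1 i + \<beta> * f i)))))
    \<le> of_nat M1 * (\<integral>\<^sup>+f. \<integral>\<^sup>+t. ennreal (caus f t * vec_gauss N v (\<lambda>i. f i - l * t i)) \<partial>V \<partial>V)"
  proof (rule sum_gain1_triple_integral_le[OF v(2)])
    show "caus f t1 * vec_gauss N v (\<lambda>i. f i - l * t1 i) \<ge> 0" for f t1
      by (intro mult_nonneg_nonneg less_imp_le vec_gauss_pos v caus_pos)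
  qed (intro meas3I, measurable)
  then show "(\<Sum>w1\<in>{1..M1}. triple_integral (\<lambda>f t1 t2. gain1 w1 (y1_of w1 t2) * (caus f t1 * vec_gauss N v (\<lambda>i. f i - l * t1 i) *
      vec_gauss N v' (\<lambda>i. y1_of w1 t2 i - (\<alpha> * t1 i + \<beta> * f i))))) \<le> of_nat M1"
    by (simp add: nn_integral_caus_gauss[OF v(1)])
qed

end

section \<open>Second moments\<close>

text \<open>Cauchy-Schwarz with weights \<open>cmod u\<close> and \<open>cmod w\<close>. If both
  inputs have mean power at most 1, it yields the coherent power \<open>(cmod u + cmod w)^2\<close>,
  whatever correlation cooperation creates between \<open>X1\<close> and \<open>X2\<close>.\<close>

lemma cmod_add_mult_power2_le:
  "(cmod (u * x + w * y))\<^sup>2 \<le> (cmod u + cmod w) * (cmod u * (cmod x)\<^sup>2 + cmod w * (cmod y)\<^sup>2)"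
proof -
  have "(cmod (u * x + w * y))\<^sup>2 \<le> (cmod u * cmod x + cmod w * cmod y)\<^sup>2"
    by (intro power_mono order.trans[OF norm_triangle_ineq]) (simp_all add: norm_mult)
  also have "\<dots> = (cmod u + cmod w) * (cmod u * (cmod x)\<^sup>2 + cmod w * (cmod y)\<^sup>2)
      - cmod u * cmod w * (cmod x - cmod y)\<^sup>2"
    by (simp add: power2_eq_square algebra_simps)
  also have "\<dots> \<le> (cmod u + cmod w) * (cmod u * (cmod x)\<^sup>2 + cmod w * (cmod y)\<^sup>2)"
    by simp
  finally show ?thesis .
qed

context coded_channel
begin

abbreviation "\<Omega> \<equiv> outcome_space N M1 M2"

sublocale outcome: prob_space \<Omega>
  by (rule prob_space_outcome_space[OF M1 M2])

lemma outcome_measurable: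
  assumes i: "i \<in> {1..N}"
  shows X1_measurable: "X1 c i \<in> borel_measurable \<Omega>"
    and X2_measurable: "X2 ch c i \<in> borel_measurable \<Omega>"
    and Z1_measurable: "Z1 i \<in> borel_measurable \<Omega>"
    and Z2_measurable: "Z2 i \<in> borel_measurable \<Omega>"
    and Zf_measurable: "Zf i \<in> borel_measurable \<Omega>"
  by (rule outcome_space_measurableI, use i in \<open>simp add: X1_eq X2_eq split_beta'\<close>; measurable)+

text \<open>The common form of all estimation errors: linear in the two inputs and the three noises
  at the same time.\<close>

definition resid :: "complex \<Rightarrow> complex \<Rightarrow> complex \<Rightarrow> complex \<Rightarrow> complex \<Rightarrow> outcome \<Rightarrow> nat \<Rightarrow> complex" where
  "resid u w a1 a2 af \<omega> i = u * X1 c i \<omega> + w * X2 ch c i \<omega> + a1 * Z1 i \<omega> + a2 * Z2 i \<omega> + af * Zf i \<omega>"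

lemma resid_measurable [measurable]:
  "i \<in> {1..N} \<Longrightarrow> (\<lambda>\<omega>. resid u w a1 a2 af \<omega> i) \<in> borel_measurable \<Omega>"
  unfolding resid_def using outcome_measurable[of i] by measurable

text \<open>The noises at time \<open>i\<close> are independent of both inputs at time
  \<open>i\<close>, so their powers add without cross terms.\<close>

lemma nn_integral_resid:
  assumes i: "i \<in> {1..N}"
  shows "(\<integral>\<^sup>+\<omega>. ennreal ((cmod (resid u w a1 a2 af \<omega> i))\<^sup>2) \<partial>\<Omega>) =
    (\<integral>\<^sup>+\<omega>. ennreal ((cmod (u * X1 c i \<omega> + w * X2 ch c i \<omega>))\<^sup>2) \<partial>\<Omega>)
      + ennreal ((cmod a1)\<^sup>2) + ennreal ((cmod a2)\<^sup>2) + ennreal ((cmod af)\<^sup>2)"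
proof -
  let ?Z = "noise_space N"
  let ?K = "ennreal ((cmod a1)\<^sup>2) + ennreal ((cmod a2)\<^sup>2) + ennreal ((cmod af)\<^sup>2)"
  let ?A = "\<lambda>w1 w2 zf. u * xs1 w1 i + w * xs2 w2 (f_of w1 zf) i"
  note [measurable] = outcome_measurable[OF i]
  have A [measurable]: "?A w1 w2 \<in> borel_measurable V" for w1 w2
    using i by measurable
  \<comment> \<open>The feedback is strictly causal: the input at time \<open>i\<close> reads
    \<open>f\<close> before \<open>i\<close>, so changing the feedback noise at \<open>i\<close> has
    no effect.\<close>
  have A_indep: "?A w1 w2 (z(i := x)) = ?A w1 w2 z" for w1 w2 z x
    by (auto simp: f_of_def intro!: xs2_cong)
  have const: "(\<integral>\<^sup>+z. ennreal ((cmod (b + a * z i))\<^sup>2) \<partial>?Z) = ennreal ((cmod b)\<^sup>2) + ennreal ((cmod a)\<^sup>2)" for b a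
    using noise_cmod_affine[of "\<lambda>_. b" N i a] i noise_space.emeasure_space_1[of N] by simp
  have inner: "(\<integral>\<^sup>+zf. \<integral>\<^sup>+z2. \<integral>\<^sup>+z1. ennreal ((cmod (?A w1 w2 zf + a1 * z1 i + a2 * z2 i + af * zf i))\<^sup>2) \<partial>?Z \<partial>?Z \<partial>?Z)
     = (\<integral>\<^sup>+zf. \<integral>\<^sup>+z2. \<integral>\<^sup>+z1. ennreal ((cmod (?A w1 w2 zf))\<^sup>2) + ?K \<partial>?Z \<partial>?Z \<partial>?Z)" (is "?L = ?R") for w1 w2
  proof -
    have "?L = (\<integral>\<^sup>+zf. \<integral>\<^sup>+z2. \<integral>\<^sup>+z1. ennreal ((cmod ((?A w1 w2 zf + a2 * z2 i + af * zf i) + a1 * z1 i))\<^sup>2) \<partial>?Z \<partial>?Z \<partial>?Z)"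
      by (simp add: ac_simps)
    also have "\<dots> = (\<integral>\<^sup>+zf. \<integral>\<^sup>+z2. ennreal ((cmod ((?A w1 w2 zf + af * zf i) + a2 * z2 i))\<^sup>2) + ennreal ((cmod a1)\<^sup>2) \<partial>?Z \<partial>?Z)"
      unfolding const by (simp add: ac_simps)
    also have "\<dots> = (\<integral>\<^sup>+zf. ennreal ((cmod (?A w1 w2 zf + af * zf i))\<^sup>2) + ennreal ((cmod a2)\<^sup>2) + ennreal ((cmod a1)\<^sup>2) \<partial>?Z)"
      using i noise_space.emeasure_space_1[of N]
      by (intro nn_integral_cong) (subst nn_integral_add, auto simp: const)
    also have "\<dots> = (\<integral>\<^sup>+zf. ennreal ((cmod (?A w1 w2 zf + af * zf i))\<^sup>2) \<partial>?Z) + (ennreal ((cmod a2)\<^sup>2) + ennreal ((cmod a1)\<^sup>2))"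
      using i noise_space.emeasure_space_1[of N]
      unfolding add.assoc by (subst nn_integral_add) (auto simp: nn_integral_add)
    also have "(\<integral>\<^sup>+zf. ennreal ((cmod (?A w1 w2 zf + af * zf i))\<^sup>2) \<partial>?Z) = (\<integral>\<^sup>+zf. ennreal ((cmod (?A w1 w2 zf))\<^sup>2) \<partial>?Z) + ennreal ((cmod af)\<^sup>2)"
      by (rule noise_cmod_affine[OF A i A_indep])
    also have "\<dots> + (ennreal ((cmod a2)\<^sup>2) + ennreal ((cmod a1)\<^sup>2)) = (\<integral>\<^sup>+zf. ennreal ((cmod (?A w1 w2 zf))\<^sup>2) \<partial>?Z) + ?K"
      by (simp add: ac_simps)
    also have "\<dots> = (\<integral>\<^sup>+zf. ennreal ((cmod (?A w1 w2 zf))\<^sup>2) + ?K \<partial>?Z)"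
      using noise_space.emeasure_space_1[of N] by (subst nn_integral_add) auto
    also have "\<dots> = ?R"
      using noise_space.emeasure_space_1[of N] by (simp add: nn_integral_const)
    finally show ?thesis .
  qed
  have "(\<integral>\<^sup>+\<omega>. ennreal ((cmod (resid u w a1 a2 af \<omega> i))\<^sup>2) \<partial>\<Omega>)
     = (\<integral>\<^sup>+\<omega>. ennreal ((cmod (u * X1 c i \<omega> + w * X2 ch c i \<omega>))\<^sup>2) + ?K \<partial>\<Omega>)"
  proof (subst (1 2) nn_integral_outcome_space[OF _ M1 M2], goal_cases)
    case (1 w1 w2)
    show ?case using i by (simp add: X1_eq X2_eq split_beta' resid_def) measurable
  next
    case (2 w1 w2)
    show ?case using i by (simp add: X1_eq X2_eq split_beta' resid_def) measurable
  next
    case 3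
    show ?case
      using i inner by (simp add: X1_eq X2_eq resid_def)
  qed
  also have "\<dots> = (\<integral>\<^sup>+\<omega>. ennreal ((cmod (u * X1 c i \<omega> + w * X2 ch c i \<omega>))\<^sup>2) \<partial>\<Omega>) + ?K"
    using outcome.emeasure_space_1 by (subst nn_integral_add) auto
  finally show ?thesis by (simp add: ac_simps)
qed

lemma power_constraint_sum:
  assumes P: "power_constraint ch N M1 M2 c" and N: "1 \<le> N"
  shows "(\<Sum>i\<in>{1..N}. \<integral>\<^sup>+\<omega>. ennreal ((cmod (X1 c i \<omega>))\<^sup>2) \<partial>\<Omega>) \<le> of_nat N"
    and "(\<Sum>i\<in>{1..N}. \<integral>\<^sup>+\<omega>. ennreal ((cmod (X2 ch c i \<omega>))\<^sup>2) \<partial>\<Omega>) \<le> of_nat N"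
proof -
  have "x \<le> of_nat N" if "x / of_nat N \<le> (1 :: ennreal)" for x
  proof -
    have "x = x * of_nat N / of_nat N"
      using N by (intro mult_divide_eq_ennreal[symmetric]) (auto simp: ennreal_of_nat_eq_real_of_nat)
    also have "\<dots> = of_nat N * (x / of_nat N)"
      by (simp add: ennreal_times_divide mult.commute)
    also have "\<dots> \<le> of_nat N * 1"
      by (intro mult_left_mono that) auto
    finally show ?thesis by simp
  qed
  then show "(\<Sum>i\<in>{1..N}. \<integral>\<^sup>+\<omega>. ennreal ((cmod (X1 c i \<omega>))\<^sup>2) \<partial>\<Omega>) \<le> of_nat N"
    and "(\<Sum>i\<in>{1..N}. \<integral>\<^sup>+\<omega>. ennreal ((cmod (X2 ch c i \<omega>))\<^sup>2) \<partial>\<Omega>) \<le> of_nat N"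
    using P by (auto simp: power_constraint_def)
qed

lemma nn_integral_signal_le:
  assumes i: "i \<in> {1..N}"
  shows "(\<integral>\<^sup>+\<omega>. ennreal ((cmod (u * X1 c i \<omega> + w * X2 ch c i \<omega>))\<^sup>2) \<partial>\<Omega>) \<le>
    ennreal ((cmod u + cmod w) * cmod u) * (\<integral>\<^sup>+\<omega>. ennreal ((cmod (X1 c i \<omega>))\<^sup>2) \<partial>\<Omega>) +
    ennreal ((cmod u + cmod w) * cmod w) * (\<integral>\<^sup>+\<omega>. ennreal ((cmod (X2 ch c i \<omega>))\<^sup>2) \<partial>\<Omega>)"
proof -
  note [measurable] = outcome_measurable[OF i]
  have "(\<integral>\<^sup>+\<omega>. ennreal ((cmod (u * X1 c i \<omega> + w * X2 ch c i \<omega>))\<^sup>2) \<partial>\<Omega>) \<le>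
    (\<integral>\<^sup>+\<omega>. ennreal ((cmod u + cmod w) * cmod u) * ennreal ((cmod (X1 c i \<omega>))\<^sup>2) +
       ennreal ((cmod u + cmod w) * cmod w) * ennreal ((cmod (X2 ch c i \<omega>))\<^sup>2) \<partial>\<Omega>)"
    using cmod_add_mult_power2_le
    by (intro nn_integral_mono)
      (simp add: ennreal_mult[symmetric] ennreal_plus[symmetric] distrib_left mult.assoc ennreal_leI del: ennreal_plus)
  also have "\<dots> = ennreal ((cmod u + cmod w) * cmod u) * (\<integral>\<^sup>+\<omega>. ennreal ((cmod (X1 c i \<omega>))\<^sup>2) \<partial>\<Omega>) +
    ennreal ((cmod u + cmod w) * cmod w) * (\<integral>\<^sup>+\<omega>. ennreal ((cmod (X2 ch c i \<omega>))\<^sup>2) \<partial>\<Omega>)"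
    by (simp add: nn_integral_add nn_integral_cmult)
  finally show ?thesis .
qed

definition energy :: "complex \<Rightarrow> complex \<Rightarrow> complex \<Rightarrow> complex \<Rightarrow> complex \<Rightarrow> outcome \<Rightarrow> real" where
  "energy u w a1 a2 af \<omega> = (\<Sum>i\<in>{1..N}. (cmod (resid u w a1 a2 af \<omega> i))\<^sup>2)"

lemma energy_measurable [measurable]: "energy u w a1 a2 af \<in> borel_measurable \<Omega>"
  unfolding energy_def by measurable

lemma nn_integral_energy:
  "(\<integral>\<^sup>+\<omega>. ennreal (energy u w a1 a2 af \<omega>) \<partial>\<Omega>) =
    (\<Sum>i\<in>{1..N}. \<integral>\<^sup>+\<omega>. ennreal ((cmod (u * X1 c i \<omega> + w * X2 ch c i \<omega>))\<^sup>2) \<partial>\<Omega>)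
    + of_nat N * ennreal ((cmod a1)\<^sup>2 + (cmod a2)\<^sup>2 + (cmod af)\<^sup>2)"
proof -
  have "(\<integral>\<^sup>+\<omega>. ennreal (energy u w a1 a2 af \<omega>) \<partial>\<Omega>)
    = (\<Sum>i\<in>{1..N}. \<integral>\<^sup>+\<omega>. ennreal ((cmod (resid u w a1 a2 af \<omega> i))\<^sup>2) \<partial>\<Omega>)"
    unfolding energy_def
    by (subst nn_integral_sum[symmetric]) (auto intro!: nn_integral_cong simp: sum_ennreal)
  also have "\<dots> = (\<Sum>i\<in>{1..N}. (\<integral>\<^sup>+\<omega>. ennreal ((cmod (u * X1 c i \<omega> + w * X2 ch c i \<omega>))\<^sup>2) \<partial>\<Omega>)
      + ennreal ((cmod a1)\<^sup>2 + (cmod a2)\<^sup>2 + (cmod af)\<^sup>2))"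
    by (intro sum.cong refl) (simp add: nn_integral_resid add.assoc)
  also have "\<dots> = (\<Sum>i\<in>{1..N}. \<integral>\<^sup>+\<omega>. ennreal ((cmod (u * X1 c i \<omega> + w * X2 ch c i \<omega>))\<^sup>2) \<partial>\<Omega>)
    + of_nat N * ennreal ((cmod a1)\<^sup>2 + (cmod a2)\<^sup>2 + (cmod af)\<^sup>2)"
    unfolding sum.distrib by simp
  finally show ?thesis .
qed

text \<open>The bound at each time is linear in the two input powers, so summing over the block uses
  the block constraints only; no single time has to satisfy them.\<close>

lemma energy_bound:
  assumes P: "power_constraint ch N M1 M2 c" and N: "1 \<le> N"
    and v: "(cmod u + cmod w)\<^sup>2 + (cmod a1)\<^sup>2 + (cmod a2)\<^sup>2 + (cmod af)\<^sup>2 \<le> v"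
  shows "integrable \<Omega> (energy u w a1 a2 af)"
    and "(\<integral>\<omega>. energy u w a1 a2 af \<omega> \<partial>\<Omega>) \<le> real N * v"
proof -
  let ?k = "cmod u + cmod w"
  let ?S1 = "\<Sum>i\<in>{1..N}. \<integral>\<^sup>+\<omega>. ennreal ((cmod (X1 c i \<omega>))\<^sup>2) \<partial>\<Omega>"
  let ?S2 = "\<Sum>i\<in>{1..N}. \<integral>\<^sup>+\<omega>. ennreal ((cmod (X2 ch c i \<omega>))\<^sup>2) \<partial>\<Omega>"
  have "(\<Sum>i\<in>{1..N}. \<integral>\<^sup>+\<omega>. ennreal ((cmod (u * X1 c i \<omega> + w * X2 ch c i \<omega>))\<^sup>2) \<partial>\<Omega>)
      \<le> ennreal (?k * cmod u) * ?S1 + ennreal (?k * cmod w) * ?S2"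
    unfolding sum_distrib_left sum.distrib[symmetric]
    by (rule sum_mono[OF nn_integral_signal_le])
  also have "\<dots> \<le> ennreal (?k * cmod u) * of_nat N + ennreal (?k * cmod w) * of_nat N"
    by (intro add_mono mult_left_mono power_constraint_sum[OF P N]) auto
  also have "\<dots> = ennreal (real N * ?k\<^sup>2)"
    by (simp add: ennreal_of_nat_eq_real_of_nat ennreal_mult[symmetric] ennreal_plus[symmetric]
        power2_eq_square algebra_simps del: ennreal_plus)
  finally have sig: "(\<Sum>i\<in>{1..N}. \<integral>\<^sup>+\<omega>. ennreal ((cmod (u * X1 c i \<omega> + w * X2 ch c i \<omega>))\<^sup>2) \<partial>\<Omega>)
      \<le> ennreal (real N * ?k\<^sup>2)" .
  have "(\<integral>\<^sup>+\<omega>. ennreal (energy u w a1 a2 af \<omega>) \<partial>\<Omega>)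
      \<le> ennreal (real N * ?k\<^sup>2) + of_nat N * ennreal ((cmod a1)\<^sup>2 + (cmod a2)\<^sup>2 + (cmod af)\<^sup>2)"
    unfolding nn_integral_energy by (rule add_right_mono[OF sig])
  also have "\<dots> = ennreal (real N * (?k\<^sup>2 + (cmod a1)\<^sup>2 + (cmod a2)\<^sup>2 + (cmod af)\<^sup>2))"
    by (simp add: ennreal_of_nat_eq_real_of_nat ennreal_mult[symmetric] ennreal_plus[symmetric]
        algebra_simps del: ennreal_plus)
  also have "\<dots> \<le> ennreal (real N * v)"
    using v by (intro ennreal_leI mult_left_mono) auto
  finally have le: "(\<integral>\<^sup>+\<omega>. ennreal (energy u w a1 a2 af \<omega>) \<partial>\<Omega>) \<le> ennreal (real N * v)" .
  have e0: "energy u w a1 a2 af \<omega> \<ge> 0" for \<omega> by (simp add: energy_def sum_nonneg)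
  show int: "integrable \<Omega> (energy u w a1 a2 af)"
    by (rule integrableI_nonneg) (use e0 le in \<open>auto intro: le_less_trans\<close>)
  have "v \<ge> 0"
    using v by (meson add_nonneg_nonneg order_trans zero_le_power2)
  then show "(\<integral>\<omega>. energy u w a1 a2 af \<omega> \<partial>\<Omega>) \<le> real N * v"
    using le nn_integral_eq_integral[OF int] e0 by (simp add: ennreal_le_iff)
qed

text \<open>An upper bound would not do: the noise energy enters \<open>gap\<close> with a negative
  sign.\<close>

lemma noise_energy:
  assumes "(cmod a1)\<^sup>2 + (cmod a2)\<^sup>2 + (cmod af)\<^sup>2 = 1"
  shows "integrable \<Omega> (energy 0 0 a1 a2 af)"
    and "(\<integral>\<omega>. energy 0 0 a1 a2 af \<omega> \<partial>\<Omega>) = real N"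
proof -
  have e0: "energy 0 0 a1 a2 af \<omega> \<ge> 0" for \<omega> by (simp add: energy_def sum_nonneg)
  have eq: "(\<integral>\<^sup>+\<omega>. ennreal (energy 0 0 a1 a2 af \<omega>) \<partial>\<Omega>) = ennreal (real N)"
    using assms by (simp add: nn_integral_energy ennreal_of_nat_eq_real_of_nat)
  show int: "integrable \<Omega> (energy 0 0 a1 a2 af)"
    by (rule integrableI_nonneg) (use e0 eq in auto)
  show "(\<integral>\<omega>. energy 0 0 a1 a2 af \<omega> \<partial>\<Omega>) = real N"
    using eq nn_integral_eq_integral[OF int] e0 by (simp add: integral_nonneg)
qed

lemma ln_vec_gauss_resid:
  "v > 0 \<Longrightarrow> ln (vec_gauss N v (resid u w a1 a2 af \<omega>)) = - energy u w a1 a2 af \<omega> / v - real N * (ln pi + ln v)"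
  by (simp add: ln_vec_gauss energy_def sum_subtractf sum_negf sum_divide_distrib algebra_simps)

definition gap :: "real \<Rightarrow> (outcome \<Rightarrow> nat \<Rightarrow> complex) \<Rightarrow> (nat \<Rightarrow> outcome \<Rightarrow> complex) \<Rightarrow> outcome \<Rightarrow> real" where
  "gap v r z \<omega> = ln (vec_gauss N 1 (\<lambda>i. z i \<omega>)) - ln (vec_gauss N v (r \<omega>))"

text \<open>As \<open>v\<close> dominates the mean error power, \<open>energy / v\<close> has mean
  at most \<open>N\<close>, which is compensated by the noise energy, of mean exactly
  \<open>N\<close>; the terms \<open>ln pi\<close> cancel. What remains is the logarithm of a ratio
  of variances, as for a difference of Gaussian entropies.\<close>

lemma gap_bound:
  assumes P: "power_constraint ch N M1 M2 c" and N: "1 \<le> N"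
    and v: "(cmod u + cmod w)\<^sup>2 + (cmod a1)\<^sup>2 + (cmod a2)\<^sup>2 + (cmod af)\<^sup>2 \<le> v" and v0: "v > 0"
    and z: "z \<in> {Z1, Z2, Zf}"
  shows "integrable \<Omega> (gap v (resid u w a1 a2 af) z)"
    and "(\<integral>\<omega>. gap v (resid u w a1 a2 af) z \<omega> \<partial>\<Omega>) \<le> real N * ln v"
proof -
  \<comment> \<open>Each noise is itself a residual with zero signal, so both logarithms are
    expressed by energies.\<close>
  obtain b1 b2 bf where b: "(cmod b1)\<^sup>2 + (cmod b2)\<^sup>2 + (cmod bf)\<^sup>2 = 1"
    and zb: "\<And>i \<omega>. z i \<omega> = resid 0 0 b1 b2 bf \<omega> i"
  proof -
    consider "z = Z1" | "z = Z2" | "z = Zf" using z by auto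
    then show ?thesis
    proof cases
      case 1 then show ?thesis by (intro that[of 1 0 0]) (auto simp: resid_def)
    next
      case 2 then show ?thesis by (intro that[of 0 1 0]) (auto simp: resid_def)
    next
      case 3 then show ?thesis by (intro that[of 0 0 1]) (auto simp: resid_def)
    qed
  qed
  have eq: "gap v (resid u w a1 a2 af) z = (\<lambda>\<omega>. energy u w a1 a2 af \<omega> / v - energy 0 0 b1 b2 bf \<omega> + real N * ln v)"
    using v0 by (simp add: gap_def zb ln_vec_gauss_resid fun_eq_iff algebra_simps)
  note e = energy_bound[OF P N v] and n = noise_energy[OF b]
  show "integrable \<Omega> (gap v (resid u w a1 a2 af) z)"
    unfolding eq using e(1) n(1) by simp
  have "(\<integral>\<omega>. gap v (resid u w a1 a2 af) z \<omega> \<partial>\<Omega>) = (\<integral>\<omega>. energy u w a1 a2 af \<omega> \<partial>\<Omega>) / v - real N + real N * ln v"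
    unfolding eq using e(1) n by (simp add: outcome.prob_space)
  also have "\<dots> \<le> real N * ln v"
    using e(2) v0 by (simp add: divide_le_eq)
  finally show "(\<integral>\<omega>. gap v (resid u w a1 a2 af) z \<omega> \<partial>\<Omega>) \<le> real N * ln v" .
qed

section \<open>Bounds for a single block\<close>

definition at_outcome :: "(nat \<Rightarrow> nat \<Rightarrow> (nat \<Rightarrow> complex) \<Rightarrow> (nat \<Rightarrow> complex) \<Rightarrow> (nat \<Rightarrow> complex) \<Rightarrow> real) \<Rightarrow> outcome \<Rightarrow> real" where
  "at_outcome \<phi> \<omega> = \<phi> (W1 \<omega>) (W2 \<omega>) (Fv \<omega>) (T1v \<omega>) (T2v \<omega>)"

lemma at_outcome_integral:
  assumes meas: "\<And>w1 w2. meas3 (\<phi> w1 w2)" and nonneg: "\<And>w1 w2 f t1 t2. \<phi> w1 w2 f t1 t2 \<ge> 0"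
    and le: "expect \<phi> \<le> 1"
  shows "integrable \<Omega> (at_outcome \<phi>)" and "(\<integral>\<omega>. at_outcome \<phi> \<omega> \<partial>\<Omega>) \<le> 1"
proof -
  have nn: "(\<integral>\<^sup>+\<omega>. ennreal (at_outcome \<phi> \<omega>) \<partial>\<Omega>) \<le> 1"
    using le nn_integral_outcome_triple_integral[of \<phi>, OF meas nonneg] by (simp add: at_outcome_def expect_def)
  have [measurable]: "at_outcome \<phi> \<in> borel_measurable \<Omega>"
  proof (rule outcome_space_measurableI)
    fix w1 w2
    have "(\<lambda>(z1, z2, zf). (f_of w1 zf, t1_of w1 z2, t2_of w2 (f_of w1 zf) z1)) \<in> V \<Otimes>\<^sub>M V \<Otimes>\<^sub>M V \<rightarrow>\<^sub>M V \<Otimes>\<^sub>M V \<Otimes>\<^sub>M V"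
      by measurable
    from measurable_compose[OF this meas[of w1 w2]]
    show "(\<lambda>(z1, z2, zf). at_outcome \<phi> (w1, w2, z1, z2, zf)) \<in> borel_measurable (V \<Otimes>\<^sub>M V \<Otimes>\<^sub>M V)"
      by (simp add: at_outcome_def Fv_eq T1v_eq T2v_eq split_beta')
  qed
  show int: "integrable \<Omega> (at_outcome \<phi>)"
    by (rule integrableI_nonneg) (use nn nonneg in \<open>auto simp: at_outcome_def intro: le_less_trans\<close>)
  show "(\<integral>\<omega>. at_outcome \<phi> \<omega> \<partial>\<Omega>) \<le> 1"
  proof -
    have "AE \<omega> in \<Omega>. at_outcome \<phi> \<omega> \<ge> 0" by (simp add: at_outcome_def nonneg)
    then show ?thesis
      using nn nn_integral_eq_integral[OF int] by (simp only: ennreal_le_1)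
  qed
qed

lemma at_outcome_components:
  assumes "i \<in> {1..N}"
  shows "xs1 (W1 \<omega>) i = X1 c i \<omega>" "xs2 (W2 \<omega>) (Fv \<omega>) i = X2 ch c i \<omega>"
    "Fv \<omega> i = gf * X1 c i \<omega> + Zf i \<omega>" "T1v \<omega> i = g21 * X1 c i \<omega> + Z2 i \<omega>"
    "T2v \<omega> i = g12 * X2 ch c i \<omega> + Z1 i \<omega>"
    "y1_of (W1 \<omega>) (T2v \<omega>) i = g11 * X1 c i \<omega> + (g12 * X2 ch c i \<omega> + Z1 i \<omega>)"
    "y2_of (W2 \<omega>) (Fv \<omega>) (T1v \<omega>) i = g22 * X2 ch c i \<omega> + (g21 * X1 c i \<omega> + Z2 i \<omega>)"
  using assms
  by (simp_all add: xs1_def X1_def X2_eq_Fv Fv_def T1v_def T2v_def y1_of_def y2_of_def Yf_def gf_def)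

lemma y_of_outcome:
  "y1_of (W1 \<omega>) (T2v \<omega>) = (\<lambda>i\<in>{1..N}. Y1 ch c i \<omega>)"
  "y2_of (W2 \<omega>) (Fv \<omega>) (T1v \<omega>) = (\<lambda>i\<in>{1..N}. Y2 ch c i \<omega>)"
proof -
  show "y1_of (W1 \<omega>) (T2v \<omega>) = (\<lambda>i\<in>{1..N}. Y1 ch c i \<omega>)"
  proof
    fix i show "y1_of (W1 \<omega>) (T2v \<omega>) i = (\<lambda>i\<in>{1..N}. Y1 ch c i \<omega>) i"
      by (cases "i \<in> {1..N}") (auto simp: at_outcome_components Y1_def g11_def g12_def y1_of_def[of _ "T2v \<omega>"] simp del: atLeastAtMost_iff)
  qed
  show "y2_of (W2 \<omega>) (Fv \<omega>) (T1v \<omega>) = (\<lambda>i\<in>{1..N}. Y2 ch c i \<omega>)"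
  proof
    fix i show "y2_of (W2 \<omega>) (Fv \<omega>) (T1v \<omega>) i = (\<lambda>i\<in>{1..N}. Y2 ch c i \<omega>) i"
      by (cases "i \<in> {1..N}") (auto simp: at_outcome_components Y2_def g21_def g22_def y2_of_def[of _ "Fv \<omega>" "T1v \<omega>"] simp del: atLeastAtMost_iff)
  qed
qed

lemma dens_outcome:
  "dens1 (W1 \<omega>) (Fv \<omega>) (T1v \<omega>) = vec_gauss N 1 (\<lambda>i. Z2 i \<omega>) * vec_gauss N 1 (\<lambda>i. Zf i \<omega>)"
  "dens2 (W2 \<omega>) (Fv \<omega>) (T2v \<omega>) = vec_gauss N 1 (\<lambda>i. Z1 i \<omega>)"
  "vec_gauss N 1 (\<lambda>i. T1v \<omega> i - g21 * xs1 (W1 \<omega>) i) = vec_gauss N 1 (\<lambda>i. Z2 i \<omega>)"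
  unfolding dens1_def dens2_def
  by (intro arg_cong2[where f = "(*)"] vec_gauss_cong; simp add: at_outcome_components)+

definition log_gain1 :: "outcome \<Rightarrow> real" where
  "log_gain1 \<omega> = ln (gain1 (W1 \<omega>) (y1_of (W1 \<omega>) (T2v \<omega>)))"
definition log_gain2 :: "outcome \<Rightarrow> real" where
  "log_gain2 \<omega> = ln (gain2 (W2 \<omega>) (y2_of (W2 \<omega>) (Fv \<omega>) (T1v \<omega>)))"

lemma log_gain1:
  shows "integrable \<Omega> log_gain1"
    and "(\<integral>\<omega>. log_gain1 \<omega> \<partial>\<Omega>) = (1 - error1 ch N M1 M2 c) * ln (real M1) - ln 2"
proof -
  let ?E = "{\<omega> \<in> space \<Omega>. dec1 c (\<lambda>i\<in>{1..N}. Y1 ch c i \<omega>) \<noteq> W1 \<omega>}"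
  have "(\<lambda>\<omega>. dec1 c (\<lambda>i\<in>{1..N}. Y1 ch c i \<omega>) \<noteq> W1 \<omega>) \<in> \<Omega> \<rightarrow>\<^sub>M count_space UNIV"
    unfolding y_of_outcome(1)[symmetric]
    by (rule outcome_space_measurableI) (simp add: T2v_eq split_beta')
  then have [measurable]: "?E \<in> sets \<Omega>" by (simp add: pred_def)
  \<comment> \<open>The reward has logarithm \<open>ln M1 - ln 2\<close> on success and
    \<open>- ln 2\<close> on error.\<close>
  have eq: "log_gain1 \<omega> = ln (real M1) - ln (real M1) * indicator ?E \<omega> - ln 2" if "\<omega> \<in> space \<Omega>" for \<omega>
    using M1 that by (auto simp: log_gain1_def gain1_def y_of_outcome ln_div)
  have int: "integrable \<Omega> (\<lambda>\<omega>. ln (real M1) - ln (real M1) * indicator ?E \<omega> - ln 2)"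
    by (auto intro!: Bochner_Integration.integrable_diff integrable_real_mult_indicator simp: outcome.emeasure_eq_measure)
  then show "integrable \<Omega> log_gain1"
    by (rule Bochner_Integration.integrable_cong[THEN iffD2, rotated -1]) (auto simp: eq)
  have "(\<integral>\<omega>. log_gain1 \<omega> \<partial>\<Omega>) = (\<integral>\<omega>. ln (real M1) - ln (real M1) * indicator ?E \<omega> - ln 2 \<partial>\<Omega>)"
    by (rule Bochner_Integration.integral_cong) (auto simp: eq)
  also have "\<dots> = (1 - error1 ch N M1 M2 c) * ln (real M1) - ln 2"
    by (simp add: outcome.prob_space error1_def algebra_simps outcome.emeasure_eq_measure)
  finally show "(\<integral>\<omega>. log_gain1 \<omega> \<partial>\<Omega>) = (1 - error1 ch N M1 M2 c) * ln (real M1) - ln 2" .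
qed

lemma log_gain2:
  shows "integrable \<Omega> log_gain2"
    and "(\<integral>\<omega>. log_gain2 \<omega> \<partial>\<Omega>) = (1 - error2 ch N M1 M2 c) * ln (real M2) - ln 2"
proof -
  let ?E = "{\<omega> \<in> space \<Omega>. dec2 c (\<lambda>i\<in>{1..N}. Y2 ch c i \<omega>) \<noteq> W2 \<omega>}"
  have "(\<lambda>\<omega>. dec2 c (\<lambda>i\<in>{1..N}. Y2 ch c i \<omega>) \<noteq> W2 \<omega>) \<in> \<Omega> \<rightarrow>\<^sub>M count_space UNIV"
    unfolding y_of_outcome(2)[symmetric]
    by (rule outcome_space_measurableI) (simp add: Fv_eq T1v_eq split_beta')
  then have [measurable]: "?E \<in> sets \<Omega>" by (simp add: pred_def)
  have eq: "log_gain2 \<omega> = ln (real M2) - ln (real M2) * indicator ?E \<omega> - ln 2" if "\<omega> \<in> space \<Omega>" for \<omega>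
    using M2 that by (auto simp: log_gain2_def gain2_def y_of_outcome ln_div)
  have int: "integrable \<Omega> (\<lambda>\<omega>. ln (real M2) - ln (real M2) * indicator ?E \<omega> - ln 2)"
    by (auto intro!: Bochner_Integration.integrable_diff integrable_real_mult_indicator simp: outcome.emeasure_eq_measure)
  then show "integrable \<Omega> log_gain2"
    by (rule Bochner_Integration.integrable_cong[THEN iffD2, rotated -1]) (auto simp: eq)
  have "(\<integral>\<omega>. log_gain2 \<omega> \<partial>\<Omega>) = (\<integral>\<omega>. ln (real M2) - ln (real M2) * indicator ?E \<omega> - ln 2 \<partial>\<Omega>)"
    by (rule Bochner_Integration.integral_cong) (auto simp: eq)
  also have "\<dots> = (1 - error2 ch N M1 M2 c) * ln (real M2) - ln 2"
    by (simp add: outcome.prob_space error2_def algebra_simps outcome.emeasure_eq_measure)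
  finally show "(\<integral>\<omega>. log_gain2 \<omega> \<partial>\<Omega>) = (1 - error2 ch N M1 M2 c) * ln (real M2) - ln 2" .
qed

text \<open>Each logarithm is at most its ratio minus 1, whose mean is at most 0. The comparison is
  pointwise: only the sum of the three logarithms has to be integrable, and it is, being
  \<open>g\<close> minus the four gaps.\<close>

lemma gains_le_gaps:
  fixes g g1 g2 g3 g4 :: "outcome \<Rightarrow> real"
  assumes meas: "\<And>w1 w2. meas3 (\<phi> w1 w2)" "\<And>w1 w2. meas3 (\<psi> w1 w2)" "\<And>w1 w2. meas3 (\<eta> w1 w2)"
    and pos: "\<And>w1 w2 f t1 t2. \<phi> w1 w2 f t1 t2 > 0" "\<And>w1 w2 f t1 t2. \<psi> w1 w2 f t1 t2 > 0" "\<And>w1 w2 f t1 t2. \<eta> w1 w2 f t1 t2 > 0"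
    and le: "expect \<phi> \<le> 1" "expect \<psi> \<le> 1" "expect \<eta> \<le> 1"
    and g: "integrable \<Omega> g"
    and gaps: "integrable \<Omega> g1" "integrable \<Omega> g2" "integrable \<Omega> g3" "integrable \<Omega> g4"
    and eq: "\<And>\<omega>. ln (at_outcome \<phi> \<omega>) + ln (at_outcome \<psi> \<omega>) + ln (at_outcome \<eta> \<omega>) =
      g \<omega> - (g1 \<omega> + g2 \<omega> + g3 \<omega> + g4 \<omega>)"
  shows "(\<integral>\<omega>. g \<omega> \<partial>\<Omega>) \<le> (\<integral>\<omega>. g1 \<omega> \<partial>\<Omega>) + (\<integral>\<omega>. g2 \<omega> \<partial>\<Omega>) + (\<integral>\<omega>. g3 \<omega> \<partial>\<Omega>) + (\<integral>\<omega>. g4 \<omega> \<partial>\<Omega>)"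
proof -
  note a = at_outcome_integral[OF meas(1) less_imp_le[OF pos(1)] le(1)]
  note b = at_outcome_integral[OF meas(2) less_imp_le[OF pos(2)] le(2)]
  note d = at_outcome_integral[OF meas(3) less_imp_le[OF pos(3)] le(3)]
  let ?r = "\<lambda>\<omega>. at_outcome \<phi> \<omega> + at_outcome \<psi> \<omega> + at_outcome \<eta> \<omega> - 3"
  let ?g = "\<lambda>\<omega>. g1 \<omega> + g2 \<omega> + g3 \<omega> + g4 \<omega>"
  have pt: "g \<omega> \<le> ?r \<omega> + ?g \<omega>" for \<omega>
  proof -
    have "at_outcome \<phi> \<omega> > 0" "at_outcome \<psi> \<omega> > 0" "at_outcome \<eta> \<omega> > 0"
      by (simp_all add: at_outcome_def pos)
    then have "ln (at_outcome \<phi> \<omega>) + ln (at_outcome \<psi> \<omega>) + ln (at_outcome \<eta> \<omega>) \<le> ?r \<omega>"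
      using ln_le_minus_one[of "at_outcome \<phi> \<omega>"] ln_le_minus_one[of "at_outcome \<psi> \<omega>"]
        ln_le_minus_one[of "at_outcome \<eta> \<omega>"] by linarith
    then show ?thesis using eq[of \<omega>] by linarith
  qed
  have "(\<integral>\<omega>. g \<omega> \<partial>\<Omega>) \<le> (\<integral>\<omega>. ?r \<omega> + ?g \<omega> \<partial>\<Omega>)"
    using a(1) b(1) d(1) gaps by (intro integral_mono g pt) auto
  also have "\<dots> = ((\<integral>\<omega>. at_outcome \<phi> \<omega> \<partial>\<Omega>) + (\<integral>\<omega>. at_outcome \<psi> \<omega> \<partial>\<Omega>) + (\<integral>\<omega>. at_outcome \<eta> \<omega> \<partial>\<Omega>) - 3)
     + ((\<integral>\<omega>. g1 \<omega> \<partial>\<Omega>) + (\<integral>\<omega>. g2 \<omega> \<partial>\<Omega>) + (\<integral>\<omega>. g3 \<omega> \<partial>\<Omega>) + (\<integral>\<omega>. g4 \<omega> \<partial>\<Omega>))"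
    using a(1) b(1) d(1) gaps by (simp add: outcome.prob_space)
  finally show ?thesis using a(2) b(2) d(2) by linarith
qed

text \<open>In the sum of the logarithms \<open>mix1\<close> and \<open>mix2\<close> cancel, and the
  remaining denominators are the densities of \<open>Z1\<close> (twice), \<open>Z2\<close> and
  \<open>Zf\<close>. Each is paired with a Gaussian reference: \<open>v1\<close> for
  \<open>Y1\<close>, \<open>v2\<close> for \<open>Yf\<close>, \<open>v3\<close> for
  \<open>Y1\<close> given \<open>X2\<close>, \<open>T1\<close>, \<open>Yf\<close>, and
  \<open>v4\<close> for \<open>Y2\<close> given \<open>T2\<close>, \<open>Yf\<close>. Hypothesis
  \<open>zf\<close> is zero forcing: both inputs drop out of the last residual.\<close>

lemma two_R1_plus_R2_bound:
  assumes P: "power_constraint ch N M1 M2 c" and N: "1 \<le> N"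
    and v1: "(cmod g11 + cmod g12)\<^sup>2 + 1 \<le> v1"
    and v2: "(cmod gf)\<^sup>2 + 1 \<le> v2"
    and v3: "(cmod (g11 - \<alpha> * g21 - \<beta> * gf))\<^sup>2 + 1 + (cmod \<alpha>)\<^sup>2 + (cmod \<beta>)\<^sup>2 \<le> v3"
    and v4: "(cmod \<gamma>)\<^sup>2 + 1 + (cmod \<mu>)\<^sup>2 \<le> v4" and zf: "\<mu> * gf = g21" "\<gamma> * g12 = g22"
  shows "2 * ((1 - error1 ch N M1 M2 c) * ln (real M1)) + (1 - error2 ch N M1 M2 c) * ln (real M2) - 3 * ln 2
    \<le> real N * (ln v1 + ln v2 + ln v3 + ln v4)"
proof -
  have v0: "v1 > 0" "v2 > 0" "v3 > 0" "v4 > 0"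
    using v1 v2 v3 v4 by (smt (verit) zero_le_power2)+
  let ?\<phi> = "\<lambda>w1 w2 f t1 t2. gain1 w1 (y1_of w1 t2) * vec_gauss N v1 (y1_of w1 t2) / mix2 f t2"
  let ?\<psi> = "\<lambda>w1 w2 f t1 t2. gain1 w1 (y1_of w1 t2) * mix1 N N f t1 *
      vec_gauss N v3 (\<lambda>i. y1_of w1 t2 i - (g12 * xs2 w2 f i + \<alpha> * t1 i + \<beta> * f i)) / (dens1 w1 f t1 * dens2 w2 f t2)"
  let ?\<eta> = "\<lambda>w1 w2 f t1 t2. gain2 w2 (y2_of w2 f t1) * vec_gauss N v2 f * mix2 f t2 *
      vec_gauss N v4 (\<lambda>i. y2_of w2 f t1 i - (\<gamma> * t2 i + \<mu> * f i)) / (mix1 N N f t1 * dens2 w2 f t2)"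
  let ?r1 = "resid g11 g12 1 0 0" and ?r2 = "resid gf 0 0 0 1"
  let ?r3 = "resid (g11 - \<alpha> * g21 - \<beta> * gf) 0 1 (- \<alpha>) (- \<beta>)" and ?r4 = "resid 0 0 (- \<gamma>) 1 (- \<mu>)"
  note gap1 = gap_bound[OF P N _ v0(1), of g11 g12 1 0 0 Z1, simplified, OF v1]
  note gap2 = gap_bound[OF P N _ v0(2), of gf 0 0 0 1 Zf, simplified, OF v2]
  note gap3 = gap_bound[OF P N _ v0(3), of "g11 - \<alpha> * g21 - \<beta> * gf" 0 1 "- \<alpha>" "- \<beta>" Z1, simplified, OF v3]
  note gap4 = gap_bound[OF P N _ v0(4), of 0 0 "- \<gamma>" 1 "- \<mu>" Z2, simplified, OF v4]
  have r1: "vec_gauss N v1 (y1_of (W1 \<omega>) (T2v \<omega>)) = vec_gauss N v1 (?r1 \<omega>)" for \<omega>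
    by (rule vec_gauss_cong) (simp add: at_outcome_components resid_def)
  have r2: "vec_gauss N v2 (Fv \<omega>) = vec_gauss N v2 (?r2 \<omega>)" for \<omega>
    by (rule vec_gauss_cong) (simp add: at_outcome_components resid_def)
  have r3: "vec_gauss N v3 (\<lambda>i. y1_of (W1 \<omega>) (T2v \<omega>) i - (g12 * xs2 (W2 \<omega>) (Fv \<omega>) i + \<alpha> * T1v \<omega> i + \<beta> * Fv \<omega> i))
      = vec_gauss N v3 (?r3 \<omega>)" for \<omega>
    by (rule vec_gauss_cong) (simp add: at_outcome_components resid_def algebra_simps)
  have r4: "vec_gauss N v4 (\<lambda>i. y2_of (W2 \<omega>) (Fv \<omega>) (T1v \<omega>) i - (\<gamma> * T2v \<omega> i + \<mu> * Fv \<omega> i))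
      = vec_gauss N v4 (?r4 \<omega>)" for \<omega>
    by (rule vec_gauss_cong) (simp add: at_outcome_components resid_def zf[symmetric] algebra_simps)
  have "(\<integral>\<omega>. 2 * log_gain1 \<omega> + log_gain2 \<omega> \<partial>\<Omega>) \<le> (\<integral>\<omega>. gap v1 ?r1 Z1 \<omega> \<partial>\<Omega>)
     + (\<integral>\<omega>. gap v2 ?r2 Zf \<omega> \<partial>\<Omega>) + (\<integral>\<omega>. gap v3 ?r3 Z1 \<omega> \<partial>\<Omega>) + (\<integral>\<omega>. gap v4 ?r4 Z2 \<omega> \<partial>\<Omega>)"
  proof (rule gains_le_gaps[where \<phi> = ?\<phi> and \<psi> = ?\<psi> and \<eta> = ?\<eta>])
    show "meas3 (?\<phi> w1 w2)" "meas3 (?\<psi> w1 w2)" "meas3 (?\<eta> w1 w2)" for w1 w2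
      by (intro meas3I; measurable)+
    show "?\<phi> w1 w2 f t1 t2 > 0" "?\<psi> w1 w2 f t1 t2 > 0" "?\<eta> w1 w2 f t1 t2 > 0" for w1 w2 f t1 t2
      by (intro mult_pos_pos divide_pos_pos gain_pos vec_gauss_pos v0 mix1_pos mix2_pos dens1_pos dens2_pos)+
    show "expect ?\<phi> \<le> 1" by (rule expect_ratio_A1[OF v0(1)])
    show "expect ?\<psi> \<le> 1" by (rule expect_ratio_B1[OF v0(3)])
    show "expect ?\<eta> \<le> 1" by (rule expect_ratio_C1[OF v0(2,4)])
    show "integrable \<Omega> (\<lambda>\<omega>. 2 * log_gain1 \<omega> + log_gain2 \<omega>)"
      using log_gain1 log_gain2 by simp
    fix \<omega>
    have pos: "vec_gauss N 1 (\<lambda>i. Z1 i \<omega>) > 0" "vec_gauss N 1 (\<lambda>i. Z2 i \<omega>) > 0" "vec_gauss N 1 (\<lambda>i. Zf i \<omega>) > 0"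
      by (simp_all add: vec_gauss_pos)
    show "ln (at_outcome ?\<phi> \<omega>) + ln (at_outcome ?\<psi> \<omega>) + ln (at_outcome ?\<eta> \<omega>) =
        2 * log_gain1 \<omega> + log_gain2 \<omega> - (gap v1 ?r1 Z1 \<omega> + gap v2 ?r2 Zf \<omega> + gap v3 ?r3 Z1 \<omega> + gap v4 ?r4 Z2 \<omega>)"
      unfolding at_outcome_def dens_outcome r1 r2 r3 r4 gap_def log_gain1_def log_gain2_def
      using pos v0 by (simp add: ln_mult_pos ln_divide_pos gain_pos vec_gauss_pos mix1_pos mix2_pos)
  qed (fact gap1(1) gap2(1) gap3(1) gap4(1))+
  then show ?thesis
    using gap1(2) gap2(2) gap3(2) gap4(2) log_gain1 log_gain2 by (simp add: distrib_left)
qed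

text \<open>Here \<open>caus\<close> and \<open>mix2\<close> cancel, and the remaining denominators
  are the densities of \<open>Z2\<close> (twice), \<open>Z1\<close> and \<open>Zf\<close>.
  \<open>v1\<close> belongs to \<open>Y2\<close>, \<open>v2\<close> to \<open>Y2\<close> given
  \<open>X1\<close> and \<open>T2\<close>, \<open>v3\<close> to \<open>Yf\<close> given
  \<open>T1\<close>, and \<open>v4\<close> to \<open>Y1\<close> given \<open>T1\<close> and
  \<open>Yf\<close>, where \<open>X2\<close> stays in the residual and may add coherently to what is
  left of \<open>X1\<close>.\<close>

lemma R1_plus_two_R2_bound:
  assumes P: "power_constraint ch N M1 M2 c" and N: "1 \<le> N"
    and v1: "(cmod g21 + cmod g22)\<^sup>2 + 1 \<le> v1"
    and v2: "(cmod (g22 - \<gamma> * g12))\<^sup>2 + (cmod \<gamma>)\<^sup>2 + 1 \<le> v2"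
    and v3: "(cmod (gf - \<mu> * g21))\<^sup>2 + (cmod \<mu>)\<^sup>2 + 1 \<le> v3"
    and v4: "(cmod (g11 - \<alpha> * g21 - \<beta> * gf) + cmod g12)\<^sup>2 + 1 + (cmod \<alpha>)\<^sup>2 + (cmod \<beta>)\<^sup>2 \<le> v4"
  shows "(1 - error1 ch N M1 M2 c) * ln (real M1) + 2 * ((1 - error2 ch N M1 M2 c) * ln (real M2)) - 3 * ln 2
    \<le> real N * (ln v1 + ln v2 + ln v3 + ln v4)"
proof -
  have v0: "v1 > 0" "v2 > 0" "v3 > 0" "v4 > 0"
    using v1 v2 v3 v4 by (smt (verit) zero_le_power2)+
  let ?\<phi> = "\<lambda>w1 w2 f t1 t2. gain2 w2 (y2_of w2 f t1) * vec_gauss N v1 (y2_of w2 f t1) / caus f t1"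
  let ?\<psi> = "\<lambda>w1 w2 f t1 t2. gain2 w2 (y2_of w2 f t1) * mix2 f t2 *
      vec_gauss N v2 (\<lambda>i. y2_of w2 f t1 i - (g21 * xs1 w1 i + \<gamma> * t2 i)) /
      (vec_gauss N 1 (\<lambda>i. t1 i - g21 * xs1 w1 i) * dens2 w2 f t2)"
  let ?\<eta> = "\<lambda>w1 w2 f t1 t2. gain1 w1 (y1_of w1 t2) * caus f t1 * vec_gauss N v3 (\<lambda>i. f i - \<mu> * t1 i) *
      vec_gauss N v4 (\<lambda>i. y1_of w1 t2 i - (\<alpha> * t1 i + \<beta> * f i)) / (dens1 w1 f t1 * mix2 f t2)"
  let ?r1 = "resid g21 g22 0 1 0" and ?r2 = "resid 0 (g22 - \<gamma> * g12) (- \<gamma>) 1 0"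
  let ?r3 = "resid (gf - \<mu> * g21) 0 0 (- \<mu>) 1" and ?r4 = "resid (g11 - \<alpha> * g21 - \<beta> * gf) g12 1 (- \<alpha>) (- \<beta>)"
  note gap1 = gap_bound[OF P N _ v0(1), of g21 g22 0 1 0 Z2, simplified, OF v1]
  note gap2 = gap_bound[OF P N _ v0(2), of 0 "g22 - \<gamma> * g12" "- \<gamma>" 1 0 Z2, simplified, OF v2]
  note gap3 = gap_bound[OF P N _ v0(3), of "gf - \<mu> * g21" 0 0 "- \<mu>" 1 Zf, simplified, OF v3]
  note gap4 = gap_bound[OF P N _ v0(4), of "g11 - \<alpha> * g21 - \<beta> * gf" g12 1 "- \<alpha>" "- \<beta>" Z1, simplified, OF v4]
  have r1: "vec_gauss N v1 (y2_of (W2 \<omega>) (Fv \<omega>) (T1v \<omega>)) = vec_gauss N v1 (?r1 \<omega>)" for \<omega>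
    by (rule vec_gauss_cong) (simp add: at_outcome_components resid_def algebra_simps)
  have r2: "vec_gauss N v2 (\<lambda>i. y2_of (W2 \<omega>) (Fv \<omega>) (T1v \<omega>) i - (g21 * xs1 (W1 \<omega>) i + \<gamma> * T2v \<omega> i))
      = vec_gauss N v2 (?r2 \<omega>)" for \<omega>
    by (rule vec_gauss_cong) (simp add: at_outcome_components resid_def algebra_simps)
  have r3: "vec_gauss N v3 (\<lambda>i. Fv \<omega> i - \<mu> * T1v \<omega> i) = vec_gauss N v3 (?r3 \<omega>)" for \<omega>
    by (rule vec_gauss_cong) (simp add: at_outcome_components resid_def algebra_simps)
  have r4: "vec_gauss N v4 (\<lambda>i. y1_of (W1 \<omega>) (T2v \<omega>) i - (\<alpha> * T1v \<omega> i + \<beta> * Fv \<omega> i))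
      = vec_gauss N v4 (?r4 \<omega>)" for \<omega>
    by (rule vec_gauss_cong) (simp add: at_outcome_components resid_def algebra_simps)
  have "(\<integral>\<omega>. log_gain1 \<omega> + 2 * log_gain2 \<omega> \<partial>\<Omega>) \<le> (\<integral>\<omega>. gap v1 ?r1 Z2 \<omega> \<partial>\<Omega>)
     + (\<integral>\<omega>. gap v2 ?r2 Z2 \<omega> \<partial>\<Omega>) + (\<integral>\<omega>. gap v3 ?r3 Zf \<omega> \<partial>\<Omega>) + (\<integral>\<omega>. gap v4 ?r4 Z1 \<omega> \<partial>\<Omega>)"
  proof (rule gains_le_gaps[where \<phi> = ?\<phi> and \<psi> = ?\<psi> and \<eta> = ?\<eta>])
    show "meas3 (?\<phi> w1 w2)" "meas3 (?\<psi> w1 w2)" "meas3 (?\<eta> w1 w2)" for w1 w2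
      by (intro meas3I; measurable)+
    show "?\<phi> w1 w2 f t1 t2 > 0" "?\<psi> w1 w2 f t1 t2 > 0" "?\<eta> w1 w2 f t1 t2 > 0" for w1 w2 f t1 t2
      by (intro mult_pos_pos divide_pos_pos gain_pos vec_gauss_pos v0 zero_less_one caus_pos mix2_pos dens1_pos dens2_pos)+
    show "expect ?\<phi> \<le> 1" by (rule expect_ratio_A2[OF v0(1)])
    show "expect ?\<psi> \<le> 1" by (rule expect_ratio_B2[OF v0(2)])
    show "expect ?\<eta> \<le> 1" by (rule expect_ratio_C2[OF v0(3,4)])
    show "integrable \<Omega> (\<lambda>\<omega>. log_gain1 \<omega> + 2 * log_gain2 \<omega>)"
      using log_gain1 log_gain2 by simp
    fix \<omega>
    have pos: "vec_gauss N 1 (\<lambda>i. Z1 i \<omega>) > 0" "vec_gauss N 1 (\<lambda>i. Z2 i \<omega>) > 0" "vec_gauss N 1 (\<lambda>i. Zf i \<omega>) > 0"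
      by (simp_all add: vec_gauss_pos)
    show "ln (at_outcome ?\<phi> \<omega>) + ln (at_outcome ?\<psi> \<omega>) + ln (at_outcome ?\<eta> \<omega>) =
        log_gain1 \<omega> + 2 * log_gain2 \<omega> - (gap v1 ?r1 Z2 \<omega> + gap v2 ?r2 Z2 \<omega> + gap v3 ?r3 Zf \<omega> + gap v4 ?r4 Z1 \<omega>)"
      unfolding at_outcome_def dens_outcome r1 r2 r3 r4 gap_def log_gain1_def log_gain2_def
      using pos v0 by (simp add: ln_mult_pos ln_divide_pos gain_pos vec_gauss_pos caus_pos mix2_pos)
  qed (fact gap1(1) gap2(1) gap3(1) gap4(1))+
  then show ?thesis
    using gap1(2) gap2(2) gap3(2) gap4(2) log_gain1 log_gain2 by (simp add: distrib_left)
qed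

end

section \<open>From block bounds to rates, and the choice of estimators\<close>

lemma num_messages_bounds:
  assumes R: "R \<ge> 0"
  shows "1 \<le> num_messages N R" and "(real N * R - 1) * ln 2 \<le> ln (real (num_messages N R))"
proof -
  let ?x = "2 powr (real N * R)"
  have x: "?x \<ge> 1" using R by (simp add: ge_one_powr_ge_zero)
  then have fl: "\<lfloor>?x\<rfloor> \<ge> 1" by simp
  then have M: "real (num_messages N R) = of_int \<lfloor>?x\<rfloor>"
    by (simp add: num_messages_def)
  show 1: "1 \<le> num_messages N R"
    using fl by (simp add: num_messages_def le_nat_iff)
  \<comment> \<open>Rounding down a number that is at least 1 loses at most a factor 2, i.e. one bit
    per block.\<close>
  have "?x / 2 \<le> of_int \<lfloor>?x\<rfloor>"
    using fl floor_correct[of ?x] by linarith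
  then have "ln (?x / 2) \<le> ln (real (num_messages N R))"
    using x M by (intro ln_mono) auto
  then show "(real N * R - 1) * ln 2 \<le> ln (real (num_messages N R))"
    using x by (simp add: ln_divide_pos ln_powr algebra_simps)
qed

text \<open>For fixed \<open>\<epsilon>\<close> the constants \<open>a\<close> and \<open>b\<close>
  vanish against \<open>N\<close>; only afterwards does \<open>\<epsilon>\<close> tend to 0.\<close>

lemma rate_le_of_blocks:
  fixes T K a b :: real
  assumes ev: "\<And>\<epsilon>. 0 < \<epsilon> \<Longrightarrow> \<epsilon> < 1 \<Longrightarrow>
    \<forall>\<^sub>F N in sequentially. (1 - \<epsilon>) * (real N * T - a) - b \<le> real N * K"
  shows "T \<le> K"
proof -
  have step: "(1 - \<epsilon>) * T \<le> K" if \<epsilon>: "0 < \<epsilon>" "\<epsilon> < 1" for \<epsilon>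
  proof (rule ccontr)
    assume "\<not> (1 - \<epsilon>) * T \<le> K"
    then have \<delta>: "(1 - \<epsilon>) * T - K > 0" by simp
    have "\<forall>\<^sub>F N in sequentially. real N > ((1 - \<epsilon>) * a + b) / ((1 - \<epsilon>) * T - K)"
      using filterlim_real_sequentially by (simp add: filterlim_at_top_dense)
    with ev[OF \<epsilon>] have "\<forall>\<^sub>F N::nat in sequentially. False"
    proof eventually_elim
      case (elim N)
      then have "(1 - \<epsilon>) * a + b < real N * ((1 - \<epsilon>) * T - K)"
        using \<delta> by (simp add: divide_less_eq)
      with elim(1) show False by (simp add: algebra_simps)
    qed
    then show False by simp
  qed
  show ?thesis
  proof (rule field_le_epsilon)
    fix e :: real assume e: "e > 0"
    \<comment> \<open>Chosen so that \<open>\<epsilon> < 1\<close> and the loss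
      \<open>\<epsilon> * T\<close> is at most \<open>e\<close>, for either sign of
      \<open>T\<close>.\<close>
    define \<epsilon> where "\<epsilon> = min (1 / 2) (e / (1 + \<bar>T\<bar>))"
    have \<epsilon>: "0 < \<epsilon>" "\<epsilon> < 1" using e by (auto simp: \<epsilon>_def)
    have "\<epsilon> * T \<le> \<epsilon> * (1 + \<bar>T\<bar>)" using \<epsilon> by (intro mult_left_mono) auto
    also have "\<dots> \<le> e / (1 + \<bar>T\<bar>) * (1 + \<bar>T\<bar>)" by (intro mult_right_mono) (auto simp: \<epsilon>_def)
    also have "\<dots> = e" by (simp add: add_nonneg_eq_0_iff)
    finally show "T \<le> K + e" using step[OF \<epsilon>] by (simp add: algebra_simps)
  qed
qed

text \<open>The coefficients of least mean square error for estimating \<open>g * X\<close>, with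
  \<open>X\<close> of unit power, from \<open>h1 * X\<close> and \<open>h2 * X\<close> in
  independent unit noises. Leftover signal and amplified noise are stated separately, since the
  leftover may add coherently to another input while the noise only adds in power.\<close>

lemma linear_estimator:
  fixes g h1 h2 :: complex
  defines "d \<equiv> 1 + (cmod h1)\<^sup>2 + (cmod h2)\<^sup>2"
  obtains a b where "cmod (g - a * h1 - b * h2) = cmod g / d"
    and "(cmod a)\<^sup>2 + (cmod b)\<^sup>2 = (cmod g)\<^sup>2 * (d - 1) / d\<^sup>2"
proof -
  have d: "d > 0" unfolding d_def by (meson add_pos_nonneg zero_less_one zero_le_power2)
  let ?a = "g * cnj h1 / of_real d" and ?b = "g * cnj h2 / of_real d"
  have "g - ?a * h1 - ?b * h2 = g * (of_real d - cnj h1 * h1 - cnj h2 * h2) / of_real d"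
    using d by (simp add: field_simps)
  also have "of_real d - cnj h1 * h1 - cnj h2 * h2 = (1 :: complex)"
    unfolding d_def mult.commute[of "cnj _"] by (simp add: complex_norm_square[symmetric])
  finally have "cmod (g - ?a * h1 - ?b * h2) = cmod g / d"
    using d by (simp add: norm_divide)
  moreover have "(cmod ?a)\<^sup>2 + (cmod ?b)\<^sup>2 = (cmod g)\<^sup>2 * (d - 1) / d\<^sup>2"
  proof -
    have "(cmod ?a)\<^sup>2 + (cmod ?b)\<^sup>2 = (cmod g)\<^sup>2 * ((cmod h1)\<^sup>2 + (cmod h2)\<^sup>2) / d\<^sup>2"
      using d by (simp add: norm_mult norm_divide power_divide power_mult_distrib add_divide_distrib distrib_left)
    then show ?thesis by (simp add: d_def)
  qed
  ultimately show ?thesis using that by blast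
qed

lemma weighted_rate_le:
  fixes a b K :: real
  assumes cap: "(R1, R2) \<in> capacity_region ch" and ab: "a \<ge> 0" "b \<ge> 0"
    and bound: "\<And>c N M1 M2. coded_channel c N M1 M2 \<Longrightarrow> power_constraint ch N M1 M2 c \<Longrightarrow> 1 \<le> N \<Longrightarrow>
      a * ((1 - error1 ch N M1 M2 c) * ln (real M1)) + b * ((1 - error2 ch N M1 M2 c) * ln (real M2)) - 3 * ln 2
        \<le> real N * (K * ln 2)"
  shows "a * R1 + b * R2 \<le> K"
\<comment> \<open>In bits per block, \<open>a + b\<close> accounts for rounding the numbers of
  messages and \<open>3\<close> for the factors \<open>1 / 2\<close> in the three decoding
  rewards.\<close>
proof (rule rate_le_of_blocks[where a = "a + b" and b = 3])
  have R: "R1 \<ge> 0" "R2 \<ge> 0"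
    using cap by (auto simp: capacity_region_def)
  fix \<epsilon> :: real assume \<epsilon>: "0 < \<epsilon>" "\<epsilon> < 1"
  obtain c where "\<forall>\<^sub>F N in sequentially.
      measurable_code N (c N) \<and> power_constraint ch N (num_messages N R1) (num_messages N R2) (c N) \<and>
      max (error1 ch N (num_messages N R1) (num_messages N R2) (c N))
        (error2 ch N (num_messages N R1) (num_messages N R2) (c N)) \<le> \<epsilon>"
    using cap \<epsilon> unfolding capacity_region_def eps_achievable_def Let_def by blast
  then show "\<forall>\<^sub>F N in sequentially. (1 - \<epsilon>) * (real N * (a * R1 + b * R2) - (a + b)) - 3 \<le> real N * K"
    using eventually_ge_at_top[of 1]
  proof eventually_elim
    case (elim N)
    let ?M1 = "num_messages N R1" and ?M2 = "num_messages N R2"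
    let ?e1 = "error1 ch N ?M1 ?M2 (c N)" and ?e2 = "error2 ch N ?M1 ?M2 (c N)"
    note m1 = num_messages_bounds[OF R(1), of N] and m2 = num_messages_bounds[OF R(2), of N]
    have "coded_channel (c N) N ?M1 ?M2"
      using elim m1 m2 by unfold_locales auto
    then have B: "a * ((1 - ?e1) * ln (real ?M1)) + b * ((1 - ?e2) * ln (real ?M2)) - 3 * ln 2 \<le> real N * (K * ln 2)"
      using elim by (intro bound) auto
    have l: "(1 - \<epsilon>) * ((real N * R - 1) * ln 2) \<le> (1 - e) * ln (real M)"
      if "e \<le> \<epsilon>" "1 \<le> M" "(real N * R - 1) * ln 2 \<le> ln (real M)" for e R and M :: nat
    proof -
      have "(1 - \<epsilon>) * ((real N * R - 1) * ln 2) \<le> (1 - \<epsilon>) * ln (real M)"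
        using \<epsilon> that by (intro mult_left_mono) auto
      also have "\<dots> \<le> (1 - e) * ln (real M)"
        using that by (intro mult_right_mono) auto
      finally show ?thesis .
    qed
    have "a * ((1 - \<epsilon>) * ((real N * R1 - 1) * ln 2)) + b * ((1 - \<epsilon>) * ((real N * R2 - 1) * ln 2)) - 3 * ln 2
        \<le> real N * (K * ln 2)"
      using mult_left_mono[OF l[OF _ m1] ab(1), of ?e1] mult_left_mono[OF l[OF _ m2] ab(2), of ?e2] elim B
      by simp
    then have "((1 - \<epsilon>) * (real N * (a * R1 + b * R2) - (a + b)) - 3) * ln 2 \<le> (real N * K) * ln 2"
      by (simp add: algebra_simps)
    then show ?case by (simp add: mult_le_cancel_right)
  qed
qed

lemma linear_estimator_single:
  fixes g h :: complex
  obtains a where "cmod (g - a * h) = cmod g / (1 + (cmod h)\<^sup>2)"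
    and "(cmod a)\<^sup>2 \<le> (cmod g)\<^sup>2 * (cmod h)\<^sup>2 / (1 + (cmod h)\<^sup>2)\<^sup>2"
proof (rule linear_estimator[of g h 0])
  fix a b assume "cmod (g - a * h - b * 0) = cmod g / (1 + (cmod h)\<^sup>2 + (cmod 0)\<^sup>2)"
    and "(cmod a)\<^sup>2 + (cmod b)\<^sup>2 = (cmod g)\<^sup>2 * (1 + (cmod h)\<^sup>2 + (cmod 0)\<^sup>2 - 1) / (1 + (cmod h)\<^sup>2 + (cmod 0)\<^sup>2)\<^sup>2"
  moreover from this(2) have "(cmod a)\<^sup>2 + (cmod b)\<^sup>2 = (cmod g)\<^sup>2 * (cmod h)\<^sup>2 / (1 + (cmod h)\<^sup>2)\<^sup>2"
    by simp
  then have "(cmod a)\<^sup>2 \<le> (cmod g)\<^sup>2 * (cmod h)\<^sup>2 / (1 + (cmod h)\<^sup>2)\<^sup>2"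
    using zero_le_power2[of "cmod b"] by linarith
  ultimately show thesis using that[of a] by simp
qed

lemma estimation_error_sum: "(d :: real) > 0 \<Longrightarrow> (x / d)\<^sup>2 + x\<^sup>2 * (d - 1) / d\<^sup>2 = x\<^sup>2 / d"
  by (simp add: power_divide power2_eq_square field_simps)

context coded_channel
begin

lemma gain_norms:
  assumes "snr1 ch > 0" "snr2 ch > 0" "inr1 ch > 0" "inr2 ch > 0" "coop ch > 0"
  shows "cmod g11 = sqrt (snr1 ch)" "cmod g22 = sqrt (snr2 ch)"
    "cmod g12 = sqrt (inr2 ch)" "cmod g21 = sqrt (inr1 ch)" "cmod gf = sqrt (coop ch)"
  using assms by (simp_all add: g11_def g22_def g12_def g21_def gf_def norm_mult)

lemma two_R1_plus_R2_block:
  assumes P: "power_constraint ch N M1 M2 c" and N: "1 \<le> N"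
    and ch: "snr1 ch = S1" "snr2 ch = S2" "inr1 ch = I1" "inr2 ch = I2" "coop ch = C"
    and pos: "S1 > 0" "S2 > 0" "I1 > 0" "I2 > 0" "C > 0"
  shows "2 * ((1 - error1 ch N M1 M2 c) * ln (real M1)) + 1 * ((1 - error2 ch N M1 M2 c) * ln (real M2)) - 3 * ln 2
    \<le> real N * ((log 2 (1 + (sqrt S1 + sqrt I2)\<^sup>2) + log 2 (1 + C)
        + log 2 (1 + S1 / (1 + I1 + C)) + log 2 (1 + I1 / C + S2 / I2)) * ln 2)"
proof -
  have g: "cmod g11 = sqrt S1" "cmod g22 = sqrt S2" "cmod g12 = sqrt I2" "cmod g21 = sqrt I1" "cmod gf = sqrt C"
    using gain_norms pos unfolding ch by auto
  \<comment> \<open>Once \<open>X2\<close> is known, what remains of \<open>Y1\<close> is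
    \<open>g11 * X1 + Z1\<close>, and its signal is estimated from \<open>T1\<close> and
    \<open>Yf\<close>.\<close>
  obtain \<alpha> \<beta> where ab: "cmod (g11 - \<alpha> * g21 - \<beta> * gf) = sqrt S1 / (1 + I1 + C)"
    "(cmod \<alpha>)\<^sup>2 + (cmod \<beta>)\<^sup>2 = S1 * (1 + I1 + C - 1) / (1 + I1 + C)\<^sup>2"
    by (rule linear_estimator[of g11 g21 gf]) (use pos in \<open>auto simp: g\<close>)
  have nz: "g12 \<noteq> 0" "gf \<noteq> 0"
    using g pos by auto
  have v3: "(cmod (g11 - \<alpha> * g21 - \<beta> * gf))\<^sup>2 + 1 + (cmod \<alpha>)\<^sup>2 + (cmod \<beta>)\<^sup>2 \<le> 1 + S1 / (1 + I1 + C)"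
    using estimation_error_sum[of "1 + I1 + C" "sqrt S1"] ab pos by simp
  \<comment> \<open>The zero-forcing coefficients are \<open>g22 / g12\<close> for \<open>T2\<close>
    and \<open>g21 / gf\<close> for \<open>Yf\<close>, with squared moduli \<open>S2 / I2\<close>
    and \<open>I1 / C\<close>.\<close>
  have v4: "(cmod (g22 / g12))\<^sup>2 + 1 + (cmod (g21 / gf))\<^sup>2 \<le> 1 + I1 / C + S2 / I2"
    using pos by (simp add: norm_divide g power_divide)
  have "2 * ((1 - error1 ch N M1 M2 c) * ln (real M1)) + (1 - error2 ch N M1 M2 c) * ln (real M2) - 3 * ln 2
    \<le> real N * (ln (1 + (sqrt S1 + sqrt I2)\<^sup>2) + ln (1 + C) + ln (1 + S1 / (1 + I1 + C)) + ln (1 + I1 / C + S2 / I2))"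
    by (rule two_R1_plus_R2_bound[OF P N _ _ v3 v4]) (use nz pos in \<open>simp_all add: g\<close>)
  then show ?thesis by (simp add: log_def distrib_right)
qed

lemma R1_plus_two_R2_block:
  assumes P: "power_constraint ch N M1 M2 c" and N: "1 \<le> N"
    and ch: "snr1 ch = S1" "snr2 ch = S2" "inr1 ch = I1" "inr2 ch = I2" "coop ch = C"
    and pos: "S1 > 0" "S2 > 0" "I1 > 0" "I2 > 0" "C > 0"
  shows "1 * ((1 - error1 ch N M1 M2 c) * ln (real M1)) + 2 * ((1 - error2 ch N M1 M2 c) * ln (real M2)) - 3 * ln 2
    \<le> real N * ((log 2 (1 + (sqrt S2 + sqrt I1)\<^sup>2) + log 2 (1 + S2 / (1 + I2))
        + log 2 (1 + I2 + (S1 + C + I2 * C + 2 * sqrt (S1 * I2)) / (1 + I1))) * ln 2)"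
proof -
  have g: "cmod g11 = sqrt S1" "cmod g22 = sqrt S2" "cmod g12 = sqrt I2" "cmod g21 = sqrt I1" "cmod gf = sqrt C"
    using gain_norms pos unfolding ch by auto
  let ?d = "1 + I1 + C"
  obtain \<alpha> \<beta> where ab: "cmod (g11 - \<alpha> * g21 - \<beta> * gf) = sqrt S1 / ?d"
    "(cmod \<alpha>)\<^sup>2 + (cmod \<beta>)\<^sup>2 = S1 * (?d - 1) / ?d\<^sup>2"
    by (rule linear_estimator[of g11 g21 gf]) (use pos in \<open>auto simp: g\<close>)
  obtain \<gamma> where c: "cmod (g22 - \<gamma> * g12) = sqrt S2 / (1 + I2)" "(cmod \<gamma>)\<^sup>2 \<le> S2 * ((1 + I2) - 1) / (1 + I2)\<^sup>2"
    by (rule linear_estimator_single[of g22 g12]) (use pos in \<open>auto simp: g\<close>)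
  obtain \<mu> where m: "cmod (gf - \<mu> * g21) = sqrt C / (1 + I1)" "(cmod \<mu>)\<^sup>2 \<le> C * ((1 + I1) - 1) / (1 + I1)\<^sup>2"
    by (rule linear_estimator_single[of gf g21]) (use pos in \<open>auto simp: g\<close>)
  \<comment> \<open>The estimator aims at \<open>g11 * X1\<close> only. Its leftover amplitude
    \<open>sqrt S1 / ?d\<close> adds coherently to \<open>sqrt I2\<close>, which produces the term
    \<open>2 * sqrt (S1 * I2) / ?d\<close>.\<close>
  let ?v4 = "1 + I2 + (S1 + 2 * sqrt (S1 * I2)) / ?d"
  have v2: "(cmod (g22 - \<gamma> * g12))\<^sup>2 + (cmod \<gamma>)\<^sup>2 + 1 \<le> 1 + S2 / (1 + I2)"
    using estimation_error_sum[of "1 + I2" "sqrt S2"] c pos by simp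
  have v3: "(cmod (gf - \<mu> * g21))\<^sup>2 + (cmod \<mu>)\<^sup>2 + 1 \<le> 1 + C / (1 + I1)"
    using estimation_error_sum[of "1 + I1" "sqrt C"] m pos by simp
  have "(sqrt S1 / ?d + sqrt I2)\<^sup>2 = (sqrt S1 / ?d)\<^sup>2 + I2 + 2 * sqrt (S1 * I2) / ?d"
    using pos by (simp add: power2_sum real_sqrt_mult)
  then have v4: "(cmod (g11 - \<alpha> * g21 - \<beta> * gf) + cmod g12)\<^sup>2 + 1 + (cmod \<alpha>)\<^sup>2 + (cmod \<beta>)\<^sup>2 \<le> ?v4"
    using estimation_error_sum[of ?d "sqrt S1"] ab pos by (simp add: g add_divide_distrib)
  have "(1 - error1 ch N M1 M2 c) * ln (real M1) + 2 * ((1 - error2 ch N M1 M2 c) * ln (real M2)) - 3 * ln 2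
    \<le> real N * (ln (1 + (sqrt S2 + sqrt I1)\<^sup>2) + ln (1 + S2 / (1 + I2)) + ln (1 + C / (1 + I1)) + ln ?v4)"
    by (rule R1_plus_two_R2_bound[OF P N _ v2 v3 v4]) (use pos in \<open>simp add: g add.commute\<close>)
  also have "ln (1 + (sqrt S2 + sqrt I1)\<^sup>2) + ln (1 + S2 / (1 + I2)) + ln (1 + C / (1 + I1)) + ln ?v4
    = ln (1 + (sqrt S2 + sqrt I1)\<^sup>2) + ln (1 + S2 / (1 + I2)) + ln ((1 + C / (1 + I1)) * ?v4)"
    using pos by (subst ln_mult_pos) (auto intro!: add_pos_nonneg)
  \<comment> \<open>The variance \<open>1 + C / (1 + I1)\<close> equals \<open>?d / (1 + I1)\<close>
    and so cancels the denominator \<open>?d\<close> inside \<open>?v4\<close>; this merges two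
    logarithms into the last one of the claim.\<close>
  also have "(1 + C / (1 + I1)) * ?v4 = 1 + I2 + (S1 + C + I2 * C + 2 * sqrt (S1 * I2)) / (1 + I1)"
  proof -
    have frac: "d / k * (m + x / d) = (m * d + x) / k" if "d > 0" for d k m x :: real
    proof -
      have "m + x / d = (m * d + x) / d" using that by (simp add: add_divide_distrib)
      then show ?thesis using that by simp
    qed
    have "1 + C / (1 + I1) = ?d / (1 + I1)"
      using pos by (simp add: field_simps)
    then have "(1 + C / (1 + I1)) * ?v4 = ?d / (1 + I1) * ?v4"
      by (simp only:)
    also have "\<dots> = ((1 + I2) * ?d + (S1 + 2 * sqrt (S1 * I2))) / (1 + I1)"
      by (rule frac) (use pos in simp)
    also have "\<dots> = 1 + I2 + (S1 + C + I2 * C + 2 * sqrt (S1 * I2)) / (1 + I1)"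
      using pos by (simp add: field_simps)
    finally show ?thesis .
  qed
  finally show ?thesis by (simp add: log_def distrib_right)
qed

end

theorem mainTheorem2:
  fixes S1 S2 I1 I2 C \<theta>1 \<theta>2 R1 R2 :: real
  assumes "S1 > 1" and "S2 > 1" and "I1 > 1" and "I2 > 1" and "C > 1"
    and "(R1, R2) \<in> capacity_region
           \<lparr>snr1 = S1, snr2 = S2, inr1 = I1, inr2 = I2, coop = C, phase1 = \<theta>1, phase2 = \<theta>2\<rparr>"
  shows "2 * R1 + R2 \<le> log 2 (1 + (sqrt S1 + sqrt I2)\<^sup>2) + log 2 (1 + C) + log 2 2
           + log 2 (1 + S1 / (1 + I1 + C)) + log 2 (1 + I1 / C + S2 / I2)
       \<and>
         R1 + 2 * R2 \<le> log 2 (1 + (sqrt S2 + sqrt I1)\<^sup>2) + log 2 (1 + S2 / (1 + I2))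
           + log 2 (1 + I2 + (S1 + C + I2 * C + 2 * sqrt (S1 * I2)) / (1 + I1))"
proof
  \<comment> \<open>This is sharper than the claim by \<open>log 2 2 = 1\<close>, which is then
    added as slack.\<close>
  have "2 * R1 + 1 * R2 \<le> log 2 (1 + (sqrt S1 + sqrt I2)\<^sup>2) + log 2 (1 + C)
        + log 2 (1 + S1 / (1 + I1 + C)) + log 2 (1 + I1 / C + S2 / I2)"
    by (rule weighted_rate_le[OF assms(6)], simp, simp, rule coded_channel.two_R1_plus_R2_block)
      (use assms(1-5) in simp_all)
  then show "2 * R1 + R2 \<le> log 2 (1 + (sqrt S1 + sqrt I2)\<^sup>2) + log 2 (1 + C) + log 2 2
           + log 2 (1 + S1 / (1 + I1 + C)) + log 2 (1 + I1 / C + S2 / I2)"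
    by simp
  have "1 * R1 + 2 * R2 \<le> log 2 (1 + (sqrt S2 + sqrt I1)\<^sup>2) + log 2 (1 + S2 / (1 + I2))
           + log 2 (1 + I2 + (S1 + C + I2 * C + 2 * sqrt (S1 * I2)) / (1 + I1))"
    by (rule weighted_rate_le[OF assms(6)], simp, simp, rule coded_channel.R1_plus_two_R2_block)
      (use assms(1-5) in simp_all)
  then show "R1 + 2 * R2 \<le> log 2 (1 + (sqrt S2 + sqrt I1)\<^sup>2) + log 2 (1 + S2 / (1 + I2))
           + log 2 (1 + I2 + (S1 + C + I2 * C + 2 * sqrt (S1 * I2)) / (1 + I1))"
    by simp
qed

end
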